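(* Let $1\le p,q<\infty$. For the piecewise constant interpolations $(\rho_\tau)_{\tau>0}$, $(\eta_\tau)_{\tau>0}$ of the splitting scheme there exist functions $\rho,\eta\in L^p(0,T;L^q(\Omega))$ and a sequence $\tau_k\to0$ such that $\rho_{\tau_k}\to\rho$ and $\eta_{\tau_k}\to\eta$ strongly in $L^p(0,T;L^q(\Omega))$, and moreover for every $t\in[0,T]$, $\rho_{\tau_k}(t)\to\rho(t)$ and $\eta_{\tau_k}(t)\to\eta(t)$ strongly in $L^q(\Omega)$.
   Context: Setting. $\Omega\subset\mathbb R$ is a bounded open interval and $T>0$. $BV(\Omega)$ is the space of functions $f:\bar\Omega\to\mathbb R$ with finite total variation $|f|_{BV}:=\sup_P\sum_{i=1}^{|P|-1}|f(x_{i+1})-f(x_i)|$, the supremum over finite partitions $P=\{x_1<\dots<x_{|P|}\}\subset\Omega$. A function $\chi:[0,\infty)\to\mathbb R$ is an internal energy density: $\chi\in C^0([0,\infty))\cap C^2((0,\infty))$, $\chi''>0$ on $(0,\infty)$, $\lim_{h\downarrow0}\chi'(h)=0$, and the integrals $\kappa(x):=\int_1^x\frac{\chi''(s)}{s}\,ds$ and $K(\sigma):=\int_0^\sigma\kappa(x)\,dx$ exist. Put $\mathcal E(\rho,\eta):=\int_\Omega\chi(\rho+\eta)\,dx$. The functions $F_1,F_2,G_1,G_2:[0,\infty)^2\to\mathbb R$ are bounded and Lipschitz, with $G_1(0,\eta)\ge0$ for all $\eta\ge0$ and $G_2(\rho,0)\ge0$ for all $\rho\ge0$. For $\sigma\ge0$,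 $r\in[0,1]$ set $\tilde F_i(\sigma,r)=F_i(r\sigma,(1-r)\sigma)$, $\tilde G_i(\sigma,r)=G_i(r\sigma,(1-r)\sigma)$, $A_1=\tilde F_1+\tilde G_2$, $A_2=\tilde G_1+\tilde F_2$, $A_3=\tilde F_1-\tilde F_2$, $\Sigma(\sigma,r)=\sigma(rA_1+(1-r)A_2)$, $R(\sigma,r)=r(1-r)A_3+(1-r)^2\tilde G_1-r^2\tilde G_2$. Initial data: $\rho_0,\eta_0\in BV(\Omega)\cap L^\infty(\Omega)$ nonnegative, $\sigma_0=\rho_0+\eta_0$, and $r_0\in BV(\Omega)$ with $0\le r_0\le1$ and $r_0=\rho_0/\sigma_0$ on $\{\sigma_0>0\}$. For $m>0$, $\mathcal P^m(\Omega)$ is the set of nonnegative Borel measures on $\Omega$ of total mass $m$; $W_2$ is the quadratic Wasserstein distance between measures of equal mass. Splitting scheme. Fix $\tau\in(0,1)$ and $N\in\mathbb N$ with $N\tau=T$; set $r^0=r_0$, $\sigma^0=\sigma_0$. For $n=0,\dots,N-1$: (Reaction step) for each $x\in\Omega$ solve $\dot\sigma=\Sigma(\sigma,r)$, $\dot r=R(\sigma,r)$ on $[0,\tau]$ with $\sigma(0)=\sigma^n(x)$, $r(0)=r^n(x)$, and set $\sigma^{n+1/2}(x)=\sigma(\tau)$, $r^{n+1/2}(x)=r(\tau)$, $\rho^{n+1/2}=r^{n+1/2}\sigma^{n+1/2}$, $\eta^{n+1/2}=(1-r^{n+1/2})\sigma^{n+1/2}$. (Diffusion step) with $m_1=\int_\Omega\rho^{n+1/2}$,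 $m_2=\int_\Omega\eta^{n+1/2}$, let $(\rho^{n+1},\eta^{n+1})$ be a minimiser over $\mathcal P^{m_1}(\Omega)\times\mathcal P^{m_2}(\Omega)$ of $\frac1{2\tau}\big[W_2^2(\rho,\rho^{n+1/2})+W_2^2(\eta,\eta^{n+1/2})\big]+\mathcal E(\rho,\eta)$; set $\sigma^{n+1}=\rho^{n+1}+\eta^{n+1}$ and $r^{n+1}=r^{n+1/2}\circ\mathcal T$, where $\mathcal T$ is the nondecreasing optimal transport map pushing $\sigma^{n+1}$ forward to $\sigma^{n+1/2}$. Piecewise constant interpolation: for $t\in[n\tau,(n+1)\tau)$, $\rho_\tau(t)=r^n\sigma^n$, $\eta_\tau(t)=(1-r^n)\sigma^n$. *)

theory Defs
  imports "HOL-Analysis.Analysis"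
begin

definition tv :: "(real \<Rightarrow> real) \<Rightarrow> real \<Rightarrow> real \<Rightarrow> ennreal" where
  "tv f a b = (SUP xs \<in> {xs. sorted_wrt (<) xs \<and> set xs \<subseteq> {a<..<b}}.
      ennreal (\<Sum>i<length xs - 1. \<bar>f (xs ! Suc i) - f (xs ! i)\<bar>))"

definition is_BV :: "(real \<Rightarrow> real) \<Rightarrow> real \<Rightarrow> real \<Rightarrow> bool" where
  "is_BV f a b \<longleftrightarrow> tv f a b < \<infinity>"

definition internal_energy :: "(real \<Rightarrow> real) \<Rightarrow> bool" where
  "internal_energy chi \<longleftrightarrow>
     continuous_on {0..} chi \<and>
     (\<forall>x>0. chi differentiable (at x)) \<and>
     (\<forall>x>0. deriv chi differentiable (at x)) \<and>
     continuous_on {0<..} (deriv (deriv chi)) \<and>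
     (\<forall>x>0. deriv (deriv chi) x > 0) \<and>
     ((deriv chi) \<longlongrightarrow> 0) (at_right 0) \<and>
     (\<forall>x>0. interval_lebesgue_integrable lborel 1 (ereal x) (\<lambda>s. deriv (deriv chi) s / s)) \<and>
     (\<forall>\<sigma>\<ge>0. interval_lebesgue_integrable lborel 0 (ereal \<sigma>)
                 (\<lambda>x. LBINT s=1..x. deriv (deriv chi) s / s))"

definition bdd_lip :: "(real \<Rightarrow> real \<Rightarrow> real) \<Rightarrow> bool" where
  "bdd_lip F \<longleftrightarrow>
     (\<exists>M. \<forall>x\<ge>0. \<forall>y\<ge>0. \<bar>F x y\<bar> \<le> M) \<and>
     (\<exists>L. \<forall>x1 y1 x2 y2. x1 \<ge> 0 \<and> y1 \<ge> 0 \<and> x2 \<ge> 0 \<and> y2 \<ge> 0 \<longrightarrow>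
          \<bar>F x1 y1 - F x2 y2\<bar> \<le> L * (\<bar>x1 - x2\<bar> + \<bar>y1 - y2\<bar>))"

definition tld :: "(real \<Rightarrow> real \<Rightarrow> real) \<Rightarrow> real \<Rightarrow> real \<Rightarrow> real" where
  "tld F \<sigma> r = F (r * \<sigma>) ((1 - r) * \<sigma>)"

definition SigmaR :: "(real \<Rightarrow> real \<Rightarrow> real) \<Rightarrow> (real \<Rightarrow> real \<Rightarrow> real) \<Rightarrow>
    (real \<Rightarrow> real \<Rightarrow> real) \<Rightarrow> (real \<Rightarrow> real \<Rightarrow> real) \<Rightarrow> real \<Rightarrow> real \<Rightarrow> real" where
  "SigmaR F1 F2 G1 G2 \<sigma> r =
     \<sigma> * (r * (tld F1 \<sigma> r + tld G2 \<sigma> r) + (1 - r) * (tld G1 \<sigma> r + tld F2 \<sigma> r))"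

definition RR :: "(real \<Rightarrow> real \<Rightarrow> real) \<Rightarrow> (real \<Rightarrow> real \<Rightarrow> real) \<Rightarrow>
    (real \<Rightarrow> real \<Rightarrow> real) \<Rightarrow> (real \<Rightarrow> real \<Rightarrow> real) \<Rightarrow> real \<Rightarrow> real \<Rightarrow> real" where
  "RR F1 F2 G1 G2 \<sigma> r =
     r * (1 - r) * (tld F1 \<sigma> r - tld F2 \<sigma> r) + (1 - r)\<^sup>2 * tld G1 \<sigma> r - r\<^sup>2 * tld G2 \<sigma> r"

definition reaction_sol :: "(real \<Rightarrow> real \<Rightarrow> real) \<Rightarrow> (real \<Rightarrow> real \<Rightarrow> real) \<Rightarrow> real \<Rightarrow>
    real \<Rightarrow> real \<Rightarrow> real \<Rightarrow> real \<Rightarrow> bool" where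
  "reaction_sol Sig R \<tau> s0 r0 s1 r1 \<longleftrightarrow>
     (\<exists>s r. s 0 = s0 \<and> r 0 = r0 \<and> s \<tau> = s1 \<and> r \<tau> = r1 \<and>
        (\<forall>t\<in>{0..\<tau>}. s t \<ge> 0 \<and> 0 \<le> r t \<and> r t \<le> 1 \<and>
           (s has_real_derivative Sig (s t) (r t)) (at t within {0..\<tau>}) \<and>
           (r has_real_derivative R (s t) (r t)) (at t within {0..\<tau>})))"

definition dens :: "real \<Rightarrow> real \<Rightarrow> (real \<Rightarrow> real) \<Rightarrow> real measure" where
  "dens a b f = density lborel (\<lambda>x. indicator {a<..<b} x * ennreal (f x))"

definition Pm :: "real \<Rightarrow> real \<Rightarrow> ennreal \<Rightarrow> real measure set" where
  "Pm a b m = {\<mu>. sets \<mu> = sets borel \<and> emeasure \<mu> (UNIV - {a<..<b}) = 0 \<and>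
                  emeasure \<mu> UNIV = m}"

definition W2sq :: "real measure \<Rightarrow> real measure \<Rightarrow> ennreal" where
  "W2sq \<mu> \<nu> = (INF \<pi> \<in> {\<pi> :: (real \<times> real) measure.
        sets \<pi> = sets (borel \<Otimes>\<^sub>M borel) \<and> distr \<pi> borel fst = \<mu> \<and> distr \<pi> borel snd = \<nu>}.
        \<integral>\<^sup>+ z. ennreal ((fst z - snd z)\<^sup>2) \<partial>\<pi>)"

text \<open>int_Omega chi(f+g) dx, written as chi(0)|Omega| + int (chi(f+g) - chi(0)) (chi is
  bounded below by chi(0) on [0,inf)); value +infinity allowed.\<close>
definition Eint :: "(real \<Rightarrow> real) \<Rightarrow> real \<Rightarrow> real \<Rightarrow> (real \<Rightarrow> real) \<Rightarrow> (real \<Rightarrow> real) \<Rightarrow> ereal" where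
  "Eint chi a b f g = ereal (chi 0 * (b - a)) +
      enn2ereal (\<integral>\<^sup>+ x \<in> {a<..<b}. ennreal (chi (f x + g x) - chi 0) \<partial>lborel)"

text \<open>Energy of a pair of measures: Eint of their densities if both are absolutely
  continuous, +infinity otherwise.\<close>
definition energy :: "(real \<Rightarrow> real) \<Rightarrow> real \<Rightarrow> real \<Rightarrow> real measure \<Rightarrow> real measure \<Rightarrow> ereal" where
  "energy chi a b \<mu> \<nu> = (INF fg \<in> {(f, g). set_borel_measurable borel {a<..<b} f \<and>
        set_borel_measurable borel {a<..<b} g \<and> (\<forall>x\<in>{a<..<b}. f x \<ge> 0 \<and> g x \<ge> 0) \<and>
        \<mu> = dens a b f \<and> \<nu> = dens a b g}. Eint chi a b (fst fg) (snd fg))"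

definition JKO_functional :: "(real \<Rightarrow> real) \<Rightarrow> real \<Rightarrow> real \<Rightarrow> real \<Rightarrow> real measure \<Rightarrow> real measure
    \<Rightarrow> real measure \<Rightarrow> real measure \<Rightarrow> ereal" where
  "JKO_functional chi a b \<tau> \<mu>0 \<nu>0 \<mu> \<nu> =
     enn2ereal (W2sq \<mu> \<mu>0 + W2sq \<nu> \<nu>0) * ereal (1 / (2 * \<tau>)) + energy chi a b \<mu> \<nu>"

text \<open>sig n, r n: sigma^n, r^n; sigh n, rh n: sigma^(n+1/2), r^(n+1/2);
  rho n, eta n (n >= 1): the diffusion minimisers rho^n, eta^n.
  Steps n = 0..N-1 are those with n*tau < T.\<close>
definition splitting_scheme ::
  "(real \<Rightarrow> real) \<Rightarrow> (real \<Rightarrow> real \<Rightarrow> real) \<Rightarrow> (real \<Rightarrow> real \<Rightarrow> real) \<Rightarrow>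
   (real \<Rightarrow> real \<Rightarrow> real) \<Rightarrow> (real \<Rightarrow> real \<Rightarrow> real) \<Rightarrow> real \<Rightarrow> real \<Rightarrow> real \<Rightarrow> real \<Rightarrow>
   (real \<Rightarrow> real) \<Rightarrow> (real \<Rightarrow> real) \<Rightarrow>
   (nat \<Rightarrow> real \<Rightarrow> real) \<Rightarrow> (nat \<Rightarrow> real \<Rightarrow> real) \<Rightarrow> (nat \<Rightarrow> real \<Rightarrow> real) \<Rightarrow>
   (nat \<Rightarrow> real \<Rightarrow> real) \<Rightarrow> (nat \<Rightarrow> real \<Rightarrow> real) \<Rightarrow> (nat \<Rightarrow> real \<Rightarrow> real) \<Rightarrow> bool" where
  "splitting_scheme chi F1 F2 G1 G2 a b T \<tau> \<sigma>0 r0 sig r sigh rh rho eta \<longleftrightarrow>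
     (\<forall>x\<in>{a..b}. sig 0 x = \<sigma>0 x \<and> r 0 x = r0 x) \<and>
     (\<forall>n. real n * \<tau> < T \<longrightarrow>
        (\<forall>x\<in>{a..b}. reaction_sol (SigmaR F1 F2 G1 G2) (RR F1 F2 G1 G2) \<tau>
                        (sig n x) (r n x) (sigh n x) (rh n x)) \<and>
        (let rhoh = (\<lambda>x. rh n x * sigh n x); etah = (\<lambda>x. (1 - rh n x) * sigh n x);
             m1 = emeasure (dens a b rhoh) UNIV; m2 = emeasure (dens a b etah) UNIV in
           set_borel_measurable borel {a<..<b} (rho (Suc n)) \<and>
           set_borel_measurable borel {a<..<b} (eta (Suc n)) \<and>
           (\<forall>x\<in>{a..b}. rho (Suc n) x \<ge> 0 \<and> eta (Suc n) x \<ge> 0) \<and>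
           dens a b (rho (Suc n)) \<in> Pm a b m1 \<and> dens a b (eta (Suc n)) \<in> Pm a b m2 \<and>
           (\<forall>\<mu>\<in>Pm a b m1. \<forall>\<nu>\<in>Pm a b m2.
              JKO_functional chi a b \<tau> (dens a b rhoh) (dens a b etah)
                 (dens a b (rho (Suc n))) (dens a b (eta (Suc n)))
              \<le> JKO_functional chi a b \<tau> (dens a b rhoh) (dens a b etah) \<mu> \<nu>)) \<and>
        (\<forall>x\<in>{a..b}. sig (Suc n) x = rho (Suc n) x + eta (Suc n) x) \<and>
        (\<exists>Tm. Tm \<in> borel_measurable borel \<and> mono_on {a..b} Tm \<and> Tm ` {a..b} \<subseteq> {a..b} \<and>
              distr (dens a b (sig (Suc n))) borel Tm = dens a b (sigh n) \<and>
              (\<forall>x\<in>{a..b}. r (Suc n) x = rh n (Tm x))))"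

definition admissible_step :: "real \<Rightarrow> real \<Rightarrow> bool" where
  "admissible_step T \<tau> \<longleftrightarrow> 0 < \<tau> \<and> \<tau> < 1 \<and> (\<exists>N::nat. real N * \<tau> = T)"

definition rho_interp :: "real \<Rightarrow> (nat \<Rightarrow> real \<Rightarrow> real) \<Rightarrow> (nat \<Rightarrow> real \<Rightarrow> real) \<Rightarrow> real \<Rightarrow> real \<Rightarrow> real" where
  "rho_interp \<tau> r sig t x = r (nat \<lfloor>t / \<tau>\<rfloor>) x * sig (nat \<lfloor>t / \<tau>\<rfloor>) x"

definition eta_interp :: "real \<Rightarrow> (nat \<Rightarrow> real \<Rightarrow> real) \<Rightarrow> (nat \<Rightarrow> real \<Rightarrow> real) \<Rightarrow> real \<Rightarrow> real \<Rightarrow> real" where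
  "eta_interp \<tau> r sig t x = (1 - r (nat \<lfloor>t / \<tau>\<rfloor>) x) * sig (nat \<lfloor>t / \<tau>\<rfloor>) x"

definition enn_powr :: "ennreal \<Rightarrow> real \<Rightarrow> ennreal" where
  "enn_powr x e = (if x = \<infinity> then \<infinity> else ennreal (enn2real x powr e))"

definition Lq_norm :: "real \<Rightarrow> real \<Rightarrow> real \<Rightarrow> (real \<Rightarrow> real) \<Rightarrow> ennreal" where
  "Lq_norm q a b f = enn_powr (\<integral>\<^sup>+ x \<in> {a<..<b}. ennreal (\<bar>f x\<bar> powr q) \<partial>lborel) (1 / q)"

definition LpLq_norm :: "real \<Rightarrow> real \<Rightarrow> real \<Rightarrow> real \<Rightarrow> real \<Rightarrow> (real \<Rightarrow> real \<Rightarrow> real) \<Rightarrow> ennreal" where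
  "LpLq_norm p q T a b f =
     enn_powr (\<integral>\<^sup>+ t \<in> {0<..<T}. enn_powr (Lq_norm q a b (f t)) p \<partial>lborel) (1 / p)"

definition in_LpLq :: "real \<Rightarrow> real \<Rightarrow> real \<Rightarrow> real \<Rightarrow> real \<Rightarrow> (real \<Rightarrow> real \<Rightarrow> real) \<Rightarrow> bool" where
  "in_LpLq p q T a b f \<longleftrightarrow>
     (\<forall>t\<in>{0<..<T}. set_borel_measurable borel {a<..<b} (f t)) \<and>
     (\<exists>g. set_borel_measurable borel ({0<..<T} \<times> {a<..<b}) (\<lambda>(t, x). g t x) \<and>
          (AE t in lborel. t \<in> {0<..<T} \<longrightarrow>
             (AE x in lborel. x \<in> {a<..<b} \<longrightarrow> f t x = g t x))) \<and>
     LpLq_norm p q T a b f < \<infinity>"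

end

theory Submission
  imports Defs
begin

text \<open>
  Densities are only determined up to null sets, so bounded variation is always measured on a conull set D,
  by a monotone function dominating the increments; the ratio r only matters where the total density
  is positive, and a vanishing density stays zero under the reaction, so that r is only estimated there.

  Diffusion step. The monotone transport map T is optimal by duality with the convex potential whose derivative
  is T. Moving a little mass from points x to points z of lower density, with the species composition carried along,
  gives a competitor, and minimality yields
  chi'(sigma x) - chi'(sigma z) <= ((z - T x)^2 - (x - T x)^2) / (2 tau) whenever sigma z < sigma x.
  Hence T maps every maximal interval of a set {sigma > K} into itself, and only mass from inside is mapped into a maximal
  interval of {sigma < K}; comparing masses, the old density exceeds (falls below) K somewhere on the same interval.
  Applied to strictly alternating finite sequences of points this shows that neither the supremum nor the variation of
  sigma increases. The variation of r does not increase because r is composed with T.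

  Reaction step. Gronwall estimates enlarge the supremum and the variations by a factor 1 + O(tau).

  Time regularity. Energy dissipation bounds the sum of the squared transport costs by O(tau), so integrals against
  Lipschitz test functions are equicontinuous in time. Averages over dyadic cells approximate a function of variation V
  in L^1 with error mesh * V, uniformly along the scheme, so convergence of all cell averages, obtained
  by a diagonal argument at rational times, upgrades to strong convergence at every time.
\<close>

section \<open>Variation on a subset of the line\<close>

definition lvar :: "(real \<Rightarrow> real) \<Rightarrow> real list \<Rightarrow> real" where
  "lvar f xs = (\<Sum>i<length xs - 1. \<bar>f (xs ! Suc i) - f (xs ! i)\<bar>)"

definition bv_on :: "real set \<Rightarrow> (real \<Rightarrow> real) \<Rightarrow> real \<Rightarrow> bool" where
  "bv_on D f V \<longleftrightarrow> (\<exists>v. mono v \<and> (\<forall>x. 0 \<le> v x \<and> v x \<le> V) \<and>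
     (\<forall>x\<in>D. \<forall>y\<in>D. x \<le> y \<longrightarrow> \<bar>f y - f x\<bar> \<le> v y - v x))"

lemma lvar_Nil [simp]: "lvar f [] = 0" and lvar_single [simp]: "lvar f [x] = 0"
  by (simp_all add: lvar_def)

lemma lvar_Cons: "lvar f (x # y # xs) = \<bar>f y - f x\<bar> + lvar f (y # xs)"
  unfolding lvar_def by (simp add: sum.lessThan_Suc_shift del: sum.lessThan_Suc)

lemma lvar_append: "lvar f (xs @ y # ys) = lvar f (xs @ [y]) + lvar f (y # ys)"
proof (induction xs)
  case (Cons x xs)
  then show ?case by (cases xs) (auto simp: lvar_Cons)
qed simp

lemma lvar_snoc: "xs \<noteq> [] \<Longrightarrow> lvar f (xs @ [y]) = lvar f xs + \<bar>f y - f (last xs)\<bar>"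
  using lvar_append[of f "butlast xs" "last xs" "[y]"] append_butlast_last_id[of xs]
  by (metis (no_types, lifting) add.right_neutral append_Cons append_Nil append_assoc lvar_Cons lvar_single)

lemma bv_on_subset: "bv_on D f V \<Longrightarrow> D' \<subseteq> D \<Longrightarrow> bv_on D' f V"
  unfolding bv_on_def by blast

lemma bv_on_nonneg: "bv_on D f V \<Longrightarrow> 0 \<le> V"
  unfolding bv_on_def by (meson order_trans)

lemma bv_on_cong: "bv_on D f V \<Longrightarrow> (\<And>x. x \<in> D \<Longrightarrow> f x = g x) \<Longrightarrow> bv_on D g V"
  unfolding bv_on_def by (metis (no_types, lifting))

lemma bv_on_lvar_le:
  assumes "bv_on D f V" "sorted_wrt (<) xs" "set xs \<subseteq> D"
  shows "lvar f xs \<le> V"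
proof -
  obtain v where v: "mono v" "\<And>x. 0 \<le> v x \<and> v x \<le> V"
    "\<And>x y. x \<in> D \<Longrightarrow> y \<in> D \<Longrightarrow> x \<le> y \<Longrightarrow> \<bar>f y - f x\<bar> \<le> v y - v x"
    using assms(1) unfolding bv_on_def by blast
  have "xs \<noteq> [] \<longrightarrow> lvar f xs \<le> v (last xs) - v (hd xs)" using assms(2,3)
  proof (induction xs rule: rev_induct)
    case (snoc y xs)
    show ?case
    proof (cases "xs = []")
      case False
      then have "last xs < y" "last xs \<in> D" "y \<in> D" using snoc.prems by (auto simp: sorted_wrt_append)
      then have "\<bar>f y - f (last xs)\<bar> \<le> v y - v (last xs)" using v(3) by simp
      moreover have "lvar f xs \<le> v (last xs) - v (hd xs)" using snoc False by (auto simp: sorted_wrt_append)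
      ultimately show ?thesis using False by (simp add: lvar_snoc)
    qed simp
  qed simp
  then show ?thesis using v(2)[of "hd xs"] v(2)[of "last xs"] by (cases "xs = []") auto
qed

lemma sorted_wrt_less_le_last:
  fixes z :: real
  assumes "sorted_wrt (<) xs" "z \<in> set xs"
  shows "z \<le> last xs"
  using assms by (induction xs rule: rev_induct) (auto simp: sorted_wrt_append order_less_imp_le)

lemma bv_on_of_lvar:
  assumes "\<And>xs. sorted_wrt (<) xs \<Longrightarrow> set xs \<subseteq> D \<Longrightarrow> lvar f xs \<le> V"
  shows "bv_on D f V"
proof -
  define S where "S x = lvar f ` {xs. sorted_wrt (<) xs \<and> set xs \<subseteq> D \<inter> {..x}}" for x
  define v where "v x = Sup (S x)" for x
  have bdd: "bdd_above (S x)" for x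
    unfolding S_def using assms by (intro bdd_aboveI[of _ V]) auto
  have ne: "0 \<in> S x" for x unfolding S_def by (auto intro!: image_eqI[of _ _ "[]"])
  have mem: "lvar f xs \<le> v x" if "sorted_wrt (<) xs" "set xs \<subseteq> D \<inter> {..x}" for xs x
    unfolding v_def by (rule cSup_upper[OF _ bdd]) (use that in \<open>auto simp: S_def\<close>)
  have "mono v"
  proof (rule monoI)
    fix x y :: real assume "x \<le> y"
    then show "v x \<le> v y" unfolding v_def
      by (intro cSup_subset_mono bdd) (use ne[of x] in \<open>force simp: S_def\<close>)+
  qed
  moreover have "0 \<le> v x \<and> v x \<le> V" for x
    unfolding v_def using ne[of x] bdd[of x] assms
    by (auto intro!: cSup_upper cSup_least simp: S_def)
  moreover have "\<bar>f y - f x\<bar> \<le> v y - v x" if xy: "x \<in> D" "y \<in> D" "x \<le> y" for x y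
  proof (cases "x = y")
    case False
    then have lt: "x < y" using xy by simp
    have "s \<le> v y - \<bar>f y - f x\<bar>" if s: "s \<in> S x" for s
    proof -
      obtain xs where xs: "s = lvar f xs" "sorted_wrt (<) xs" "set xs \<subseteq> D \<inter> {..x}"
        using s unfolding S_def by auto
      obtain zs where zs: "sorted_wrt (<) zs" "set zs \<subseteq> D \<inter> {..x}" "zs \<noteq> []" "last zs = x" "s \<le> lvar f zs"
      proof (cases "xs \<noteq> [] \<and> last xs = x")
        case True then show ?thesis using that[of xs] xs by auto
      next
        case False
        have "z < x" if z: "z \<in> set xs" for z
        proof -
          have "xs \<noteq> []" using z by auto
          then have "last xs < x" using False xs last_in_set[of xs] by fastforce
          moreover have "z \<le> last xs" using sorted_wrt_less_le_last[OF xs(2) z] .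
          ultimately show ?thesis by simp
        qed
        then have "sorted_wrt (<) (xs @ [x])" using xs by (auto simp: sorted_wrt_append)
        moreover have "s \<le> lvar f (xs @ [x])" using xs by (cases "xs = []") (auto simp: lvar_snoc)
        ultimately show ?thesis using that[of "xs @ [x]"] xs xy by auto
      qed
      have "lvar f (zs @ [y]) \<le> v y"
        by (rule mem) (use zs xy lt in \<open>auto simp: sorted_wrt_append\<close>)
      then show ?thesis using zs by (simp add: lvar_snoc)
    qed
    then have "v x \<le> v y - \<bar>f y - f x\<bar>" unfolding v_def[of x]
      by (intro cSup_least) (use ne in auto)
    then show ?thesis by simp
  qed simp
  ultimately show ?thesis unfolding bv_on_def by blast
qed

lemma bv_on_of_is_BV:
  assumes "is_BV f a b"
  obtains V where "bv_on {a<..<b} f V"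
proof -
  obtain V where V: "tv f a b = ennreal V" "0 \<le> V"
    using assms unfolding is_BV_def by (cases "tv f a b") auto
  have "lvar f xs \<le> V" if "sorted_wrt (<) xs" "set xs \<subseteq> {a<..<b}" for xs
  proof -
    have "ennreal (lvar f xs) \<le> tv f a b"
      unfolding tv_def lvar_def by (rule SUP_upper) (use that in auto)
    then show ?thesis using V by (simp add: ennreal_le_iff)
  qed
  then show ?thesis using bv_on_of_lvar that by blast
qed

lemma bv_on_combine:
  assumes g: "bv_on D g V" and h: "bv_on E h W" and "0 \<le> \<alpha>" "0 \<le> \<beta>"
    and le: "\<And>x y. x \<in> D' \<Longrightarrow> y \<in> D' \<Longrightarrow> x \<le> y \<Longrightarrow> x \<in> D \<and> y \<in> D \<and>
      \<bar>f y - f x\<bar> \<le> \<alpha> * \<bar>g y - g x\<bar> + (if x \<in> E \<and> y \<in> E then \<beta> * \<bar>h y - h x\<bar> else 0)"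
  shows "bv_on D' f (\<alpha> * V + \<beta> * W)"
proof -
  obtain v where v: "mono v" "\<And>x. 0 \<le> v x \<and> v x \<le> V"
    "\<And>x y. x \<in> D \<Longrightarrow> y \<in> D \<Longrightarrow> x \<le> y \<Longrightarrow> \<bar>g y - g x\<bar> \<le> v y - v x"
    using g unfolding bv_on_def by blast
  obtain w where w: "mono w" "\<And>x. 0 \<le> w x \<and> w x \<le> W"
    "\<And>x y. x \<in> E \<Longrightarrow> y \<in> E \<Longrightarrow> x \<le> y \<Longrightarrow> \<bar>h y - h x\<bar> \<le> w y - w x"
    using h unfolding bv_on_def by blast
  let ?u = "\<lambda>x. \<alpha> * v x + \<beta> * w x"
  have "mono ?u" using v(1) w(1) assms(3,4)
    by (intro monoI add_mono mult_left_mono) (auto dest: monoD)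
  moreover have "0 \<le> ?u x \<and> ?u x \<le> \<alpha> * V + \<beta> * W" for x
    using v(2) w(2) assms(3,4) by (auto intro!: add_mono mult_left_mono add_nonneg_nonneg)
  moreover have "\<bar>f y - f x\<bar> \<le> ?u y - ?u x" if "x \<in> D'" "y \<in> D'" "x \<le> y" for x y
  proof -
    have "\<alpha> * \<bar>g y - g x\<bar> \<le> \<alpha> * (v y - v x)"
      using le[OF that] v(3) that assms(3) by (intro mult_left_mono) auto
    moreover have "(if x \<in> E \<and> y \<in> E then \<beta> * \<bar>h y - h x\<bar> else 0) \<le> \<beta> * (w y - w x)"
      using w(3)[of x y] that assms(4) monoD[OF w(1), of x y] by (auto intro!: mult_left_mono)
    ultimately show ?thesis using le[OF that] by (simp add: algebra_simps)
  qed
  ultimately show ?thesis unfolding bv_on_def by (intro exI[of _ ?u]) blast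
qed

lemma bv_on_comp_mono:
  assumes "bv_on D f V" "mono T" "\<And>x. x \<in> D' \<Longrightarrow> T x \<in> D"
  shows "bv_on D' (\<lambda>x. f (T x)) V"
proof -
  obtain v where v: "mono v" "\<And>x. 0 \<le> v x \<and> v x \<le> V"
    "\<And>x y. x \<in> D \<Longrightarrow> y \<in> D \<Longrightarrow> x \<le> y \<Longrightarrow> \<bar>f y - f x\<bar> \<le> v y - v x"
    using assms(1) unfolding bv_on_def by blast
  show ?thesis unfolding bv_on_def
    by (rule exI[of _ "\<lambda>x. v (T x)"]) (use v assms(2,3) in \<open>auto simp: mono_def\<close>)
qed

lemma bv_on_borel_measurable:
  assumes "bv_on D f V" "D \<in> sets borel"
  shows "(\<lambda>x. indicator D x * f x :: real) \<in> borel_measurable borel"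
proof -
  obtain v where v: "mono v"
    "\<And>x y. x \<in> D \<Longrightarrow> y \<in> D \<Longrightarrow> x \<le> y \<Longrightarrow> \<bar>f y - f x\<bar> \<le> v y - v x"
    using assms(1) unfolding bv_on_def by blast
  define C where "C = {x. \<not> isCont v x}"
  have C: "countable C" unfolding C_def using mono_ctble_discont[OF v(1)] .
  have cont: "continuous_on (D - C) f"
  proof (clarsimp simp: continuous_on_iff)
    fix x e :: real assume x: "x \<in> D" "x \<notin> C" and e: "e > 0"
    then obtain d where d: "d > 0" "\<And>y. dist y x < d \<Longrightarrow> dist (v y) (v x) < e"
      unfolding C_def continuous_at_eps_delta by blast
    have "dist (f y) (f x) < e" if "y \<in> D - C" "dist y x < d" for y
    proof -
      have "\<bar>f y - f x\<bar> \<le> \<bar>v y - v x\<bar>"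
        using v(2)[of x y] v(2)[of y x] that x by (cases "x \<le> y") auto
      then show ?thesis using d(2)[OF that(2)] by (simp add: dist_real_def)
    qed
    then show "\<exists>d>0. \<forall>x'\<in>D - C. dist x' x < d \<longrightarrow> dist (f x') (f x) < e" using d(1) by blast
  qed
  have "f \<in> borel_measurable (restrict_space borel (D - C))"
    by (rule borel_measurable_continuous_on_restrict[OF cont])
  moreover have "D - C \<in> sets borel" using assms(2) C by (simp add: sets.Diff sets.countable)
  ultimately have 1: "(\<lambda>x. indicator (D - C) x * f x) \<in> borel_measurable borel"
    by (simp add: borel_measurable_restrict_space_iff)
  have 2: "(\<lambda>x. indicator (D \<inter> C) x * f x) \<in> borel_measurable borel"
  proof (rule measurable_discrete_difference[where f="\<lambda>_. 0" and X="D \<inter> C"])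
    show "countable (D \<inter> C)" using C by auto
  qed auto
  have "(\<lambda>x. indicator D x * f x) = (\<lambda>x. indicator (D - C) x * f x + indicator (D \<inter> C) x * f x)"
    by (auto simp: indicator_def)
  then show ?thesis using 1 2 by simp
qed

lemma lvar_alternating:
  assumes "sorted_wrt (<) xs" "set xs \<subseteq> D" "lvar f xs > V"
  obtains ys where "sorted_wrt (<) ys" "set ys \<subseteq> D" "lvar f ys > V"
    "\<And>i. Suc (Suc i) < length ys \<Longrightarrow> (f (ys ! i) < f (ys ! Suc i) \<and> f (ys ! Suc (Suc i)) < f (ys ! Suc i))
        \<or> (f (ys ! Suc i) < f (ys ! i) \<and> f (ys ! Suc i) < f (ys ! Suc (Suc i)))"
proof -
  have "\<exists>ys. sorted_wrt (<) ys \<and> set ys \<subseteq> D \<and> lvar f ys > V \<and>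
    (\<forall>i. Suc (Suc i) < length ys \<longrightarrow> (f (ys ! i) < f (ys ! Suc i) \<and> f (ys ! Suc (Suc i)) < f (ys ! Suc i))
        \<or> (f (ys ! Suc i) < f (ys ! i) \<and> f (ys ! Suc i) < f (ys ! Suc (Suc i))))"
    using assms
  proof (induction "length xs" arbitrary: xs rule: less_induct)
    case less
    show ?case
    proof (rule ccontr)
      assume neg: "\<not> ?thesis"
      then obtain i where i: "Suc (Suc i) < length xs"
        "\<not> (f (xs ! i) < f (xs ! Suc i) \<and> f (xs ! Suc (Suc i)) < f (xs ! Suc i))"
        "\<not> (f (xs ! Suc i) < f (xs ! i) \<and> f (xs ! Suc i) < f (xs ! Suc (Suc i)))"
        using less.prems by blast
      define us ws x y z where "us = take i xs" and "ws = drop (Suc (Suc (Suc i))) xs"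
        and "x = xs ! i" and "y = xs ! Suc i" and "z = xs ! Suc (Suc i)"
      have xs: "xs = us @ x # y # z # ws"
        unfolding us_def ws_def x_def y_def z_def using i(1)
        by (metis Cons_nth_drop_Suc Suc_lessD append_take_drop_id)
      have "lvar f xs = lvar f (us @ x # z # ws)"
        using i(2,3) unfolding x_def[symmetric] y_def[symmetric] z_def[symmetric]
        unfolding xs lvar_append[of f us x "y # z # ws"] lvar_append[of f us x "z # ws"]
        by (auto simp: lvar_Cons)
      then show False
        using less.hyps[of "us @ x # z # ws"] less.prems neg
        by (auto simp: xs sorted_wrt_append)
    qed
  qed
  then show ?thesis using that by blast
qed

section \<open>Measures with densities and quadratic transport cost\<close>

lemma dens_cong_AE:
  assumes "AE x in lborel. x \<in> {a<..<b} \<longrightarrow> f x = g x"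
  shows "dens a b f = dens a b g"
proof -
  have "(\<lambda>A. \<integral>\<^sup>+ x. indicator {a<..<b} x * ennreal (f x) * indicator A x \<partial>lborel) =
        (\<lambda>A. \<integral>\<^sup>+ x. indicator {a<..<b} x * ennreal (g x) * indicator A x \<partial>lborel)"
    by (intro ext nn_integral_cong_AE) (use assms in \<open>auto elim!: eventually_mono simp: indicator_def\<close>)
  then show ?thesis unfolding dens_def density_def by simp
qed

lemma AE_borel_subset:
  assumes "AE x in lborel. x \<in> {a<..<b::real} \<longrightarrow> P x"
  obtains D where "D \<in> sets borel" "D \<subseteq> {a<..<b}" "\<And>x. x \<in> D \<Longrightarrow> P x"
    "AE x in lborel. x \<in> {a<..<b} \<longrightarrow> x \<in> D"
proof -
  obtain N where N: "{x \<in> space lborel. \<not> (x \<in> {a<..<b} \<longrightarrow> P x)} \<subseteq> N" "N \<in> null_sets lborel"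
    using AE_E[OF assms] by (metis null_setsI)
  have "AE x in lborel. x \<in> {a<..<b} \<longrightarrow> x \<in> {a<..<b} - N"
    using AE_not_in[OF N(2)] by eventually_elim auto
  moreover have "P x" if "x \<in> {a<..<b} - N" for x using N(1) that by auto
  ultimately show ?thesis using that[of "{a<..<b} - N"] N(2) by (auto simp: null_sets_def)
qed

lemma space_dens [simp]: "space (dens a b f) = UNIV" and sets_dens [measurable_cong, simp]: "sets (dens a b f) = sets borel"
  by (simp_all add: dens_def)

lemma nn_integral_dens:
  assumes [measurable]: "f \<in> borel_measurable borel" "u \<in> borel_measurable borel"
  shows "(\<integral>\<^sup>+ x. u x \<partial>dens a b f) = (\<integral>\<^sup>+ x. ennreal (f x) * u x * indicator {a<..<b} x \<partial>lborel)"
  unfolding dens_def by (subst nn_integral_density) (auto intro!: nn_integral_cong simp: mult_ac)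

lemma emeasure_dens:
  assumes [measurable]: "f \<in> borel_measurable borel" "A \<in> sets borel"
  shows "emeasure (dens a b f) A = (\<integral>\<^sup>+ x. ennreal (f x) * indicator (A \<inter> {a<..<b}) x \<partial>lborel)"
  unfolding dens_def by (subst emeasure_density) (auto intro!: nn_integral_cong simp: indicator_def)

lemma AE_dens:
  assumes [measurable]: "f \<in> borel_measurable borel"
  shows "(AE x in dens a b f. P x) \<longleftrightarrow> (AE x in lborel. x \<in> {a<..<b} \<and> f x > 0 \<longrightarrow> P x)"
  unfolding dens_def by (subst AE_density) (auto simp: indicator_def intro!: arg_cong[where f="\<lambda>P. eventually P _"])

lemma dens_eq_iff:
  assumes [measurable]: "f \<in> borel_measurable borel" "g \<in> borel_measurable borel"
    and "\<And>x. x \<in> {a<..<b} \<Longrightarrow> 0 \<le> f x" "\<And>x. x \<in> {a<..<b} \<Longrightarrow> 0 \<le> g x"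
  shows "dens a b f = dens a b g \<longleftrightarrow> (AE x in lborel. x \<in> {a<..<b} \<longrightarrow> f x = g x)"
proof -
  have "dens a b f = dens a b g \<longleftrightarrow>
      (AE x in lborel. indicator {a<..<b} x * ennreal (f x) = indicator {a<..<b} x * ennreal (g x))"
    unfolding dens_def by (rule sigma_finite_measure.density_unique_iff[OF sigma_finite_lborel]) auto
  also have "\<dots> \<longleftrightarrow> (AE x in lborel. x \<in> {a<..<b} \<longrightarrow> f x = g x)"
    by (rule AE_cong) (use assms(3,4) in \<open>auto simp: indicator_def\<close>)
  finally show ?thesis .
qed

lemma W2sq_distr_le:
  assumes [measurable]: "X \<in> borel_measurable M" "Y \<in> borel_measurable M"
  shows "W2sq (distr M borel X) (distr M borel Y) \<le> (\<integral>\<^sup>+ w. ennreal ((X w - Y w)\<^sup>2) \<partial>M)"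
proof -
  let ?p = "distr M (borel \<Otimes>\<^sub>M borel) (\<lambda>w. (X w, Y w))"
  have "W2sq (distr M borel X) (distr M borel Y) \<le> (\<integral>\<^sup>+ z. ennreal ((fst z - snd z)\<^sup>2) \<partial>?p)"
    unfolding W2sq_def by (rule INF_lower) (auto simp: distr_distr comp_def)
  also have "\<dots> = (\<integral>\<^sup>+ w. ennreal ((X w - Y w)\<^sup>2) \<partial>M)"
    by (subst nn_integral_distr) auto
  finally show ?thesis .
qed

lemma W2sq_dual_bound:
  assumes [measurable]: "A \<in> borel_measurable borel" "B \<in> borel_measurable borel"
    and K: "\<And>x. \<bar>A x\<bar> \<le> K" "\<And>x. \<bar>B x\<bar> \<le> K" and le: "\<And>x y. A x + B y \<le> (x - y)\<^sup>2"
    and fin: "emeasure \<mu> UNIV < \<infinity>" and sets: "sets \<mu> = sets borel" "sets \<nu> = sets borel"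
  shows "(\<integral>\<^sup>+ x. ennreal (A x + K) \<partial>\<mu>) + (\<integral>\<^sup>+ y. ennreal (B y + K) \<partial>\<nu>) \<le> W2sq \<mu> \<nu> + ennreal (2 * K) * emeasure \<mu> UNIV"
    (is "?L \<le> _ + ?c")
proof -
  have K0: "0 \<le> K" using K(1)[of 0] by simp
  have "?L - ?c \<le> W2sq \<mu> \<nu>" unfolding W2sq_def
  proof (rule INF_greatest)
    fix \<pi> :: "(real \<times> real) measure"
    assume "\<pi> \<in> {\<pi>. sets \<pi> = sets (borel \<Otimes>\<^sub>M borel) \<and> distr \<pi> borel fst = \<mu> \<and> distr \<pi> borel snd = \<nu>}"
    then have \<pi>: "sets \<pi> = sets (borel \<Otimes>\<^sub>M borel)" "\<mu> = distr \<pi> borel fst" "\<nu> = distr \<pi> borel snd"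
      by auto
    note [measurable_cong] = \<pi>(1)
    have "?L = (\<integral>\<^sup>+ z. ennreal (A (fst z) + K) \<partial>\<pi>) + (\<integral>\<^sup>+ z. ennreal (B (snd z) + K) \<partial>\<pi>)"
      unfolding \<pi>(2,3) by (simp add: nn_integral_distr)
    also have "\<dots> = (\<integral>\<^sup>+ z. ennreal (A (fst z) + K) + ennreal (B (snd z) + K) \<partial>\<pi>)"
      by (subst nn_integral_add) auto
    also have "\<dots> \<le> (\<integral>\<^sup>+ z. ennreal ((fst z - snd z)\<^sup>2) + ennreal (2 * K) \<partial>\<pi>)"
    proof (rule nn_integral_mono)
      fix z :: "real \<times> real"
      have "0 \<le> A (fst z) + K" "0 \<le> B (snd z) + K" using K(1)[of "fst z"] K(2)[of "snd z"] by linarith+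
      moreover have "A (fst z) + K + (B (snd z) + K) \<le> (fst z - snd z)\<^sup>2 + 2 * K" using le[of "fst z" "snd z"] by linarith
      ultimately show "ennreal (A (fst z) + K) + ennreal (B (snd z) + K) \<le> ennreal ((fst z - snd z)\<^sup>2) + ennreal (2 * K)"
        using K0 by (simp flip: ennreal_plus add: ennreal_leI)
    qed
    also have "\<dots> = (\<integral>\<^sup>+ z. ennreal ((fst z - snd z)\<^sup>2) \<partial>\<pi>) + ennreal (2 * K) * emeasure \<pi> (space \<pi>)"
      by (subst nn_integral_add) auto
    also have "emeasure \<pi> (space \<pi>) = emeasure \<mu> UNIV"
      unfolding \<pi>(2) by (subst emeasure_distr) auto
    finally show "?L - ?c \<le> (\<integral>\<^sup>+ z. ennreal ((fst z - snd z)\<^sup>2) \<partial>\<pi>)"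
      using fin unfolding ennreal_minus_le_iff
      by (auto simp: add.commute ennreal_mult_eq_top_iff)
  qed
  moreover have "?c \<noteq> \<infinity>" using fin by (auto simp: ennreal_mult_eq_top_iff)
  ultimately show ?thesis by (auto simp: ennreal_minus_le_iff add.commute)
qed

lemma monotone_dual_potentials:
  fixes T :: "real \<Rightarrow> real"
  assumes "a < b" "mono T" "\<And>x. T x \<in> {a..b}"
  obtains A B K where "A \<in> borel_measurable borel" "B \<in> borel_measurable borel"
    "\<And>x. \<bar>A x\<bar> \<le> K" "\<And>x. \<bar>B x\<bar> \<le> (K::real)" "\<And>x y. A x + B y \<le> (x - y)\<^sup>2"
    "\<And>x. x \<in> {a<..<b} \<Longrightarrow> A x + B (T x) = (x - T x)\<^sup>2"
proof -
  define c where "c x = max a (min b x)" for x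
  have c: "c x \<in> {a..b}" "x \<in> {a..b} \<Longrightarrow> c x = x" for x using assms(1) by (auto simp: c_def)
  have c_contr: "\<bar>c x - c y\<bar> \<le> \<bar>x - y\<bar>" for x y by (auto simp: c_def max_def min_def)
  have c_cont: "continuous_on UNIV c" unfolding c_def by (intro continuous_intros)
  have int: "T integrable_on {x..y}" for x y
    by (rule integrable_on_mono_on) (use assms(2) in \<open>auto simp: mono_on_def mono_def\<close>)
  define \<phi> where "\<phi> x = integral {a..x} T" for x
  have diff: "\<phi> y - \<phi> x = integral {x..y} T" if "a \<le> x" "x \<le> y" for x y
    unfolding \<phi>_def using Henstock_Kurzweil_Integration.integral_combine[OF that int] by simp
  have sub: "\<phi> x + T x * (y - x) \<le> \<phi> y" if "x \<in> {a..b}" "y \<in> {a..b}" for x y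
  proof (cases "x \<le> y")
    case True
    have "integral {x..y} (\<lambda>_. T x) \<le> integral {x..y} T"
      by (rule integral_le) (use int assms(2) in \<open>auto dest: monoD\<close>)
    then show ?thesis using diff[of x y] that True by (simp add: mult.commute)
  next
    case False
    have "integral {y..x} T \<le> integral {y..x} (\<lambda>_. T x)"
      by (rule integral_le) (use int assms(2) in \<open>auto dest: monoD\<close>)
    then show ?thesis using diff[of y x] that False by (simp add: algebra_simps)
  qed
  have \<phi>_cont: "continuous_on {a..b} \<phi>"
    unfolding \<phi>_def by (rule indefinite_integral_continuous_1[OF int])
  define \<psi> where "\<psi> y = (SUP x\<in>{a..b}. x * y - \<phi> x)" for y
  have bdd: "bdd_above ((\<lambda>x. x * y - \<phi> x) ` {a..b})" for y
  proof -
    have "compact ((\<lambda>x. x * y - \<phi> x) ` {a..b})"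
      by (intro compact_continuous_image continuous_intros \<phi>_cont compact_Icc)
    then show ?thesis by (rule bounded_imp_bdd_above[OF compact_imp_bounded])
  qed
  have \<psi>_ge: "x * y - \<phi> x \<le> \<psi> y" if "x \<in> {a..b}" for x y
    unfolding \<psi>_def by (rule cSUP_upper[OF that bdd])
  have \<psi>_eq: "\<psi> (T x) = x * T x - \<phi> x" if x: "x \<in> {a..b}" for x
  proof (rule antisym)
    show "\<psi> (T x) \<le> x * T x - \<phi> x" unfolding \<psi>_def
    proof (rule cSUP_least)
      fix z assume "z \<in> {a..b}"
      then show "z * T x - \<phi> z \<le> x * T x - \<phi> x" using sub[OF x, of z] by (simp add: algebra_simps)
    qed (use assms(1) in auto)
  qed (rule \<psi>_ge[OF x])
  define L where "L = max \<bar>a\<bar> \<bar>b\<bar>"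
  have L: "\<bar>x\<bar> \<le> L" if "x \<in> {a..b}" for x using that unfolding L_def by auto
  have \<psi>_lip1: "\<psi> y \<le> \<psi> y' + L * \<bar>y - y'\<bar>" for y y'
    unfolding \<psi>_def[of y]
  proof (rule cSUP_least)
    fix x assume x: "x \<in> {a..b}"
    have "x * (y - y') \<le> L * \<bar>y - y'\<bar>"
      using mult_right_mono[OF L[OF x], of "\<bar>y - y'\<bar>"] by (metis abs_ge_self abs_ge_zero abs_mult order_trans)
    then show "x * y - \<phi> x \<le> \<psi> y' + L * \<bar>y - y'\<bar>" using \<psi>_ge[OF x, of y'] by (simp add: algebra_simps)
  qed (use assms(1) in auto)
  have "L-lipschitz_on UNIV \<psi>"
  proof (rule lipschitz_onI)
    fix y y' show "dist (\<psi> y) (\<psi> y') \<le> L * dist y y'"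
      using \<psi>_lip1[of y y'] \<psi>_lip1[of y' y] by (auto simp: dist_real_def abs_minus_commute)
  qed (simp add: L_def)
  then have \<psi>_cont: "continuous_on UNIV \<psi>" by (rule lipschitz_on_continuous_on)
  define A0 where "A0 x = x\<^sup>2 - 2 * \<phi> x" for x
  define B0 where "B0 x = x\<^sup>2 - 2 * \<psi> x" for x
  have A0: "continuous_on {a..b} A0" and B0: "continuous_on {a..b} B0"
    unfolding A0_def B0_def by (intro continuous_intros \<phi>_cont continuous_on_subset[OF \<psi>_cont] subset_UNIV)+
  obtain KA where KA: "\<forall>x\<in>{a..b}. \<bar>A0 x\<bar> \<le> KA"
    using compact_imp_bounded[OF compact_continuous_image[OF A0 compact_Icc]] unfolding bounded_iff by auto
  obtain KB where KB: "\<forall>x\<in>{a..b}. \<bar>B0 x\<bar> \<le> KB"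
    using compact_imp_bounded[OF compact_continuous_image[OF B0 compact_Icc]] unfolding bounded_iff by auto
  have m: "(\<lambda>x. A0 (c x)) \<in> borel_measurable borel" "(\<lambda>x. B0 (c x)) \<in> borel_measurable borel"
    using c by (auto intro!: borel_measurable_continuous_onI continuous_on_compose2[OF A0 c_cont] continuous_on_compose2[OF B0 c_cont])
  have ineq: "A0 x + B0 y \<le> (x - y)\<^sup>2" if "x \<in> {a..b}" for x y
    using \<psi>_ge[OF that, of y] unfolding A0_def B0_def by (simp add: power2_diff)
  show ?thesis
  proof (rule that[of "\<lambda>x. A0 (c x)" "\<lambda>x. B0 (c x)" "max KA KB"])
    show "A0 (c x) + B0 (c y) \<le> (x - y)\<^sup>2" for x y
      using ineq[OF c(1), of x "c y"] c_contr[of x y] unfolding abs_le_square_iff by (rule order_trans)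
    show "A0 (c x) + B0 (c (T x)) = (x - T x)\<^sup>2" if "x \<in> {a<..<b}" for x
      using that c(2)[of x] c(2)[OF assms(3)[of x]] \<psi>_eq[of x] unfolding A0_def B0_def by (simp add: power2_diff)
    show "\<bar>A0 (c x)\<bar> \<le> max KA KB" "\<bar>B0 (c x)\<bar> \<le> max KA KB" for x
      using KA[rule_format, OF c(1)[of x]] KB[rule_format, OF c(1)[of x]] by auto
  qed (use m in auto)
qed

lemma monotone_transport_lower_bound:
  fixes T :: "real \<Rightarrow> real"
  assumes "a < b" "mono T" "\<And>x. T x \<in> {a..b}"
    and [measurable]: "\<rho> \<in> borel_measurable borel" "\<eta> \<in> borel_measurable borel"
      "s1 \<in> borel_measurable borel" "s2 \<in> borel_measurable borel" "T \<in> borel_measurable borel"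
    and nn: "\<And>x. 0 \<le> \<rho> x" "\<And>x. 0 \<le> \<eta> x" "\<And>x. 0 \<le> s1 x" "\<And>x. 0 \<le> s2 x"
    and fin: "emeasure (dens a b (\<lambda>x. \<rho> x + \<eta> x)) UNIV < \<infinity>"
    and push: "distr (dens a b (\<lambda>x. \<rho> x + \<eta> x)) borel T = dens a b (\<lambda>x. s1 x + s2 x)"
  shows "(\<integral>\<^sup>+ x. ennreal ((\<rho> x + \<eta> x) * (x - T x)\<^sup>2) * indicator {a<..<b} x \<partial>lborel)
    \<le> W2sq (dens a b \<rho>) (dens a b s1) + W2sq (dens a b \<eta>) (dens a b s2)"
proof -
  obtain A B K where AB [measurable]: "A \<in> borel_measurable borel" "B \<in> borel_measurable borel"
    and K: "\<And>x. \<bar>A x\<bar> \<le> K" "\<And>x. \<bar>B x\<bar> \<le> (K::real)" "\<And>x y. A x + B y \<le> (x - y)\<^sup>2"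
    and eq: "\<And>x. x \<in> {a<..<b} \<Longrightarrow> A x + B (T x) = (x - T x)\<^sup>2"
    using monotone_dual_potentials[OF assms(1-3)] by blast
  have K0: "0 \<le> K" using K(1)[of 0] by simp
  have A0: "0 \<le> A x + K" and B0: "0 \<le> B x + K" for x using K(1,2)[of x] by linarith+
  have split: "(\<integral>\<^sup>+ x. u x \<partial>dens a b (\<lambda>x. f x + g x)) = (\<integral>\<^sup>+ x. u x \<partial>dens a b f) + (\<integral>\<^sup>+ x. u x \<partial>dens a b g)"
    if [measurable]: "f \<in> borel_measurable borel" "g \<in> borel_measurable borel" "u \<in> borel_measurable borel"
      and "\<And>x. 0 \<le> f x" "\<And>x. 0 \<le> g x" for f g :: "real \<Rightarrow> real" and u
    by (simp add: nn_integral_dens that(4,5) ennreal_plus flip: nn_integral_add)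
       (auto intro!: nn_integral_cong simp: distrib_right distrib_left)
  have mass: "emeasure (dens a b (\<lambda>x. \<rho> x + \<eta> x)) UNIV = emeasure (dens a b \<rho>) UNIV + emeasure (dens a b \<eta>) UNIV"
    using split[of \<rho> \<eta> "\<lambda>_. 1"] nn by simp
  let ?c = "ennreal (2 * K) * emeasure (dens a b (\<lambda>x. \<rho> x + \<eta> x)) UNIV"
  have "(\<integral>\<^sup>+ x. ennreal (A x + K) \<partial>dens a b (\<lambda>x. \<rho> x + \<eta> x)) + (\<integral>\<^sup>+ x. ennreal (B x + K) \<partial>dens a b (\<lambda>x. s1 x + s2 x))
    = ((\<integral>\<^sup>+ x. ennreal (A x + K) \<partial>dens a b \<rho>) + (\<integral>\<^sup>+ x. ennreal (B x + K) \<partial>dens a b s1))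
     + ((\<integral>\<^sup>+ x. ennreal (A x + K) \<partial>dens a b \<eta>) + (\<integral>\<^sup>+ x. ennreal (B x + K) \<partial>dens a b s2))"
    using nn by (simp add: split add_ac)
  also have "\<dots> \<le> (W2sq (dens a b \<rho>) (dens a b s1) + ennreal (2 * K) * emeasure (dens a b \<rho>) UNIV)
     + (W2sq (dens a b \<eta>) (dens a b s2) + ennreal (2 * K) * emeasure (dens a b \<eta>) UNIV)"
    using fin unfolding mass by (intro add_mono W2sq_dual_bound K AB) (auto simp: ennreal_add_eq_top less_top)
  also have "\<dots> = W2sq (dens a b \<rho>) (dens a b s1) + W2sq (dens a b \<eta>) (dens a b s2) + ?c"
    unfolding mass by (simp add: distrib_left add_ac)
  finally have le: "(\<integral>\<^sup>+ x. ennreal (A x + K) \<partial>dens a b (\<lambda>x. \<rho> x + \<eta> x)) + (\<integral>\<^sup>+ x. ennreal (B x + K) \<partial>dens a b (\<lambda>x. s1 x + s2 x))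
     \<le> W2sq (dens a b \<rho>) (dens a b s1) + W2sq (dens a b \<eta>) (dens a b s2) + ?c" .
  have "(\<integral>\<^sup>+ x. ennreal (A x + K) \<partial>dens a b (\<lambda>x. \<rho> x + \<eta> x)) + (\<integral>\<^sup>+ x. ennreal (B x + K) \<partial>dens a b (\<lambda>x. s1 x + s2 x))
     = (\<integral>\<^sup>+ x. ennreal (A x + K) + ennreal (B (T x) + K) \<partial>dens a b (\<lambda>x. \<rho> x + \<eta> x))"
    unfolding push[symmetric] by (simp add: nn_integral_distr nn_integral_add)
  also have "\<dots> = (\<integral>\<^sup>+ x. (ennreal (\<rho> x + \<eta> x) * (ennreal (A x + K) + ennreal (B (T x) + K))) * indicator {a<..<b} x \<partial>lborel)"
    by (subst nn_integral_dens) auto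
  also have "\<dots> = (\<integral>\<^sup>+ x. ennreal ((\<rho> x + \<eta> x) * (x - T x)\<^sup>2) * indicator {a<..<b} x + ennreal (2 * K) * (ennreal (\<rho> x + \<eta> x) * indicator {a<..<b} x) \<partial>lborel)"
  proof (rule nn_integral_cong)
    fix x
    have "ennreal (\<rho> x + \<eta> x) * (ennreal (A x + K) + ennreal (B (T x) + K)) = ennreal ((\<rho> x + \<eta> x) * (A x + B (T x)) + 2 * K * (\<rho> x + \<eta> x))"
      if "x \<in> {a<..<b}"
      using A0[of x] B0[of "T x"] nn(1,2)[of x] by (simp add: algebra_simps flip: ennreal_plus ennreal_mult)
    then show "(ennreal (\<rho> x + \<eta> x) * (ennreal (A x + K) + ennreal (B (T x) + K))) * indicator {a<..<b} x
      = ennreal ((\<rho> x + \<eta> x) * (x - T x)\<^sup>2) * indicator {a<..<b} x + ennreal (2 * K) * (ennreal (\<rho> x + \<eta> x) * indicator {a<..<b} x)"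
      using nn(1,2)[of x] K0 eq[of x] by (auto simp: indicator_def ennreal_plus ennreal_mult)
  qed
  also have "\<dots> = (\<integral>\<^sup>+ x. ennreal ((\<rho> x + \<eta> x) * (x - T x)\<^sup>2) * indicator {a<..<b} x \<partial>lborel) + ?c"
    by (subst nn_integral_add) (auto simp: nn_integral_cmult emeasure_dens)
  finally have "(\<integral>\<^sup>+ x. ennreal ((\<rho> x + \<eta> x) * (x - T x)\<^sup>2) * indicator {a<..<b} x \<partial>lborel) + ?c
     \<le> W2sq (dens a b \<rho>) (dens a b s1) + W2sq (dens a b \<eta>) (dens a b s2) + ?c" using le by simp
  moreover have "?c < \<infinity>" using fin by (auto simp: ennreal_mult_less_top)
  ultimately show ?thesis by (auto simp: add.commute[of _ ?c] ennreal_add_left_cancel_le)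
qed

lemma integral_dens:
  assumes [measurable]: "f \<in> borel_measurable borel" "u \<in> borel_measurable borel" and f: "\<And>x. 0 \<le> f x"
  shows "(LINT x|dens a b f. u x) = (LINT x|lborel. f x * u x * indicator {a<..<b} x :: real)"
    and "integrable (dens a b f) u \<longleftrightarrow> integrable lborel (\<lambda>x. f x * u x * indicator {a<..<b} x :: real)"
proof -
  have eq: "dens a b f = density lborel (\<lambda>x. ennreal (f x * indicator {a<..<b} x))"
    unfolding dens_def by (rule density_cong) (auto simp: indicator_def)
  show "(LINT x|dens a b f. u x) = (LINT x|lborel. f x * u x * indicator {a<..<b} x)"
    unfolding eq by (subst integral_density) (use f in \<open>auto intro!: Bochner_Integration.integral_cong\<close>)
  show "integrable (dens a b f) u \<longleftrightarrow> integrable lborel (\<lambda>x. f x * u x * indicator {a<..<b} x)"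
    unfolding eq by (subst integrable_density) (use f in \<open>auto intro!: Bochner_Integration.integrable_cong\<close>)
qed

lemma AE_Ioo_ex:
  assumes "AE x in lborel. x \<in> {c<..<d::real} \<longrightarrow> P x" "c < d"
  shows "\<exists>x\<in>{c<..<d}. P x"
proof (rule ccontr)
  assume neg: "\<not> ?thesis"
  have "AE x in lborel. x \<notin> {c<..<d}"
    using assms(1) by (rule eventually_mono) (use neg in auto)
  then have "emeasure lborel {c<..<d} = 0"
    by (subst (asm) AE_iff_measurable[OF _ refl]) (auto simp: greaterThanLessThan_def greaterThan_def lessThan_def Int_def)
  then show False using assms(2) by simp
qed

lemma nn_integral_gt_const:
  assumes [measurable]: "f \<in> borel_measurable borel" and "c < d" "0 \<le> K"
    and ae: "AE x in lborel. x \<in> {c<..<d} \<longrightarrow> K < f x"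
  shows "ennreal (K * (d - c)) < (\<integral>\<^sup>+x. ennreal (f x) * indicator {c<..<d} x \<partial>lborel)"
proof (rule ccontr)
  assume "\<not> ?thesis"
  then have le: "(\<integral>\<^sup>+x. ennreal (f x) * indicator {c<..<d} x \<partial>lborel) \<le> ennreal (K * (d - c))" by simp
  have "(\<integral>\<^sup>+x. ennreal (f x) * indicator {c<..<d} x \<partial>lborel)
     = (\<integral>\<^sup>+x. ennreal K * indicator {c<..<d} x + ennreal (f x - K) * indicator {c<..<d} x \<partial>lborel)"
    by (rule nn_integral_cong_AE, use ae in eventually_elim) (use assms(3) in \<open>auto simp: indicator_def simp flip: ennreal_plus\<close>)
  also have "\<dots> = ennreal (K * (d - c)) + (\<integral>\<^sup>+x. ennreal (f x - K) * indicator {c<..<d} x \<partial>lborel)"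
    by (subst nn_integral_add) (use assms(2,3) in \<open>auto simp: nn_integral_cmult ennreal_mult\<close>)
  finally have "ennreal (K * (d - c)) + (\<integral>\<^sup>+x. ennreal (f x - K) * indicator {c<..<d} x \<partial>lborel) \<le> ennreal (K * (d - c)) + 0"
    using le by simp
  then have "(\<integral>\<^sup>+x. ennreal (f x - K) * indicator {c<..<d} x \<partial>lborel) = 0"
    unfolding ennreal_add_left_cancel_le by auto
  then have "AE x in lborel. ennreal (f x - K) * indicator {c<..<d} x = 0"
    by (subst (asm) nn_integral_0_iff_AE) auto
  then have "AE x in lborel. x \<in> {c<..<d} \<longrightarrow> False"
    using ae by eventually_elim (auto simp: indicator_def ennreal_eq_0_iff split: if_splits)
  from AE_Ioo_ex[OF this assms(2)] show False by simp
qed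

lemma nn_integral_lt_const:
  assumes [measurable]: "f \<in> borel_measurable borel" and "c < d" and f: "\<And>x. 0 \<le> f x"
    and ae: "AE x in lborel. x \<in> {c<..<d} \<longrightarrow> f x < K"
  shows "(\<integral>\<^sup>+x. ennreal (f x) * indicator {c<..<d} x \<partial>lborel) < ennreal (K * (d - c))"
proof (rule ccontr)
  let ?F = "\<integral>\<^sup>+x. ennreal (f x) * indicator {c<..<d} x \<partial>lborel"
  assume "\<not> ?thesis"
  then have le: "ennreal (K * (d - c)) \<le> ?F" by simp
  have K: "0 \<le> K" using AE_Ioo_ex[OF ae assms(2)] f by (meson less_eq_real_def order_le_less_trans)
  have "ennreal (K * (d - c)) = (\<integral>\<^sup>+x. ennreal K * indicator {c<..<d} x \<partial>lborel)"
    using assms(2) K by (simp add: nn_integral_cmult ennreal_mult)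
  also have "\<dots> = (\<integral>\<^sup>+x. ennreal (f x) * indicator {c<..<d} x + ennreal (K - f x) * indicator {c<..<d} x \<partial>lborel)"
    by (rule nn_integral_cong_AE, use ae in eventually_elim) (use f in \<open>auto simp: indicator_def simp flip: ennreal_plus\<close>)
  also have "\<dots> = ?F + (\<integral>\<^sup>+x. ennreal (K - f x) * indicator {c<..<d} x \<partial>lborel)"
    by (rule nn_integral_add) auto
  finally have eq: "ennreal (K * (d - c)) = ?F + (\<integral>\<^sup>+x. ennreal (K - f x) * indicator {c<..<d} x \<partial>lborel)" .
  then have "?F \<noteq> top" by (metis ennreal_add_eq_top ennreal_neq_top)
  moreover have "?F + (\<integral>\<^sup>+x. ennreal (K - f x) * indicator {c<..<d} x \<partial>lborel) \<le> ?F + 0" using le eq by simp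
  ultimately have "(\<integral>\<^sup>+x. ennreal (K - f x) * indicator {c<..<d} x \<partial>lborel) = 0"
    unfolding ennreal_add_left_cancel_le by auto
  then have "AE x in lborel. ennreal (K - f x) * indicator {c<..<d} x = 0"
    by (subst (asm) nn_integral_0_iff_AE) auto
  then have "AE x in lborel. x \<in> {c<..<d} \<longrightarrow> False"
    using ae by eventually_elim (auto simp: indicator_def ennreal_eq_0_iff split: if_splits)
  from AE_Ioo_ex[OF this assms(2)] show False by simp
qed

section \<open>The internal energy density\<close>

definition energy_slope :: "(real \<Rightarrow> real) \<Rightarrow> real \<Rightarrow> real" where
  "energy_slope chi s = (if s > 0 then deriv chi s else 0)"

lemma energy_slope_strict_mono:
  assumes "internal_energy chi" "0 \<le> x" "x < y"
  shows "energy_slope chi x < energy_slope chi y"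
proof -
  have d: "(deriv chi has_real_derivative deriv (deriv chi) z) (at z)" "deriv (deriv chi) z > 0" if "z > 0" for z
    using assms(1) that unfolding internal_energy_def by (auto simp: DERIV_deriv_iff_real_differentiable)
  have pos: "deriv chi u < deriv chi v" if "0 < u" "u < v" for u v
    by (rule DERIV_pos_imp_increasing[OF that(2)]) (use d that in \<open>meson less_le_trans\<close>)
  show ?thesis
  proof (cases "x = 0")
    case False
    then show ?thesis using pos[of x y] assms by (simp add: energy_slope_def)
  next
    case True
    have "eventually (\<lambda>z. deriv chi z \<le> deriv chi (y/2)) (at_right 0)"
      using eventually_at_right_less[of 0] eventually_at_right_real[of 0 "y/2"] assms True
      by (auto elim!: eventually_mono intro!: less_imp_le pos)
    moreover have "(deriv chi \<longlongrightarrow> 0) (at_right 0)" using assms(1) by (simp add: internal_energy_def)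
    ultimately have "0 \<le> deriv chi (y/2)" by (metis tendsto_upperbound trivial_limit_at_right_real)
    then show ?thesis using pos[of "y/2" y] assms True by (simp add: energy_slope_def)
  qed
qed

lemma energy_slope_mono:
  "internal_energy chi \<Longrightarrow> 0 \<le> x \<Longrightarrow> x \<le> y \<Longrightarrow> energy_slope chi x \<le> energy_slope chi y"
  using energy_slope_strict_mono[of chi x y] by (cases "x = y") auto

lemma energy_slope_nonneg: "internal_energy chi \<Longrightarrow> 0 \<le> x \<Longrightarrow> 0 \<le> energy_slope chi x"
  using energy_slope_mono[of chi 0 x] by (simp add: energy_slope_def)

lemma continuous_on_energy_slope:
  assumes "internal_energy chi"
  shows "continuous_on {0..} (energy_slope chi)"
  unfolding continuous_on_def
proof
  fix x :: real assume "x \<in> {0..}"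
  then consider "x > 0" | "x = 0" by force
  then show "(energy_slope chi \<longlongrightarrow> energy_slope chi x) (at x within {0..})"
  proof cases
    case 1
    have "isCont (deriv chi) x"
      using assms 1 unfolding internal_energy_def by (auto intro: differentiable_imp_continuous_within)
    then have "(deriv chi \<longlongrightarrow> deriv chi x) (at x)" by (simp add: isCont_def)
    moreover have "eventually (\<lambda>y. deriv chi y = energy_slope chi y) (at x)"
      using eventually_at_in_open'[of "{0<..}" x] 1 by (auto elim!: eventually_mono simp: energy_slope_def)
    ultimately have "(energy_slope chi \<longlongrightarrow> deriv chi x) (at x)" by (rule Lim_transform_eventually)
    then show ?thesis using 1 by (auto simp: energy_slope_def intro: tendsto_within_subset)
  next
    case 2
    have "(deriv chi \<longlongrightarrow> 0) (at_right 0)" using assms by (simp add: internal_energy_def)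
    moreover have "eventually (\<lambda>y. deriv chi y = energy_slope chi y) (at_right 0)"
      using eventually_at_right_less[of 0] by (auto elim!: eventually_mono simp: energy_slope_def)
    ultimately have "(energy_slope chi \<longlongrightarrow> 0) (at_right 0)" by (rule Lim_transform_eventually)
    moreover have "at 0 within {0..} = at_right (0::real)"
      by (rule at_within_Ici_at_right)
    ultimately show ?thesis using 2 by (simp add: energy_slope_def)
  qed
qed

lemma energy_mvt:
  assumes "internal_energy chi" "0 \<le> x" "x < y"
  obtains z where "x < z" "z < y" "chi y - chi x = (y - x) * energy_slope chi z"
proof -
  have "continuous_on {x..y} chi"
    using assms unfolding internal_energy_def by (auto intro: continuous_on_subset)
  moreover have "(chi has_real_derivative energy_slope chi z) (at z)" if "x < z" "z < y" for z
    using assms that unfolding internal_energy_def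
    by (auto simp: energy_slope_def DERIV_deriv_iff_real_differentiable)
  moreover have "chi differentiable (at z)" if "x < z" "z < y" for z
    using calculation(2)[OF that] real_differentiable_def by blast
  ultimately obtain l z where "x < z" "z < y" "(chi has_real_derivative l) (at z)" "chi y - chi x = (y - x) * l"
    using MVT[OF assms(3), of chi] by blast
  moreover from this have "l = energy_slope chi z"
    using \<open>\<And>z. x < z \<Longrightarrow> z < y \<Longrightarrow> (chi has_real_derivative energy_slope chi z) (at z)\<close> DERIV_unique by blast
  ultimately show ?thesis using that by blast
qed

lemma energy_diff_ge:
  assumes "internal_energy chi" "0 \<le> \<alpha>" "\<alpha> \<le> x" "x \<le> y"
  shows "energy_slope chi \<alpha> * (y - x) \<le> chi y - chi x"
proof (cases "x = y")
  case False
  have "0 \<le> x" "x < y" using assms False by auto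
  then obtain z where z: "x < z" "z < y" "chi y - chi x = (y - x) * energy_slope chi z"
    using energy_mvt[OF assms(1)] by blast
  then have "energy_slope chi \<alpha> \<le> energy_slope chi z" using energy_slope_mono[of chi \<alpha> z] assms by auto
  then show ?thesis using z assms by (simp add: mult.commute mult_left_mono)
qed simp

lemma energy_diff_le:
  assumes "internal_energy chi" "0 \<le> x" "x \<le> y" "y \<le> \<alpha>"
  shows "chi y - chi x \<le> energy_slope chi \<alpha> * (y - x)"
proof (cases "x = y")
  case False
  have "0 \<le> x" "x < y" using assms False by auto
  then obtain z where z: "x < z" "z < y" "chi y - chi x = (y - x) * energy_slope chi z"
    using energy_mvt[OF assms(1)] by blast
  then have "energy_slope chi z \<le> energy_slope chi \<alpha>" using energy_slope_mono[of chi z \<alpha>] assms by auto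
  then show ?thesis using z assms by (simp add: mult.commute mult_left_mono)
qed simp

lemma energy_ge_zero_value: "internal_energy chi \<Longrightarrow> 0 \<le> x \<Longrightarrow> chi 0 \<le> chi x"
  using energy_diff_ge[of chi 0 0 x] by (simp add: energy_slope_def)

lemma borel_measurable_energy:
  assumes "internal_energy chi" and [measurable]: "f \<in> borel_measurable borel" and "\<And>x. 0 \<le> f x"
  shows "(\<lambda>x. chi (f x)) \<in> borel_measurable borel"
proof -
  have "continuous_on {0..} chi" using assms(1) by (simp add: internal_energy_def)
  then have "continuous_on UNIV (\<lambda>x. chi (max 0 x))"
    by (rule continuous_on_compose2) (auto intro!: continuous_intros)
  then have [measurable]: "(\<lambda>x. chi (max 0 x)) \<in> borel_measurable borel"
    by (rule borel_measurable_continuous_onI)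
  have "(\<lambda>x. chi (max 0 (f x))) \<in> borel_measurable borel" by measurable
  then show ?thesis using assms(3) by simp
qed

text \<open>The coupling lives on pairs (x, z): the auxiliary interval above b for z encodes mass that stays
  at x, and z in Z the mass sent to z.\<close>
lemma W2sq_reroute:
  fixes T h k :: "real \<Rightarrow> real"
  assumes [measurable]: "T \<in> borel_measurable borel" "h \<in> borel_measurable borel" "k \<in> borel_measurable borel"
      "Z \<in> sets borel"
    and nn: "\<And>x. 0 \<le> h x" "\<And>x. 0 \<le> k x"
    and Z: "Z \<subseteq> {a<..<b}" "emeasure lborel Z = ennreal m" "0 < m"
    and c: "(\<integral>\<^sup>+x. ennreal (k x) * indicator {a<..<b} x \<partial>lborel) = ennreal c" "0 \<le> c"
  shows "W2sq (dens a b (\<lambda>x. h x + c / m * indicator Z x)) (distr (dens a b (\<lambda>x. h x + k x)) borel T)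
    \<le> (\<integral>\<^sup>+x. ennreal (h x * (x - T x)\<^sup>2) * indicator {a<..<b} x \<partial>lborel)
      + (\<integral>\<^sup>+x. (ennreal (k x) * (\<integral>\<^sup>+z. ennreal ((z - T x)\<^sup>2) * indicator Z z \<partial>lborel) / ennreal m) * indicator {a<..<b} x \<partial>lborel)" (is ?cost)
    and "emeasure (dens a b (\<lambda>x. h x + c / m * indicator Z x)) UNIV = emeasure (distr (dens a b (\<lambda>x. h x + k x)) borel T) UNIV" (is ?mass)
proof -
  define w where "w = (\<lambda>(x, z). (ennreal (h x) * indicator {b<..<b+1} z + ennreal (k x / m) * indicator Z z) * indicator {a<..<b} x)"
  have w [measurable]: "w \<in> borel_measurable (lborel \<Otimes>\<^sub>M lborel)" unfolding w_def by measurable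
  define M where "M = density (lborel \<Otimes>\<^sub>M lborel) w"
  define X where "X = (\<lambda>(x, z). if z < b then z else x)"
  define Y where "Y = (\<lambda>(x::real, z::real). T x)"
  have [measurable]: "X \<in> borel_measurable (borel \<Otimes>\<^sub>M borel)" "Y \<in> borel_measurable (borel \<Otimes>\<^sub>M borel)"
    unfolding X_def Y_def by measurable
  have setsM [measurable_cong]: "sets M = sets (borel \<Otimes>\<^sub>M borel)"
    unfolding M_def by (simp cong: sets_pair_measure_cong)
  have int: "(\<integral>\<^sup>+p. F (X p) (Y p) \<partial>M) = (\<integral>\<^sup>+x. ennreal (h x) * F x (T x) * indicator {a<..<b} x \<partial>lborel)
      + (\<integral>\<^sup>+x. ennreal (k x / m) * (\<integral>\<^sup>+z. F z (T x) * indicator Z z \<partial>lborel) * indicator {a<..<b} x \<partial>lborel)"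
    if [measurable]: "case_prod F \<in> borel_measurable (borel \<Otimes>\<^sub>M borel)" for F
  proof -
    have "(\<integral>\<^sup>+p. F (X p) (Y p) \<partial>M) = (\<integral>\<^sup>+p. w p * F (X p) (Y p) \<partial>(lborel \<Otimes>\<^sub>M lborel))"
      unfolding M_def by (subst nn_integral_density) auto
    also have "\<dots> = (\<integral>\<^sup>+x. \<integral>\<^sup>+z. w (x, z) * F (X (x, z)) (Y (x, z)) \<partial>lborel \<partial>lborel)"
      by (subst lborel.nn_integral_fst[symmetric]) auto
    also have "\<dots> = (\<integral>\<^sup>+x. ennreal (h x) * F x (T x) * indicator {a<..<b} x +
        ennreal (k x / m) * (\<integral>\<^sup>+z. F z (T x) * indicator Z z \<partial>lborel) * indicator {a<..<b} x \<partial>lborel)"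
    proof (rule nn_integral_cong)
      fix x :: real
      have "(\<integral>\<^sup>+z. w (x, z) * F (X (x, z)) (Y (x, z)) \<partial>lborel) =
        (\<integral>\<^sup>+z. (ennreal (h x) * F x (T x) * indicator {a<..<b} x) * indicator {b<..<b+1} z +
            (ennreal (k x / m) * indicator {a<..<b} x) * (F z (T x) * indicator Z z) \<partial>lborel)"
        by (rule nn_integral_cong) (use Z(1) in \<open>auto simp: w_def X_def Y_def indicator_def\<close>)
      also have "\<dots> = (\<integral>\<^sup>+z. (ennreal (h x) * F x (T x) * indicator {a<..<b} x) * indicator {b<..<b+1} z \<partial>lborel) +
            (\<integral>\<^sup>+z. (ennreal (k x / m) * indicator {a<..<b} x) * (F z (T x) * indicator Z z) \<partial>lborel)"
        by (rule nn_integral_add) auto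
      also have "\<dots> = ennreal (h x) * F x (T x) * indicator {a<..<b} x +
        ennreal (k x / m) * (\<integral>\<^sup>+z. F z (T x) * indicator Z z \<partial>lborel) * indicator {a<..<b} x"
        by (subst nn_integral_cmult, simp, subst nn_integral_cmult, simp, simp add: mult_ac)
      finally show "(\<integral>\<^sup>+z. w (x, z) * F (X (x, z)) (Y (x, z)) \<partial>lborel) = ennreal (h x) * F x (T x) * indicator {a<..<b} x +
        ennreal (k x / m) * (\<integral>\<^sup>+z. F z (T x) * indicator Z z \<partial>lborel) * indicator {a<..<b} x" .
    qed
    also have "\<dots> = (\<integral>\<^sup>+x. ennreal (h x) * F x (T x) * indicator {a<..<b} x \<partial>lborel)
      + (\<integral>\<^sup>+x. ennreal (k x / m) * (\<integral>\<^sup>+z. F z (T x) * indicator Z z \<partial>lborel) * indicator {a<..<b} x \<partial>lborel)"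
      by (rule nn_integral_add) auto
    finally show ?thesis .
  qed
  have km: "ennreal (k x / m) = ennreal (k x) / ennreal m" for x
    using nn Z(3) by (simp add: divide_ennreal)
  have cm: "ennreal (c / m) = ennreal c / ennreal m" using c(2) Z(3) by (simp add: divide_ennreal)
  have 1: "distr M borel X = dens a b (\<lambda>x. h x + c / m * indicator Z x)"
  proof (rule measure_eqI)
    fix A assume "A \<in> sets (distr M borel X)"
    then have [measurable]: "A \<in> sets borel" by simp
    have "emeasure (distr M borel X) A = (\<integral>\<^sup>+x. indicator A x \<partial>distr M borel X)" by simp
    also have "\<dots> = (\<integral>\<^sup>+p. indicator A (X p) \<partial>M)" by (rule nn_integral_distr) auto
    also have "\<dots> = (\<integral>\<^sup>+x. ennreal (h x) * indicator A x * indicator {a<..<b} x \<partial>lborel)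
      + (\<integral>\<^sup>+x. ennreal (k x / m) * (\<integral>\<^sup>+z. indicator A z * indicator Z z \<partial>lborel) * indicator {a<..<b} x \<partial>lborel)"
      by (rule int[of "\<lambda>x y. indicator A x"]) auto
    also have "(\<integral>\<^sup>+z. indicator A z * indicator Z z \<partial>lborel) = emeasure lborel (A \<inter> Z)"
      by (simp flip: indicator_inter_arith)
    also have "(\<integral>\<^sup>+x. ennreal (k x / m) * emeasure lborel (A \<inter> Z) * indicator {a<..<b} x \<partial>lborel)
      = (\<integral>\<^sup>+x. (emeasure lborel (A \<inter> Z) / ennreal m) * (ennreal (k x) * indicator {a<..<b} x) \<partial>lborel)"
      by (rule nn_integral_cong) (simp add: km divide_ennreal_def mult_ac)
    also have "\<dots> = (emeasure lborel (A \<inter> Z) / ennreal m) * ennreal c"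
      by (simp add: nn_integral_cmult c)
    also have "\<dots> = (\<integral>\<^sup>+x. ennreal (c / m) * indicator (A \<inter> Z) x \<partial>lborel)"
      by (subst nn_integral_cmult_indicator) (simp_all add: cm divide_ennreal_def mult_ac)
    also have "(\<integral>\<^sup>+x. ennreal (h x) * indicator A x * indicator {a<..<b} x \<partial>lborel) + \<dots>
       = (\<integral>\<^sup>+x. ennreal (h x) * indicator A x * indicator {a<..<b} x + ennreal (c / m) * indicator (A \<inter> Z) x \<partial>lborel)"
      by (rule nn_integral_add[symmetric]) auto
    also have "\<dots> = emeasure (dens a b (\<lambda>x. h x + c / m * indicator Z x)) A"
      by (subst emeasure_dens) (use Z(1,3) nn c(2) in \<open>auto intro!: nn_integral_cong simp: indicator_def ennreal_plus\<close>)
    finally show "emeasure (distr M borel X) A = emeasure (dens a b (\<lambda>x. h x + c / m * indicator Z x)) A" .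
  qed simp
  have 2: "distr M borel Y = distr (dens a b (\<lambda>x. h x + k x)) borel T"
  proof (rule measure_eqI)
    fix A assume "A \<in> sets (distr M borel Y)"
    then have [measurable]: "A \<in> sets borel" by simp
    have "emeasure (distr M borel Y) A = (\<integral>\<^sup>+x. indicator A x \<partial>distr M borel Y)" by simp
    also have "\<dots> = (\<integral>\<^sup>+p. indicator A (Y p) \<partial>M)" by (rule nn_integral_distr) auto
    also have "\<dots> = (\<integral>\<^sup>+x. ennreal (h x) * indicator A (T x) * indicator {a<..<b} x \<partial>lborel)
      + (\<integral>\<^sup>+x. ennreal (k x / m) * (\<integral>\<^sup>+z. indicator A (T x) * indicator Z z \<partial>lborel) * indicator {a<..<b} x \<partial>lborel)"
      by (rule int[of "\<lambda>x y. indicator A y"]) auto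
    also have "\<dots> = (\<integral>\<^sup>+x. ennreal (h x) * indicator A (T x) * indicator {a<..<b} x \<partial>lborel)
      + (\<integral>\<^sup>+x. ennreal (k x) * indicator A (T x) * indicator {a<..<b} x \<partial>lborel)"
    proof -
      have "ennreal (k x / m) * (indicator A (T x) * ennreal m) = ennreal (k x) * indicator A (T x)" for x
        using nn Z(3) by (auto simp: indicator_def simp flip: ennreal_mult)
      then show ?thesis by (simp add: nn_integral_cmult Z(2))
    qed
    also have "\<dots> = (\<integral>\<^sup>+x. ennreal (h x + k x) * indicator A (T x) * indicator {a<..<b} x \<partial>lborel)"
      by (subst nn_integral_add[symmetric]) (use nn in \<open>auto intro!: nn_integral_cong simp: indicator_def ennreal_plus\<close>)
    also have "\<dots> = (\<integral>\<^sup>+x. indicator A (T x) \<partial>dens a b (\<lambda>x. h x + k x))"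
      by (subst nn_integral_dens) auto
    also have "\<dots> = (\<integral>\<^sup>+x. indicator A x \<partial>distr (dens a b (\<lambda>x. h x + k x)) borel T)"
      by (rule nn_integral_distr[symmetric]) auto
    also have "\<dots> = emeasure (distr (dens a b (\<lambda>x. h x + k x)) borel T) A" by simp
    finally show "emeasure (distr M borel Y) A = emeasure (distr (dens a b (\<lambda>x. h x + k x)) borel T) A" .
  qed simp
  have "W2sq (distr M borel X) (distr M borel Y) \<le> (\<integral>\<^sup>+ p. ennreal ((X p - Y p)\<^sup>2) \<partial>M)"
    by (rule W2sq_distr_le) auto
  also have "\<dots> = (\<integral>\<^sup>+x. ennreal (h x) * ennreal ((x - T x)\<^sup>2) * indicator {a<..<b} x \<partial>lborel)
      + (\<integral>\<^sup>+x. ennreal (k x / m) * (\<integral>\<^sup>+z. ennreal ((z - T x)\<^sup>2) * indicator Z z \<partial>lborel) * indicator {a<..<b} x \<partial>lborel)"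
    by (rule int[of "\<lambda>x y. ennreal ((x - y)\<^sup>2)"]) auto
  also have "(\<lambda>x. ennreal (h x) * ennreal ((x - T x)\<^sup>2)) = (\<lambda>x. ennreal (h x * (x - T x)\<^sup>2))"
    using nn by (auto simp: ennreal_mult)
  finally show ?cost unfolding 1 2 km by (simp add: divide_ennreal_def mult_ac)
  show ?mass unfolding 1[symmetric] 2[symmetric] by (simp add: emeasure_distr)
qed

section \<open>The diffusion step\<close>

locale diffusion_step =
  fixes chi :: "real \<Rightarrow> real" and a b \<tau> M :: real and \<rho> \<eta> s q T :: "real \<Rightarrow> real"
  assumes ab: "a < b" and tau: "0 < \<tau>" and chi: "internal_energy chi"
    and meas [measurable]: "\<rho> \<in> borel_measurable borel" "\<eta> \<in> borel_measurable borel"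
      "s \<in> borel_measurable borel" "q \<in> borel_measurable borel" "T \<in> borel_measurable borel"
    and nn: "\<And>x. 0 \<le> \<rho> x" "\<And>x. 0 \<le> \<eta> x"
    and s: "\<And>x. 0 \<le> s x" "\<And>x. s x \<le> M" and q: "\<And>x. 0 \<le> q x" "\<And>x. q x \<le> 1"
    and T: "mono T" "\<And>x. T x \<in> {a..b}"
    and push: "distr (dens a b (\<lambda>x. \<rho> x + \<eta> x)) borel T = dens a b s"
    and minimal: "\<And>\<mu> \<nu>. \<mu> \<in> Pm a b (emeasure (dens a b (\<lambda>x. q x * s x)) UNIV) \<Longrightarrow>
      \<nu> \<in> Pm a b (emeasure (dens a b (\<lambda>x. (1 - q x) * s x)) UNIV) \<Longrightarrow>
      JKO_functional chi a b \<tau> (dens a b (\<lambda>x. q x * s x)) (dens a b (\<lambda>x. (1 - q x) * s x)) (dens a b \<rho>) (dens a b \<eta>)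
      \<le> JKO_functional chi a b \<tau> (dens a b (\<lambda>x. q x * s x)) (dens a b (\<lambda>x. (1 - q x) * s x)) \<mu> \<nu>"
begin

definition \<sigma> where "\<sigma> x = \<rho> x + \<eta> x"

lemma \<sigma>_meas [measurable]: "\<sigma> \<in> borel_measurable borel" unfolding \<sigma>_def[abs_def] by measurable

lemma \<sigma>_nonneg: "0 \<le> \<sigma> x" unfolding \<sigma>_def using nn by (simp add: add_nonneg_nonneg)

lemma qs_le: "q x * s x \<le> s x" using s[of x] q[of x] by (simp add: mult_left_le_one_le)

lemma push_\<sigma>: "distr (dens a b \<sigma>) borel T = dens a b s"
  using push unfolding \<sigma>_def[abs_def] .

lemma emeasure_dens_s_finite: "emeasure (dens a b s) UNIV < \<infinity>"
proof -
  have "emeasure (dens a b s) UNIV \<le> (\<integral>\<^sup>+x. ennreal M * indicator {a<..<b} x \<partial>lborel)"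
    by (simp add: emeasure_dens) (intro nn_integral_mono mult_right_mono ennreal_leI s, simp)
  also have "\<dots> < \<infinity>" using ab by (simp add: nn_integral_cmult ennreal_mult_less_top)
  finally show ?thesis .
qed

lemma emeasure_dens_\<sigma>_finite: "emeasure (dens a b \<sigma>) UNIV < \<infinity>"
proof -
  have "emeasure (dens a b s) UNIV = emeasure (dens a b \<sigma>) UNIV"
    unfolding push_\<sigma>[symmetric] by (simp add: emeasure_distr)
  then show ?thesis using emeasure_dens_s_finite by simp
qed

lemma push_weight:
  assumes [measurable]: "\<theta> \<in> borel_measurable borel" and "\<And>x. 0 \<le> \<theta> x"
  shows "distr (dens a b (\<lambda>x. \<theta> (T x) * \<sigma> x)) borel T = dens a b (\<lambda>x. \<theta> x * s x)"
proof (rule measure_eqI)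
  fix A assume "A \<in> sets (distr (dens a b (\<lambda>x. \<theta> (T x) * \<sigma> x)) borel T)"
  then have [measurable]: "A \<in> sets borel" by simp
  have "emeasure (distr (dens a b (\<lambda>x. \<theta> (T x) * \<sigma> x)) borel T) A
    = (\<integral>\<^sup>+x. indicator A x \<partial>distr (dens a b (\<lambda>x. \<theta> (T x) * \<sigma> x)) borel T)" by simp
  also have "\<dots> = (\<integral>\<^sup>+x. indicator A (T x) \<partial>dens a b (\<lambda>x. \<theta> (T x) * \<sigma> x))"
    by (rule nn_integral_distr) auto
  also have "\<dots> = (\<integral>\<^sup>+x. ennreal (\<theta> (T x)) * indicator A (T x) \<partial>dens a b \<sigma>)"
    by (subst (1 2) nn_integral_dens) (auto simp: assms(2) \<sigma>_nonneg ennreal_mult intro!: nn_integral_cong simp: mult_ac)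
  also have "\<dots> = (\<integral>\<^sup>+x. ennreal (\<theta> x) * indicator A x \<partial>dens a b s)"
    unfolding push_\<sigma>[symmetric] by (rule nn_integral_distr[symmetric]) auto
  also have "\<dots> = emeasure (dens a b (\<lambda>x. \<theta> x * s x)) A"
    by (subst nn_integral_dens, simp, simp, subst emeasure_dens)
       (auto simp: assms(2) s ennreal_mult intro!: nn_integral_cong simp: mult_ac indicator_def)
  finally show "emeasure (distr (dens a b (\<lambda>x. \<theta> (T x) * \<sigma> x)) borel T) A = emeasure (dens a b (\<lambda>x. \<theta> x * s x)) A" .
qed simp

lemma energy_le_Eint:
  assumes [measurable]: "f \<in> borel_measurable borel" "g \<in> borel_measurable borel"
    and "\<And>x. 0 \<le> f x" "\<And>x. 0 \<le> g x"
  shows "energy chi a b (dens a b f) (dens a b g) \<le> Eint chi a b f g"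
  unfolding energy_def by (rule INF_lower2[of "(f, g)"]) (use assms in \<open>auto simp: set_borel_measurable_def\<close>)

lemma Eint_le_energy: "Eint chi a b \<rho> \<eta> \<le> energy chi a b (dens a b \<rho>) (dens a b \<eta>)"
  unfolding energy_def
proof (rule INF_greatest, clarsimp)
  fix f g assume fg: "set_borel_measurable borel {a<..<b} f" "set_borel_measurable borel {a<..<b} g"
    "\<forall>x\<in>{a<..<b}. 0 \<le> f x \<and> 0 \<le> g x" "dens a b \<rho> = dens a b f" "dens a b \<eta> = dens a b g"
  have eq: "AE x in lborel. x \<in> {a<..<b} \<longrightarrow> u x = v x"
    if "set_borel_measurable borel {a<..<b} v" "\<forall>x\<in>{a<..<b}. 0 \<le> v x" "dens a b u = dens a b v"
      "u \<in> borel_measurable borel" "\<And>x. 0 \<le> u x" for u v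
  proof -
    let ?v = "\<lambda>x. indicator {a<..<b} x * v x"
    have "?v \<in> borel_measurable borel" using that(1) by (simp add: set_borel_measurable_def)
    moreover have "dens a b u = dens a b ?v" using that(3) dens_cong_AE[of a b v ?v] by simp
    ultimately have "AE x in lborel. x \<in> {a<..<b} \<longrightarrow> u x = ?v x"
      using that by (subst dens_eq_iff[symmetric]) auto
    then show ?thesis by (auto elim!: eventually_mono)
  qed
  have "AE x in lborel. x \<in> {a<..<b} \<longrightarrow> \<rho> x = f x" "AE x in lborel. x \<in> {a<..<b} \<longrightarrow> \<eta> x = g x"
    using eq[of f \<rho>] eq[of g \<eta>] fg nn by auto
  then have "(\<integral>\<^sup>+ x \<in> {a<..<b}. ennreal (chi (\<rho> x + \<eta> x) - chi 0) \<partial>lborel) = (\<integral>\<^sup>+ x \<in> {a<..<b}. ennreal (chi (f x + g x) - chi 0) \<partial>lborel)"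
    by (intro nn_integral_cong_AE) (auto simp: indicator_def)
  then show "Eint chi a b \<rho> \<eta> \<le> Eint chi a b f g" unfolding Eint_def by simp
qed

definition cost where "cost = (\<integral>\<^sup>+x. ennreal (\<sigma> x * (x - T x)\<^sup>2) * indicator {a<..<b} x \<partial>lborel)"
definition ener where "ener = (\<integral>\<^sup>+x. ennreal (chi (\<sigma> x) - chi 0) * indicator {a<..<b} x \<partial>lborel)"

lemma competitor_bound:
  assumes [measurable]: "f \<in> borel_measurable borel" "g \<in> borel_measurable borel"
    and fg: "\<And>x. 0 \<le> f x" "\<And>x. 0 \<le> g x"
    and m: "emeasure (dens a b f) UNIV = emeasure (dens a b (\<lambda>x. q x * s x)) UNIV"
      "emeasure (dens a b g) UNIV = emeasure (dens a b (\<lambda>x. (1 - q x) * s x)) UNIV"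
    and W: "W2sq (dens a b f) (dens a b (\<lambda>x. q x * s x)) + W2sq (dens a b g) (dens a b (\<lambda>x. (1 - q x) * s x)) \<le> W"
    and E: "(\<integral>\<^sup>+ x. ennreal (chi (f x + g x) - chi 0) * indicator {a<..<b} x \<partial>lborel) \<le> E"
  shows "cost * ennreal (1 / (2 * \<tau>)) + ener \<le> W * ennreal (1 / (2 * \<tau>)) + E"
proof -
  let ?c = "ennreal (1 / (2 * \<tau>))" and ?k = "ereal (chi 0 * (b - a))"
  let ?\<mu> = "dens a b (\<lambda>x. q x * s x)" and ?\<nu> = "dens a b (\<lambda>x. (1 - q x) * s x)"
  have conv: "enn2ereal A * ereal (1 / (2 * \<tau>)) + (?k + enn2ereal B) = ?k + enn2ereal (A * ?c + B)" for A B
    using tau by (simp add: plus_ennreal.rep_eq times_ennreal.rep_eq enn2ereal_ennreal add_ac)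
  have Pm: "dens a b f \<in> Pm a b (emeasure ?\<mu> UNIV)" "dens a b g \<in> Pm a b (emeasure ?\<nu> UNIV)"
    using m by (auto simp: Pm_def emeasure_dens)
  have "cost \<le> W2sq (dens a b \<rho>) ?\<mu> + W2sq (dens a b \<eta>) ?\<nu>"
    unfolding cost_def \<sigma>_def
    by (rule monotone_transport_lower_bound[OF ab T])
       (use nn s q push emeasure_dens_\<sigma>_finite in \<open>auto simp: \<sigma>_def[abs_def] left_diff_distrib qs_le\<close>)
  then have "?k + enn2ereal (cost * ?c + ener) \<le> ?k + enn2ereal ((W2sq (dens a b \<rho>) ?\<mu> + W2sq (dens a b \<eta>) ?\<nu>) * ?c + ener)"
    by (intro add_left_mono) (auto simp flip: less_eq_ennreal.rep_eq intro!: add_right_mono mult_right_mono)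
  also have "\<dots> = enn2ereal (W2sq (dens a b \<rho>) ?\<mu> + W2sq (dens a b \<eta>) ?\<nu>) * ereal (1 / (2 * \<tau>)) + Eint chi a b \<rho> \<eta>"
    unfolding conv[symmetric] Eint_def ener_def \<sigma>_def by simp
  also have "\<dots> \<le> JKO_functional chi a b \<tau> ?\<mu> ?\<nu> (dens a b \<rho>) (dens a b \<eta>)"
    unfolding JKO_functional_def by (intro add_left_mono Eint_le_energy)
  also have "\<dots> \<le> JKO_functional chi a b \<tau> ?\<mu> ?\<nu> (dens a b f) (dens a b g)"
    by (rule minimal[OF Pm])
  also have "\<dots> \<le> enn2ereal (W2sq (dens a b f) ?\<mu> + W2sq (dens a b g) ?\<nu>) * ereal (1 / (2 * \<tau>)) + Eint chi a b f g"
    unfolding JKO_functional_def by (intro add_left_mono energy_le_Eint) (use fg in auto)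
  also have "\<dots> = ?k + enn2ereal ((W2sq (dens a b f) ?\<mu> + W2sq (dens a b g) ?\<nu>) * ?c +
      (\<integral>\<^sup>+ x. ennreal (chi (f x + g x) - chi 0) * indicator {a<..<b} x \<partial>lborel))"
    unfolding conv[symmetric] Eint_def by simp
  also have "\<dots> \<le> ?k + enn2ereal (W * ?c + E)"
    by (intro add_left_mono) (auto simp flip: less_eq_ennreal.rep_eq intro!: add_mono mult_right_mono W E)
  finally show ?thesis by (simp add: ereal_add_le_add_iff less_eq_ennreal.rep_eq)
qed

lemma W2sq_self: "W2sq (dens a b f) (dens a b f) = 0"
proof -
  have "distr (dens a b f) borel (\<lambda>x. x) = dens a b f" by (rule distr_id2) simp
  then show ?thesis using W2sq_distr_le[of "\<lambda>x. x" "dens a b f" "\<lambda>x. x"] by simp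
qed

lemma energy_dissipation:
  "cost * ennreal (1 / (2 * \<tau>)) + ener \<le> (\<integral>\<^sup>+ x. ennreal (chi (s x) - chi 0) * indicator {a<..<b} x \<partial>lborel)"
  using competitor_bound[of "\<lambda>x. q x * s x" "\<lambda>x. (1 - q x) * s x" 0 "\<integral>\<^sup>+ x. ennreal (chi (s x) - chi 0) * indicator {a<..<b} x \<partial>lborel"]
  by (simp add: W2sq_self s q left_diff_distrib qs_le)

lemma chi_s_finite: "(\<integral>\<^sup>+ x. ennreal (chi (s x) - chi 0) * indicator {a<..<b} x \<partial>lborel) < \<infinity>"
proof -
  have "chi (s x) \<le> chi M" for x
    using energy_diff_ge[OF chi, of 0 "s x" M] s[of x] by (simp add: energy_slope_def)
  then have "(\<integral>\<^sup>+ x. ennreal (chi (s x) - chi 0) * indicator {a<..<b} x \<partial>lborel) \<le> (\<integral>\<^sup>+ x. ennreal (chi M - chi 0) * indicator {a<..<b} x \<partial>lborel)"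
    by (intro nn_integral_mono mult_right_mono ennreal_leI) auto
  also have "\<dots> < \<infinity>" using ab by (simp add: nn_integral_cmult ennreal_mult_less_top)
  finally show ?thesis .
qed

lemma cost_finite: "cost < \<infinity>" and ener_finite: "ener < \<infinity>"
proof -
  have fin: "cost * ennreal (1 / (2 * \<tau>)) + ener < \<infinity>"
    using energy_dissipation chi_s_finite by (rule le_less_trans)
  then show "ener < \<infinity>" by (auto simp: less_top ennreal_add_eq_top)
  show "cost < \<infinity>" using fin tau by (auto simp: less_top ennreal_add_eq_top ennreal_mult_less_top)
qed

lemma chi_\<sigma>_meas [measurable]: "(\<lambda>x. chi (\<sigma> x)) \<in> borel_measurable borel"
  by (rule borel_measurable_energy[OF chi]) (auto simp: \<sigma>_nonneg)

lemma integrable_cost: "integrable lborel (\<lambda>x. \<sigma> x * (x - T x)\<^sup>2 * indicator {a<..<b} x)"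
  and cost_eq: "cost = ennreal (LINT x|lborel. \<sigma> x * (x - T x)\<^sup>2 * indicator {a<..<b} x)"
proof -
  have eq: "cost = (\<integral>\<^sup>+x. ennreal (\<sigma> x * (x - T x)\<^sup>2 * indicator {a<..<b} x) \<partial>lborel)"
    unfolding cost_def by (rule nn_integral_cong) (auto simp: indicator_def)
  show 1: "integrable lborel (\<lambda>x. \<sigma> x * (x - T x)\<^sup>2 * indicator {a<..<b} x)"
    by (rule integrableI_nonneg) (use cost_finite in \<open>auto simp: eq \<sigma>_nonneg\<close>)
  show "cost = ennreal (LINT x|lborel. \<sigma> x * (x - T x)\<^sup>2 * indicator {a<..<b} x)"
    unfolding eq by (rule nn_integral_eq_integral[OF 1]) (auto simp: \<sigma>_nonneg)
qed

lemma integrable_ener: "integrable lborel (\<lambda>x. (chi (\<sigma> x) - chi 0) * indicator {a<..<b} x)"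
  and ener_eq: "ener = ennreal (LINT x|lborel. (chi (\<sigma> x) - chi 0) * indicator {a<..<b} x)"
proof -
  have eq: "ener = (\<integral>\<^sup>+x. ennreal ((chi (\<sigma> x) - chi 0) * indicator {a<..<b} x) \<partial>lborel)"
    unfolding ener_def by (rule nn_integral_cong) (auto simp: indicator_def)
  have nn: "0 \<le> (chi (\<sigma> x) - chi 0) * indicator {a<..<b} x" for x
    using energy_ge_zero_value[OF chi \<sigma>_nonneg] by simp
  show 1: "integrable lborel (\<lambda>x. (chi (\<sigma> x) - chi 0) * indicator {a<..<b} x)"
    by (rule integrableI_nonneg) (use ener_finite nn in \<open>auto simp: eq\<close>)
  show "ener = ennreal (LINT x|lborel. (chi (\<sigma> x) - chi 0) * indicator {a<..<b} x)"
    unfolding eq by (rule nn_integral_eq_integral[OF 1]) (use nn in auto)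
qed

lemma swap_bound:
  assumes [measurable]: "X \<in> sets borel" "Z \<in> sets borel"
    and sub: "X \<subseteq> {a<..<b}" "Z \<subseteq> {a<..<b}" and pos: "0 < emeasure lborel X" "0 < emeasure lborel Z"
    and \<alpha>: "0 \<le> \<alpha>0" "\<alpha>0 < \<alpha>1" "\<alpha>1 \<le> \<alpha>2" "\<alpha>2 < \<alpha>3"
    and X: "\<And>x. x \<in> X \<Longrightarrow> \<alpha>3 < \<sigma> x" and Z: "\<And>z. z \<in> Z \<Longrightarrow> \<sigma> z < \<alpha>0"
    and \<kappa>: "\<And>x z. x \<in> X \<Longrightarrow> z \<in> Z \<Longrightarrow> (z - T x)\<^sup>2 - (x - T x)\<^sup>2 \<le> \<kappa>"
  shows "2 * \<tau> * (energy_slope chi \<alpha>2 - energy_slope chi \<alpha>1) \<le> \<kappa>"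
proof -
  let ?I = "{a<..<b}"
  have fin: "emeasure lborel A < \<infinity>" if "A \<subseteq> ?I" for A
    using emeasure_mono[OF that, of lborel] ab by (auto simp: less_top[symmetric] top_unique le_less_trans)
  obtain mX where mX: "emeasure lborel X = ennreal mX" "0 < mX"
    using fin[OF sub(1)] pos(1) by (cases "emeasure lborel X") (auto simp: ennreal_less_zero_iff)
  obtain mZ where mZ: "emeasure lborel Z = ennreal mZ" "0 < mZ"
    using fin[OF sub(2)] pos(2) by (cases "emeasure lborel Z") (auto simp: ennreal_less_zero_iff)
  have mXZ: "measure lborel X = mX" "measure lborel Z = mZ" using mX mZ by (simp_all add: measure_def)
  have intXZ: "integrable lborel (indicator X :: real \<Rightarrow> real)" "integrable lborel (indicator Z :: real \<Rightarrow> real)"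
    using mX mZ by auto
  have ne: "X \<noteq> {}" "Z \<noteq> {}" using pos by auto
  have disj: "x \<notin> Z" if "x \<in> X" for x using X[OF that] Z[of x] \<alpha> by fastforce
  define \<epsilon> where "\<epsilon> = min (\<alpha>3 - \<alpha>2) ((\<alpha>1 - \<alpha>0) * mZ / mX)"
  define \<delta> where "\<delta> = \<epsilon> * mX / mZ"
  have \<epsilon>: "0 < \<epsilon>" "\<epsilon> \<le> \<alpha>3 - \<alpha>2" "\<epsilon> \<le> (\<alpha>1 - \<alpha>0) * mZ / mX" unfolding \<epsilon>_def using \<alpha> mX mZ by auto
  have \<delta>: "0 < \<delta>" "\<delta> \<le> \<alpha>1 - \<alpha>0" "\<delta> * mZ = \<epsilon> * mX"
    unfolding \<delta>_def using \<epsilon> mX mZ by (auto simp: field_simps)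
  define k h where "k x = \<epsilon> * indicator X x" and "h x = \<sigma> x - \<epsilon> * indicator X x" for x
  have [measurable]: "k \<in> borel_measurable borel" "h \<in> borel_measurable borel"
    unfolding k_def[abs_def] h_def[abs_def] by measurable
  have k0: "0 \<le> k x" for x unfolding k_def using \<epsilon> by simp
  have h0: "0 \<le> h x" for x unfolding h_def using X[of x] \<epsilon> \<alpha> \<sigma>_nonneg[of x] by (auto simp: indicator_def)
  define \<psi> where "\<psi> x = h x * (x - T x)\<^sup>2 + k x * ((x - T x)\<^sup>2 + \<kappa>)" for x
  have \<psi>_eq: "\<psi> x = \<sigma> x * (x - T x)\<^sup>2 + \<epsilon> * \<kappa> * indicator X x" for x
    unfolding \<psi>_def h_def k_def by (simp add: algebra_simps)
  have gap: "0 \<le> (x - T x)\<^sup>2 + \<kappa>" if "x \<in> X" for x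
    using \<kappa>[OF that] ne(2) by (smt (verit) all_not_in_conv zero_le_power2)
  have kgap: "0 \<le> k x * ((x - T x)\<^sup>2 + \<kappa>)" for x
    using gap[of x] \<epsilon> by (auto simp: k_def indicator_def)
  have \<psi>0: "0 \<le> \<psi> x" for x unfolding \<psi>_def using h0 kgap by (intro add_nonneg_nonneg) auto
  have [measurable]: "\<psi> \<in> borel_measurable borel" unfolding \<psi>_def[abs_def] by measurable
  define c where "c \<theta> = enn2real (\<integral>\<^sup>+x. ennreal (\<theta> (T x) * k x) * indicator ?I x \<partial>lborel)" for \<theta> :: "real \<Rightarrow> real"
  define f where "f \<theta> x = \<theta> (T x) * h x + c \<theta> / mZ * indicator Z x" for \<theta> :: "real \<Rightarrow> real" and x
  have intk: "(\<integral>\<^sup>+x. ennreal (k x) * indicator ?I x \<partial>lborel) = ennreal (\<epsilon> * mX)"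
  proof -
    have "(\<integral>\<^sup>+x. ennreal (k x) * indicator ?I x \<partial>lborel) = (\<integral>\<^sup>+x. ennreal \<epsilon> * indicator X x \<partial>lborel)"
      by (rule nn_integral_cong) (use sub in \<open>auto simp: k_def indicator_def\<close>)
    then show ?thesis using mX \<epsilon> by (simp add: nn_integral_cmult ennreal_mult)
  qed
  have part: "(\<integral>\<^sup>+x. ennreal (\<theta> (T x) * k x) * indicator ?I x \<partial>lborel) = ennreal (c \<theta>)" "0 \<le> c \<theta>"
      "f \<theta> \<in> borel_measurable borel" "0 \<le> f \<theta> x"
      "emeasure (dens a b (f \<theta>)) UNIV = emeasure (dens a b (\<lambda>x. \<theta> x * s x)) UNIV"
      "W2sq (dens a b (f \<theta>)) (dens a b (\<lambda>x. \<theta> x * s x)) \<le> (\<integral>\<^sup>+x. ennreal (\<theta> (T x) * \<psi> x) * indicator ?I x \<partial>lborel)"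
    if [measurable]: "\<theta> \<in> borel_measurable borel" and \<theta>: "\<And>x. 0 \<le> \<theta> x" "\<And>x. \<theta> x \<le> 1" for \<theta> x
  proof -
    have "(\<integral>\<^sup>+x. ennreal (\<theta> (T x) * k x) * indicator ?I x \<partial>lborel) \<le> ennreal (\<epsilon> * mX)"
      unfolding intk[symmetric] using \<theta> k0 by (intro nn_integral_mono mult_right_mono ennreal_leI) (auto simp: mult_left_le_one_le)
    then have "(\<integral>\<^sup>+x. ennreal (\<theta> (T x) * k x) * indicator ?I x \<partial>lborel) < top" by (rule le_less_trans) simp
    then show 1: "(\<integral>\<^sup>+x. ennreal (\<theta> (T x) * k x) * indicator ?I x \<partial>lborel) = ennreal (c \<theta>)"
      unfolding c_def by simp
    show 2: "0 \<le> c \<theta>" unfolding c_def by simp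
    show "f \<theta> \<in> borel_measurable borel" unfolding f_def[abs_def] by measurable
    show "0 \<le> f \<theta> x" unfolding f_def using \<theta> h0 2 mZ by (intro add_nonneg_nonneg mult_nonneg_nonneg) auto
    have hk: "(\<lambda>x. \<theta> (T x) * h x + \<theta> (T x) * k x) = (\<lambda>x. \<theta> (T x) * \<sigma> x)"
      unfolding h_def k_def by (auto simp: algebra_simps)
    have tk: "0 \<le> \<theta> (T x) * h x" "0 \<le> \<theta> (T x) * k x" for x using \<theta> h0 k0 by auto
    have mm: "(\<lambda>x. \<theta> (T x) * h x) \<in> borel_measurable borel" "(\<lambda>x. \<theta> (T x) * k x) \<in> borel_measurable borel" by auto
    note reroute = W2sq_reroute[OF meas(5) mm assms(2) tk sub(2) mZ 1 2, unfolded hk push_weight[OF that(1) \<theta>(1)] f_def[symmetric]]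
    show "emeasure (dens a b (f \<theta>)) UNIV = emeasure (dens a b (\<lambda>x. \<theta> x * s x)) UNIV"
      using reroute(2) by simp
    have inner: "(\<integral>\<^sup>+z. ennreal ((z - T x)\<^sup>2) * indicator Z z \<partial>lborel) / ennreal mZ \<le> ennreal ((x - T x)\<^sup>2 + \<kappa>)" if "x \<in> X" for x
    proof -
      have "(\<integral>\<^sup>+z. ennreal ((z - T x)\<^sup>2) * indicator Z z \<partial>lborel) \<le> (\<integral>\<^sup>+z. ennreal ((x - T x)\<^sup>2 + \<kappa>) * indicator Z z \<partial>lborel)"
        using \<kappa>[OF that] by (intro nn_integral_mono) (auto simp: indicator_def intro!: ennreal_leI, smt (verit))
      also have "\<dots> = ennreal (((x - T x)\<^sup>2 + \<kappa>) * mZ)"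
        using mZ gap[OF that] by (simp add: nn_integral_cmult ennreal_mult)
      finally have "(\<integral>\<^sup>+z. ennreal ((z - T x)\<^sup>2) * indicator Z z \<partial>lborel) / ennreal mZ \<le> ennreal (((x - T x)\<^sup>2 + \<kappa>) * mZ) / ennreal mZ"
        by (rule divide_right_mono_ennreal)
      also have "\<dots> = ennreal ((x - T x)\<^sup>2 + \<kappa>)"
        using gap[OF that] mZ by (simp add: divide_ennreal)
      finally show ?thesis .
    qed
    have "W2sq (dens a b (f \<theta>)) (dens a b (\<lambda>x. \<theta> x * s x)) \<le>
       (\<integral>\<^sup>+x. ennreal (\<theta> (T x) * h x * (x - T x)\<^sup>2) * indicator ?I x \<partial>lborel)
      + (\<integral>\<^sup>+x. (ennreal (\<theta> (T x) * k x) * (\<integral>\<^sup>+z. ennreal ((z - T x)\<^sup>2) * indicator Z z \<partial>lborel) / ennreal mZ) * indicator ?I x \<partial>lborel)"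
      using reroute(1) by simp
    also have "\<dots> \<le> (\<integral>\<^sup>+x. ennreal (\<theta> (T x) * h x * (x - T x)\<^sup>2) * indicator ?I x \<partial>lborel)
      + (\<integral>\<^sup>+x. ennreal (\<theta> (T x) * (k x * ((x - T x)\<^sup>2 + \<kappa>))) * indicator ?I x \<partial>lborel)"
    proof (intro add_left_mono nn_integral_mono mult_right_mono)
      fix x
      show "ennreal (\<theta> (T x) * k x) * (\<integral>\<^sup>+z. ennreal ((z - T x)\<^sup>2) * indicator Z z \<partial>lborel) / ennreal mZ
        \<le> ennreal (\<theta> (T x) * (k x * ((x - T x)\<^sup>2 + \<kappa>)))"
      proof (cases "x \<in> X")
        case True
        have "ennreal (\<theta> (T x) * (k x * ((x - T x)\<^sup>2 + \<kappa>))) = ennreal (\<theta> (T x) * k x) * ennreal ((x - T x)\<^sup>2 + \<kappa>)"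
          using tk gap[OF True] by (simp add: mult.assoc flip: ennreal_mult)
        then show ?thesis using inner[OF True]
          by (simp add: mult_left_mono divide_ennreal_def mult.assoc)
      qed (simp add: k_def)
    qed simp
    also have "\<dots> = (\<integral>\<^sup>+x. ennreal (\<theta> (T x) * h x * (x - T x)\<^sup>2) * indicator ?I x +
       ennreal (\<theta> (T x) * (k x * ((x - T x)\<^sup>2 + \<kappa>))) * indicator ?I x \<partial>lborel)"
      by (rule nn_integral_add[symmetric]) auto
    also have "\<dots> = (\<integral>\<^sup>+x. ennreal (\<theta> (T x) * \<psi> x) * indicator ?I x \<partial>lborel)"
    proof (rule nn_integral_cong)
      fix x
      have "ennreal (\<theta> (T x) * h x * (x - T x)\<^sup>2) + ennreal (\<theta> (T x) * (k x * ((x - T x)\<^sup>2 + \<kappa>))) = ennreal (\<theta> (T x) * \<psi> x)"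
        unfolding \<psi>_def distrib_left[of "\<theta> (T x)"]
        by (subst ennreal_plus) (use \<theta> h0 kgap in \<open>auto simp: mult.assoc\<close>)
      then show "ennreal (\<theta> (T x) * h x * (x - T x)\<^sup>2) * indicator ?I x + ennreal (\<theta> (T x) * (k x * ((x - T x)\<^sup>2 + \<kappa>))) * indicator ?I x
         = ennreal (\<theta> (T x) * \<psi> x) * indicator ?I x" by (simp flip: distrib_right)
    qed
    finally show "W2sq (dens a b (f \<theta>)) (dens a b (\<lambda>x. \<theta> x * s x)) \<le> (\<integral>\<^sup>+x. ennreal (\<theta> (T x) * \<psi> x) * indicator ?I x \<partial>lborel)" .
  qed
  let ?q' = "\<lambda>x. 1 - q x"
  note pq = part[OF meas(4) q] and pq' = part[of ?q', simplified, OF q(2) q(1)]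
  have sumc: "c q + c ?q' = \<epsilon> * mX"
  proof -
    have "ennreal (c q + c ?q') = ennreal (c q) + ennreal (c ?q')" using pq(2) pq'(2) by simp
    also have "\<dots> = (\<integral>\<^sup>+x. ennreal (q (T x) * k x) * indicator ?I x + ennreal ((1 - q (T x)) * k x) * indicator ?I x \<partial>lborel)"
      unfolding pq(1)[symmetric] pq'(1)[symmetric] by (rule nn_integral_add[symmetric]) auto
    also have "\<dots> = (\<integral>\<^sup>+x. ennreal (k x) * indicator ?I x \<partial>lborel)"
      by (rule nn_integral_cong) (use q k0 in \<open>auto simp: indicator_def algebra_simps mult_right_le_one_le simp flip: ennreal_plus\<close>)
    finally have "ennreal (c q + c ?q') = ennreal (\<epsilon> * mX)" unfolding intk .
    then show ?thesis using pq(2) pq'(2) \<epsilon> mX by (subst (asm) ennreal_inj) auto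
  qed
  have sumf: "f q x + f ?q' x = h x + \<delta> * indicator Z x" for x
  proof -
    have "f q x + f ?q' x = h x + (c q + c ?q') / mZ * indicator Z x"
      unfolding f_def by (simp add: algebra_simps add_divide_distrib)
    then show ?thesis unfolding sumc \<delta>_def .
  qed
  define C0 where "C0 = (LINT x|lborel. \<sigma> x * (x - T x)\<^sup>2 * indicator ?I x)"
  define E0 where "E0 = (LINT x|lborel. (chi (\<sigma> x) - chi 0) * indicator ?I x)"
  have C00: "0 \<le> C0" unfolding C0_def by (rule integral_nonneg_AE) (auto simp: \<sigma>_nonneg)
  have E00: "0 \<le> E0" unfolding E0_def
    by (rule integral_nonneg_AE) (use energy_ge_zero_value[OF chi \<sigma>_nonneg] in auto)
  have W: "W2sq (dens a b (f q)) (dens a b (\<lambda>x. q x * s x)) + W2sq (dens a b (f ?q')) (dens a b (\<lambda>x. (1 - q x) * s x))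
     \<le> ennreal (C0 + \<epsilon> * \<kappa> * mX)" and C1: "0 \<le> C0 + \<epsilon> * \<kappa> * mX"
  proof -
    have "W2sq (dens a b (f q)) (dens a b (\<lambda>x. q x * s x)) + W2sq (dens a b (f ?q')) (dens a b (\<lambda>x. (1 - q x) * s x))
      \<le> (\<integral>\<^sup>+x. ennreal (q (T x) * \<psi> x) * indicator ?I x \<partial>lborel) + (\<integral>\<^sup>+x. ennreal ((1 - q (T x)) * \<psi> x) * indicator ?I x \<partial>lborel)"
      by (rule add_mono[OF pq(6) pq'(6)])
    also have "\<dots> = (\<integral>\<^sup>+x. ennreal (q (T x) * \<psi> x) * indicator ?I x + ennreal ((1 - q (T x)) * \<psi> x) * indicator ?I x \<partial>lborel)"
      by (rule nn_integral_add[symmetric]) auto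
    also have "\<dots> = (\<integral>\<^sup>+x. ennreal (\<psi> x * indicator ?I x) \<partial>lborel)"
      by (rule nn_integral_cong) (use q \<psi>0 in \<open>auto simp: indicator_def algebra_simps mult_right_le_one_le simp flip: ennreal_plus\<close>)
    also have "\<dots> = ennreal (LINT x|lborel. \<psi> x * indicator ?I x)"
    proof (rule nn_integral_eq_integral)
      have "(\<lambda>x. \<psi> x * indicator ?I x) = (\<lambda>x. \<sigma> x * (x - T x)\<^sup>2 * indicator ?I x + \<epsilon> * \<kappa> * indicator X x)"
        using sub by (intro ext) (auto simp: \<psi>_eq split: split_indicator)
      then show "integrable lborel (\<lambda>x. \<psi> x * indicator ?I x)" using integrable_cost intXZ by simp
    qed (simp add: \<psi>0)
    also have "(LINT x|lborel. \<psi> x * indicator ?I x) = C0 + \<epsilon> * \<kappa> * mX"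
    proof -
      have "(\<lambda>x. \<psi> x * indicator ?I x) = (\<lambda>x. \<sigma> x * (x - T x)\<^sup>2 * indicator ?I x + \<epsilon> * \<kappa> * indicator X x)"
        using sub by (intro ext) (auto simp: \<psi>_eq split: split_indicator)
      then show ?thesis unfolding C0_def using integrable_cost intXZ mXZ by simp
    qed
    finally show "W2sq (dens a b (f q)) (dens a b (\<lambda>x. q x * s x)) + W2sq (dens a b (f ?q')) (dens a b (\<lambda>x. (1 - q x) * s x))
      \<le> ennreal (C0 + \<epsilon> * \<kappa> * mX)" .
    have "0 \<le> (LINT x|lborel. \<psi> x * indicator ?I x)" by (rule integral_nonneg_AE) (auto simp: \<psi>0)
    then show "0 \<le> C0 + \<epsilon> * \<kappa> * mX"
      using \<open>(LINT x|lborel. \<psi> x * indicator ?I x) = C0 + \<epsilon> * \<kappa> * mX\<close> by simp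
  qed
  define g2 g1 where "g2 = energy_slope chi \<alpha>2" and "g1 = energy_slope chi \<alpha>1"
  define \<omega> where "\<omega> x = (chi (\<sigma> x) - chi 0) * indicator ?I x - \<epsilon> * g2 * indicator X x + \<delta> * g1 * indicator Z x" for x
  have pt: "(chi (f q x + f ?q' x) - chi 0) \<le> \<omega> x" if "x \<in> ?I" for x
  proof -
    consider "x \<in> X" "x \<notin> Z" | "x \<in> Z" "x \<notin> X" | "x \<notin> X" "x \<notin> Z" using disj by auto
    then show ?thesis
    proof cases
      case 1
      have "g2 * (\<sigma> x - (\<sigma> x - \<epsilon>)) \<le> chi (\<sigma> x) - chi (\<sigma> x - \<epsilon>)" unfolding g2_def
        by (rule energy_diff_ge[OF chi]) (use \<alpha> X[OF 1(1)] \<epsilon> in auto)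
      then show ?thesis using 1 that unfolding sumf \<omega>_def h_def by (simp add: algebra_simps)
    next
      case 2
      have "chi (\<sigma> x + \<delta>) - chi (\<sigma> x) \<le> g1 * (\<sigma> x + \<delta> - \<sigma> x)" unfolding g1_def
        by (rule energy_diff_le[OF chi]) (use \<alpha> Z[OF 2(1)] \<delta> \<sigma>_nonneg in auto)
      then show ?thesis using 2 that unfolding sumf \<omega>_def h_def by (simp add: algebra_simps)
    next
      case 3
      then show ?thesis using that unfolding sumf \<omega>_def h_def by simp
    qed
  qed
  have \<omega>0: "0 \<le> \<omega> x" for x
  proof (cases "x \<in> ?I")
    case True
    have "chi 0 \<le> chi (f q x + f ?q' x)" by (rule energy_ge_zero_value[OF chi]) (use pq(4) pq'(4) in simp)
    then show ?thesis using pt[OF True] by linarith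
  qed (use sub in \<open>auto simp: \<omega>_def indicator_def\<close>)
  have \<omega>_int: "integrable lborel \<omega>" "(LINT x|lborel. \<omega> x) = E0 - \<epsilon> * g2 * mX + \<delta> * g1 * mZ"
    unfolding \<omega>_def[abs_def] E0_def using integrable_ener intXZ mXZ by simp_all
  have E: "(\<integral>\<^sup>+ x. ennreal (chi (f q x + f ?q' x) - chi 0) * indicator ?I x \<partial>lborel) \<le> ennreal (E0 - \<epsilon> * g2 * mX + \<delta> * g1 * mZ)"
  proof -
    have "(\<integral>\<^sup>+ x. ennreal (chi (f q x + f ?q' x) - chi 0) * indicator ?I x \<partial>lborel) \<le> (\<integral>\<^sup>+ x. ennreal (\<omega> x) \<partial>lborel)"
      by (rule nn_integral_mono) (use pt in \<open>auto simp: indicator_def intro!: ennreal_leI\<close>)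
    also have "\<dots> = ennreal (LINT x|lborel. \<omega> x)" by (rule nn_integral_eq_integral[OF \<omega>_int(1)]) (simp add: \<omega>0)
    finally show ?thesis unfolding \<omega>_int(2) .
  qed
  have E1: "0 \<le> E0 - \<epsilon> * g2 * mX + \<delta> * g1 * mZ"
    unfolding \<omega>_int(2)[symmetric] by (rule integral_nonneg_AE) (auto simp: \<omega>0)
  have fma: "ennreal (u * v + w) = ennreal u * ennreal v + ennreal w" if "0 \<le> u" "0 \<le> v" "0 \<le> w" for u v w :: real
    using that by (simp add: ennreal_plus ennreal_mult)
  have "cost * ennreal (1 / (2 * \<tau>)) + ener \<le> ennreal (C0 + \<epsilon> * \<kappa> * mX) * ennreal (1 / (2 * \<tau>)) + ennreal (E0 - \<epsilon> * g2 * mX + \<delta> * g1 * mZ)"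
    by (rule competitor_bound[OF pq(3) pq'(3) pq(4) pq'(4) pq(5) pq'(5) W E])
  then have "ennreal (C0 * (1 / (2 * \<tau>)) + E0) \<le> ennreal ((C0 + \<epsilon> * \<kappa> * mX) * (1 / (2 * \<tau>)) + (E0 - \<epsilon> * g2 * mX + \<delta> * g1 * mZ))"
    unfolding cost_eq ener_eq C0_def[symmetric] E0_def[symmetric]
    by (subst (1 2) fma) (use C00 E00 C1 E1 tau in auto)
  then have "C0 * (1 / (2 * \<tau>)) + E0 \<le> (C0 + \<epsilon> * \<kappa> * mX) * (1 / (2 * \<tau>)) + (E0 - \<epsilon> * g2 * mX + \<delta> * g1 * mZ)"
    using C1 E1 tau by (subst (asm) ennreal_le_iff) (auto intro!: add_nonneg_nonneg)
  moreover have "\<delta> * g1 * mZ = \<epsilon> * mX * g1" unfolding \<delta>(3)[symmetric] by simp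
  ultimately have "\<epsilon> * mX * g2 - \<epsilon> * mX * g1 \<le> \<epsilon> * \<kappa> * mX * (1 / (2 * \<tau>))"
    unfolding distrib_right[of C0] mult.assoc[of \<epsilon> g2] mult.commute[of g2] by (simp only: mult.assoc)
  then have "\<epsilon> * mX * (g2 - g1) \<le> \<epsilon> * mX * (\<kappa> / (2 * \<tau>))"
    by (simp add: algebra_simps)
  then have "g2 - g1 \<le> \<kappa> / (2 * \<tau>)" using mult_pos_pos[OF \<epsilon>(1) mX(2)] by (rule mult_left_le_imp_le)
  then show ?thesis unfolding g2_def g1_def using tau by (simp add: field_simps)
qed

text \<open>A violating pair of points spreads, by continuity, to a violating product of two sets of positive
  measure; only countably many such products, built from basic open sets, have to be excluded.\<close>
lemma optimality_condition:
  obtains D where "D \<in> sets borel" "D \<subseteq> {a<..<b}" "AE x in lborel. x \<in> {a<..<b} \<longrightarrow> x \<in> D"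
    "\<And>x z. x \<in> D \<Longrightarrow> z \<in> D \<Longrightarrow> \<sigma> z < \<sigma> x \<Longrightarrow>
      energy_slope chi (\<sigma> x) - energy_slope chi (\<sigma> z) \<le> ((z - T x)\<^sup>2 - (x - T x)\<^sup>2) / (2 * \<tau>)"
proof -
  let ?g = "energy_slope chi"
  obtain B3 :: "(real \<times> real \<times> real) set set" where B3: "countable B3" "topological_basis B3"
    using ex_countable_basis by blast
  obtain B2 :: "(real \<times> real) set set" where B2: "countable B2" "topological_basis B2"
    using ex_countable_basis by blast
  define G where "G U W \<longleftrightarrow> (\<exists>\<alpha>0 \<alpha>1 \<alpha>2 \<alpha>3 \<kappa>. 0 \<le> \<alpha>0 \<and> \<alpha>0 < \<alpha>1 \<and> \<alpha>1 \<le> \<alpha>2 \<and> \<alpha>2 < \<alpha>3 \<and>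
      \<kappa> < 2 * \<tau> * (?g \<alpha>2 - ?g \<alpha>1) \<and> (\<forall>x t s z s'. (x, t, s) \<in> U \<and> (z, s') \<in> W \<longrightarrow>
        \<alpha>3 < s \<and> s' < \<alpha>0 \<and> (z - t)\<^sup>2 - (x - t)\<^sup>2 \<le> \<kappa>))" for U :: "(real \<times> real \<times> real) set" and W :: "(real \<times> real) set"
  define X where "X U = {x\<in>{a<..<b}. (x, T x, \<sigma> x) \<in> U}" for U
  define Z where "Z W = {z\<in>{a<..<b}. (z, \<sigma> z) \<in> W}" for W
  define N where "N p = (if emeasure lborel (X (fst p)) = 0 then X (fst p) else Z (snd p))" for p
  have null: "N (U, W) \<in> null_sets lborel" if "U \<in> B3" "W \<in> B2" "G U W" for U W
  proof -
    have [measurable]: "U \<in> sets borel" "W \<in> sets borel"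
      using topological_basis_open[OF B3(2) that(1)] topological_basis_open[OF B2(2) that(2)] by auto
    have XU [measurable]: "X U \<in> sets borel" unfolding X_def by measurable
    have ZW [measurable]: "Z W \<in> sets borel" unfolding Z_def by measurable
    have "emeasure lborel (Z W) = 0" if X0: "emeasure lborel (X U) \<noteq> 0"
    proof (rule ccontr)
      assume Z0: "emeasure lborel (Z W) \<noteq> 0"
      obtain x1 z1 where xz: "x1 \<in> X U" "z1 \<in> Z W" using X0 Z0 by (metis all_not_in_conv emeasure_empty)
      obtain \<alpha>0 \<alpha>1 \<alpha>2 \<alpha>3 \<kappa> where \<alpha>: "0 \<le> \<alpha>0" "\<alpha>0 < \<alpha>1" "\<alpha>1 \<le> \<alpha>2" "\<alpha>2 < \<alpha>3"
        and \<kappa>: "\<kappa> < 2 * \<tau> * (?g \<alpha>2 - ?g \<alpha>1)"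
        and box: "\<And>x t s z s'. (x, t, s) \<in> U \<Longrightarrow> (z, s') \<in> W \<Longrightarrow>
          \<alpha>3 < s \<and> s' < \<alpha>0 \<and> (z - t)\<^sup>2 - (x - t)\<^sup>2 \<le> \<kappa>"
        using \<open>G U W\<close> unfolding G_def by metis
      have "2 * \<tau> * (?g \<alpha>2 - ?g \<alpha>1) \<le> \<kappa>"
      proof (rule swap_bound[OF XU ZW _ _ _ _ \<alpha>])
        show "\<alpha>3 < \<sigma> x" if "x \<in> X U" for x
          using box[of x "T x" "\<sigma> x" z1 "\<sigma> z1"] that xz unfolding X_def Z_def by auto
        show "\<sigma> z < \<alpha>0" if "z \<in> Z W" for z
          using box[of x1 "T x1" "\<sigma> x1" z "\<sigma> z"] that xz unfolding X_def Z_def by auto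
        show "(z - T x)\<^sup>2 - (x - T x)\<^sup>2 \<le> \<kappa>" if "x \<in> X U" "z \<in> Z W" for x z
          using box[of x "T x" "\<sigma> x" z "\<sigma> z"] that unfolding X_def Z_def by auto
      qed (use X0 Z0 in \<open>auto simp: X_def Z_def zero_less_iff_neq_zero\<close>)
      then show False using \<kappa> by simp
    qed
    then show ?thesis unfolding N_def null_sets_def by auto
  qed
  define P where "P = {p \<in> B3 \<times> B2. G (fst p) (snd p)}"
  have "countable P" unfolding P_def using B3(1) B2(1) by simp
  then have UN: "(\<Union>p\<in>P. N p) \<in> null_sets lborel"
    by (rule null_sets_UN') (use null in \<open>auto simp: P_def\<close>)
  show ?thesis
  proof (rule that[of "{a<..<b} - (\<Union>p\<in>P. N p)"])
    show "{a<..<b} - (\<Union>p\<in>P. N p) \<in> sets borel" using UN by auto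
    show "AE x in lborel. x \<in> {a<..<b} \<longrightarrow> x \<in> {a<..<b} - (\<Union>p\<in>P. N p)"
      using AE_not_in[OF UN] by eventually_elim auto
    fix x z assume x: "x \<in> {a<..<b} - (\<Union>p\<in>P. N p)" and z: "z \<in> {a<..<b} - (\<Union>p\<in>P. N p)" and lt: "\<sigma> z < \<sigma> x"
    show "?g (\<sigma> x) - ?g (\<sigma> z) \<le> ((z - T x)\<^sup>2 - (x - T x)\<^sup>2) / (2 * \<tau>)"
    proof (rule ccontr)
      assume neg: "\<not> ?thesis"
      define c where "c = (z - T x)\<^sup>2 - (x - T x)\<^sup>2"
      define k where "k = c / (2 * \<tau>)"
      define e where "e = (?g (\<sigma> x) - ?g (\<sigma> z) - k) / 3"
      have e: "e > 0" using neg unfolding e_def k_def c_def by simp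
      note cont = continuous_on_energy_slope[OF chi, unfolded continuous_on_iff]
      define m where "m = (\<sigma> x + \<sigma> z) / 2"
      obtain d1 where d1: "d1 > 0" "\<And>y. y \<ge> 0 \<Longrightarrow> \<bar>y - \<sigma> z\<bar> < d1 \<Longrightarrow> \<bar>?g y - ?g (\<sigma> z)\<bar> < e"
        using cont[rule_format, of "\<sigma> z" e] e \<sigma>_nonneg by (auto simp: dist_real_def)
      obtain d2 where d2: "d2 > 0" "\<And>y. y \<ge> 0 \<Longrightarrow> \<bar>y - \<sigma> x\<bar> < d2 \<Longrightarrow> \<bar>?g y - ?g (\<sigma> x)\<bar> < e"
        using cont[rule_format, of "\<sigma> x" e] e \<sigma>_nonneg by (auto simp: dist_real_def)
      define \<alpha>1 where "\<alpha>1 = min m (\<sigma> z + d1 / 2)"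
      define \<alpha>2 where "\<alpha>2 = max m (\<sigma> x - d2 / 2)"
      define \<alpha>0 where "\<alpha>0 = (\<sigma> z + \<alpha>1) / 2"
      define \<alpha>3 where "\<alpha>3 = (\<sigma> x + \<alpha>2) / 2"
      define \<kappa> where "\<kappa> = c + \<tau> * e"
      have m: "\<sigma> z < m" "m < \<sigma> x" unfolding m_def using lt by auto
      have \<alpha>: "0 \<le> \<alpha>0" "\<sigma> z < \<alpha>0" "\<alpha>0 < \<alpha>1" "\<alpha>1 \<le> \<alpha>2" "\<alpha>2 < \<alpha>3" "\<alpha>3 < \<sigma> x"
        unfolding \<alpha>0_def \<alpha>1_def \<alpha>2_def \<alpha>3_def using m d1(1) d2(1) \<sigma>_nonneg[of z] by auto
      have "\<bar>?g \<alpha>1 - ?g (\<sigma> z)\<bar> < e"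
        using \<alpha> d1(1) by (intro d1(2)) (auto simp: \<alpha>1_def)
      moreover have "\<bar>?g \<alpha>2 - ?g (\<sigma> x)\<bar> < e"
        using \<alpha> d2(1) by (intro d2(2)) (auto simp: \<alpha>2_def)
      moreover have "?g (\<sigma> x) - ?g (\<sigma> z) = k + 3 * e" unfolding e_def by (simp add: field_simps)
      ultimately have "?g \<alpha>2 - ?g \<alpha>1 > k + e" by linarith
      then have "2 * \<tau> * (?g \<alpha>2 - ?g \<alpha>1) > 2 * \<tau> * (k + e)" using tau by (intro mult_strict_left_mono) auto
      moreover have "2 * \<tau> * (k + e) = c + 2 * (\<tau> * e)" using tau by (simp add: k_def field_simps)
      ultimately have \<kappa>: "c < \<kappa>" "\<kappa> < 2 * \<tau> * (?g \<alpha>2 - ?g \<alpha>1)"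
        using mult_pos_pos[OF tau e] by (auto simp: \<kappa>_def)
      define Op where "Op = {p :: (real \<times> real \<times> real) \<times> (real \<times> real).
        \<alpha>3 < snd (snd (fst p)) \<and> snd (snd p) < \<alpha>0 \<and>
        (fst (snd p) - fst (snd (fst p)))\<^sup>2 - (fst (fst p) - fst (snd (fst p)))\<^sup>2 < \<kappa>}"
      have "open Op" unfolding Op_def
        by (intro open_Collect_conj open_Collect_less continuous_intros)
      moreover have "((x, T x, \<sigma> x), (z, \<sigma> z)) \<in> Op" unfolding Op_def using \<alpha> \<kappa> c_def by simp
      ultimately obtain U0 W0 where UW0: "open U0" "open W0" "(x, T x, \<sigma> x) \<in> U0" "(z, \<sigma> z) \<in> W0" "U0 \<times> W0 \<subseteq> Op"
        by (rule open_prod_elim) auto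
      obtain U where U: "U \<in> B3" "(x, T x, \<sigma> x) \<in> U" "U \<subseteq> U0"
        using topological_basisE[OF B3(2) UW0(1,3)] by blast
      obtain W where W: "W \<in> B2" "(z, \<sigma> z) \<in> W" "W \<subseteq> W0"
        using topological_basisE[OF B2(2) UW0(2,4)] by blast
      have sub: "((x', t, s), (z', s')) \<in> Op" if "(x', t, s) \<in> U" "(z', s') \<in> W" for x' t s z' s'
        using that U(3) W(3) UW0(5) by blast
      have "G U W" unfolding G_def
        by (rule exI[of _ \<alpha>0], rule exI[of _ \<alpha>1], rule exI[of _ \<alpha>2], rule exI[of _ \<alpha>3], rule exI[of _ \<kappa>])
           (use \<alpha> \<kappa> sub in \<open>force simp: Op_def\<close>)
      then have "(U, W) \<in> P" unfolding P_def using U W by simp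
      then have "x \<notin> N (U, W)" "z \<notin> N (U, W)" using x z by auto
      then show False using x z U(2) W(2) unfolding N_def X_def Z_def by (auto split: if_splits)
    qed
  qed auto
qed

lemma emeasure_s_eq: "A \<in> sets borel \<Longrightarrow> emeasure (dens a b s) A = emeasure (dens a b \<sigma>) (T -` A)"
  unfolding push_\<sigma>[symmetric] by (subst emeasure_distr) auto

lemma vimage_T_borel: "A \<in> sets borel \<Longrightarrow> T -` A \<in> sets borel"
  using measurable_sets[OF meas(5), of A] by simp

lemma lower_density_farther:
  assumes "\<And>x z. x \<in> D \<Longrightarrow> z \<in> D \<Longrightarrow> \<sigma> z < \<sigma> x \<Longrightarrow>
      energy_slope chi (\<sigma> x) - energy_slope chi (\<sigma> z) \<le> ((z - T x)\<^sup>2 - (x - T x)\<^sup>2) / (2 * \<tau>)"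
    and "x \<in> D" "z \<in> D" "\<sigma> z < \<sigma> x"
  shows "0 < (z - x) * (z + x - 2 * T x)"
proof -
  have "0 < energy_slope chi (\<sigma> x) - energy_slope chi (\<sigma> z)"
    using energy_slope_strict_mono[OF chi \<sigma>_nonneg assms(4)] by simp
  then have "0 < ((z - T x)\<^sup>2 - (x - T x)\<^sup>2) / (2 * \<tau>)" using assms(1)[OF assms(2-4)] by linarith
  then have "0 < (z - T x)\<^sup>2 - (x - T x)\<^sup>2" using tau by (simp add: zero_less_divide_iff)
  then show ?thesis by (simp add: power2_eq_square algebra_simps)
qed

lemma slope_diff_le:
  assumes "\<And>x z. x \<in> D \<Longrightarrow> z \<in> D \<Longrightarrow> \<sigma> z < \<sigma> x \<Longrightarrow>
      energy_slope chi (\<sigma> x) - energy_slope chi (\<sigma> z) \<le> ((z - T x)\<^sup>2 - (x - T x)\<^sup>2) / (2 * \<tau>)"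
    and "x \<in> D" "z \<in> D" "\<sigma> z < \<sigma> x" "D \<subseteq> {a<..<b}"
  shows "energy_slope chi (\<sigma> x) - energy_slope chi (\<sigma> z) \<le> (b - a) / \<tau> * \<bar>z - x\<bar>"
proof -
  have "a < x" "x < b" "a < z" "z < b" "a \<le> T x" "T x \<le> b" using assms(2,3,5) T(2)[of x] by auto
  then have "\<bar>z + x - 2 * T x\<bar> \<le> 2 * (b - a)" by (simp add: abs_le_iff)
  then have "\<bar>z - x\<bar> * \<bar>z + x - 2 * T x\<bar> \<le> \<bar>z - x\<bar> * (2 * (b - a))"
    by (intro mult_left_mono) auto
  then have "(z - x) * (z + x - 2 * T x) \<le> \<bar>z - x\<bar> * (2 * (b - a))"
    unfolding abs_mult[symmetric] by linarith
  moreover have "(z - T x)\<^sup>2 - (x - T x)\<^sup>2 = (z - x) * (z + x - 2 * T x)"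
    by (simp add: power2_eq_square algebra_simps)
  ultimately have "((z - T x)\<^sup>2 - (x - T x)\<^sup>2) / (2 * \<tau>) \<le> \<bar>z - x\<bar> * (2 * (b - a)) / (2 * \<tau>)"
    using tau by (intro divide_right_mono) auto
  also have "\<dots> = (b - a) / \<tau> * \<bar>z - x\<bar>" using tau by (simp add: field_simps)
  finally show ?thesis using assms(1)[OF assms(2-4)] by linarith
qed

text \<open>A maximal interval on which the new density exceeds K is mapped into itself by the transport map,
  so the old density has to exceed K somewhere on it as well.\<close>
lemma superlevel_interval:
  assumes D: "D \<subseteq> {a<..<b}" "AE x in lborel. x \<in> {a<..<b} \<longrightarrow> x \<in> D"
    and opt: "\<And>x z. x \<in> D \<Longrightarrow> z \<in> D \<Longrightarrow> \<sigma> z < \<sigma> x \<Longrightarrow>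
      energy_slope chi (\<sigma> x) - energy_slope chi (\<sigma> z) \<le> ((z - T x)\<^sup>2 - (x - T x)\<^sup>2) / (2 * \<tau>)"
    and D': "AE x in lborel. x \<in> {a<..<b} \<longrightarrow> x \<in> D'"
    and x0: "x0 \<in> D" "0 \<le> K" "K < \<sigma> x0"
  obtains c d y where "c < x0" "x0 < d" "c < y" "y < d" "y \<in> D'" "K < s y" "a \<le> c" "d \<le> b"
    "\<And>z. z \<in> D \<Longrightarrow> c < z \<Longrightarrow> z < d \<Longrightarrow> K < \<sigma> z"
proof -
  let ?g = "energy_slope chi"
  define r where "r = (?g (\<sigma> x0) - ?g K) * \<tau> / (b - a)"
  have r: "0 < r" unfolding r_def using energy_slope_strict_mono[OF chi x0(2,3)] ab tau by simp
  have near: "r \<le> \<bar>z - x0\<bar>" if "z \<in> D" "\<sigma> z \<le> K" for z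
  proof -
    have "?g (\<sigma> x0) - ?g K \<le> ?g (\<sigma> x0) - ?g (\<sigma> z)" using energy_slope_mono[OF chi \<sigma>_nonneg that(2)] by simp
    also have "\<dots> \<le> (b - a) / \<tau> * \<bar>z - x0\<bar>" by (rule slope_diff_le[OF opt]) (use x0 that D in auto)
    finally show ?thesis unfolding r_def using ab tau by (simp add: field_simps)
  qed
  define L R where "L = insert a {z \<in> D. z < x0 \<and> \<sigma> z \<le> K}" and "R = insert b {z \<in> D. x0 < z \<and> \<sigma> z \<le> K}"
  define c d where "c = Sup L" and "d = Inf R"
  have xI: "a < x0" "x0 < b" using x0(1) D(1) by auto
  have bL: "bdd_above L" unfolding L_def by (rule bdd_aboveI[of _ x0]) (use xI in auto)
  have bR: "bdd_below R" unfolding R_def by (rule bdd_belowI[of _ x0]) (use xI in auto)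
  have L_le: "z \<le> c" if "z \<in> L" for z unfolding c_def by (rule cSup_upper[OF that bL])
  have R_ge: "d \<le> z" if "z \<in> R" for z unfolding d_def by (rule cInf_lower[OF that bR])
  have "c \<le> max a (x0 - r)" unfolding c_def
    by (rule cSup_least) (use near in \<open>force simp: L_def\<close>)+
  then have cx: "c < x0" using r xI by linarith
  have "min b (x0 + r) \<le> d" unfolding d_def
    by (rule cInf_greatest) (use near in \<open>force simp: R_def\<close>)+
  then have xd: "x0 < d" using r xI by linarith
  have ac: "a \<le> c" "d \<le> b" using L_le[of a] R_ge[of b] by (auto simp: L_def R_def)
  have lev: "K < \<sigma> z" if "z \<in> D" "c < z" "z < d" for z
  proof (rule ccontr)
    assume "\<not> K < \<sigma> z"
    then have "z \<in> L \<or> z \<in> R" unfolding L_def R_def using that x0 by (cases z x0 rule: linorder_cases) auto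
    then show False using L_le R_ge that by fastforce
  qed
  have Tin: "T z \<in> {c..d}" if z: "z \<in> D" "c < z" "z < d" for z
  proof -
    have "w \<le> T z" if w: "w \<in> L" for w
    proof (cases "w = a")
      case False
      then have w': "w \<in> D" "\<sigma> w < \<sigma> z" using w lev[OF z] by (auto simp: L_def)
      have "0 < (w - z) * (w + z - 2 * T z)" by (rule lower_density_farther[OF opt z(1) w'])
      moreover have "w < z" using L_le[OF w] z by simp
      ultimately have "w + z - 2 * T z < 0" by (simp add: zero_less_mult_iff)
      then show ?thesis using \<open>w < z\<close> by simp
    qed (use T(2)[of z] in auto)
    then have "c \<le> T z" unfolding c_def by (intro cSup_least) (auto simp: L_def)
    moreover have "T z \<le> w" if w: "w \<in> R" for w
    proof (cases "w = b")
      case False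
      then have w': "w \<in> D" "\<sigma> w < \<sigma> z" using w lev[OF z] by (auto simp: R_def)
      have "0 < (w - z) * (w + z - 2 * T z)" by (rule lower_density_farther[OF opt z(1) w'])
      moreover have "z < w" using R_ge[OF w] z by simp
      ultimately have "0 < w + z - 2 * T z" by (simp add: zero_less_mult_iff)
      then show ?thesis using \<open>z < w\<close> by simp
    qed (use T(2)[of z] in auto)
    then have "T z \<le> d" unfolding d_def by (intro cInf_greatest) (auto simp: R_def)
    ultimately show ?thesis by simp
  qed
  have "\<exists>y. c < y \<and> y < d \<and> y \<in> D' \<and> K < s y"
  proof (rule ccontr)
    assume neg: "\<not> ?thesis"
    have "AE x in lborel. x \<in> {c<..<d} \<longrightarrow> K < \<sigma> x"
      using D(2) by eventually_elim (use lev ac in auto)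
    then have "ennreal (K * (d - c)) < (\<integral>\<^sup>+x. ennreal (\<sigma> x) * indicator {c<..<d} x \<partial>lborel)"
      by (intro nn_integral_gt_const) (use cx xd x0 in auto)
    also have "\<dots> \<le> (\<integral>\<^sup>+x. ennreal (\<sigma> x) * indicator (T -` {c..d} \<inter> {a<..<b}) x \<partial>lborel)"
      by (rule nn_integral_mono_AE, use D(2) in eventually_elim)
         (use Tin ac in \<open>auto simp: indicator_def\<close>)
    also have "\<dots> = emeasure (dens a b s) {c..d}"
      by (subst emeasure_s_eq) (auto simp: emeasure_dens vimage_T_borel)
    also have "\<dots> = (\<integral>\<^sup>+x. ennreal (s x) * indicator ({c..d} \<inter> {a<..<b}) x \<partial>lborel)"
      by (rule emeasure_dens) auto
    also have "\<dots> \<le> (\<integral>\<^sup>+x. ennreal K * indicator {c<..<d} x \<partial>lborel)"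
    proof (rule nn_integral_mono_AE)
      show "AE x in lborel. ennreal (s x) * indicator ({c..d} \<inter> {a<..<b}) x \<le> ennreal K * indicator {c<..<d} x"
        using D' AE_lborel_singleton[of c] AE_lborel_singleton[of d]
      proof eventually_elim
        case (elim x)
        then show ?case using neg[simplified, rule_format, of x] by (auto simp: indicator_def intro!: ennreal_leI)
      qed
    qed
    also have "\<dots> = ennreal (K * (d - c))" using cx xd x0 by (simp add: nn_integral_cmult ennreal_mult)
    finally show False by simp
  qed
  then show ?thesis using that[OF cx xd] ac lev by blast
qed

text \<open>Dually, only mass from inside a maximal interval with density below K is transported into it.\<close>
lemma sublevel_interval:
  assumes D: "D \<subseteq> {a<..<b}" "AE x in lborel. x \<in> {a<..<b} \<longrightarrow> x \<in> D"
    and opt: "\<And>x z. x \<in> D \<Longrightarrow> z \<in> D \<Longrightarrow> \<sigma> z < \<sigma> x \<Longrightarrow>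
      energy_slope chi (\<sigma> x) - energy_slope chi (\<sigma> z) \<le> ((z - T x)\<^sup>2 - (x - T x)\<^sup>2) / (2 * \<tau>)"
    and D': "AE x in lborel. x \<in> {a<..<b} \<longrightarrow> x \<in> D'"
    and x0: "x0 \<in> D" "\<sigma> x0 < K"
  obtains c d y where "c < x0" "x0 < d" "c < y" "y < d" "y \<in> D'" "s y < K" "a \<le> c" "d \<le> b"
    "\<And>z. z \<in> D \<Longrightarrow> c < z \<Longrightarrow> z < d \<Longrightarrow> \<sigma> z < K"
proof -
  let ?g = "energy_slope chi"
  have K0: "0 \<le> K" using x0(2) \<sigma>_nonneg[of x0] by simp
  define r where "r = (?g K - ?g (\<sigma> x0)) * \<tau> / (b - a)"
  have r: "0 < r" unfolding r_def using energy_slope_strict_mono[OF chi \<sigma>_nonneg x0(2)] ab tau by simp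
  have near: "r \<le> \<bar>z - x0\<bar>" if "z \<in> D" "K \<le> \<sigma> z" for z
  proof -
    have "?g K - ?g (\<sigma> x0) \<le> ?g (\<sigma> z) - ?g (\<sigma> x0)" using energy_slope_mono[OF chi K0 that(2)] by simp
    also have "\<dots> \<le> (b - a) / \<tau> * \<bar>x0 - z\<bar>" by (rule slope_diff_le[OF opt]) (use x0 that D in auto)
    finally show ?thesis unfolding r_def using ab tau by (simp add: field_simps abs_minus_commute)
  qed
  define L R where "L = insert a {z \<in> D. z < x0 \<and> K \<le> \<sigma> z}" and "R = insert b {z \<in> D. x0 < z \<and> K \<le> \<sigma> z}"
  define c d where "c = Sup L" and "d = Inf R"
  have xI: "a < x0" "x0 < b" using x0(1) D(1) by auto
  have bL: "bdd_above L" unfolding L_def by (rule bdd_aboveI[of _ x0]) (use xI in auto)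
  have bR: "bdd_below R" unfolding R_def by (rule bdd_belowI[of _ x0]) (use xI in auto)
  have L_le: "z \<le> c" if "z \<in> L" for z unfolding c_def by (rule cSup_upper[OF that bL])
  have R_ge: "d \<le> z" if "z \<in> R" for z unfolding d_def by (rule cInf_lower[OF that bR])
  have "c \<le> max a (x0 - r)" unfolding c_def
    by (rule cSup_least) (use near in \<open>force simp: L_def\<close>)+
  then have cx: "c < x0" using r xI by linarith
  have "min b (x0 + r) \<le> d" unfolding d_def
    by (rule cInf_greatest) (use near in \<open>force simp: R_def\<close>)+
  then have xd: "x0 < d" using r xI by linarith
  have ac: "a \<le> c" "d \<le> b" using L_le[of a] R_ge[of b] by (auto simp: L_def R_def)
  have lev: "\<sigma> z < K" if "z \<in> D" "c < z" "z < d" for z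
  proof (rule ccontr)
    assume "\<not> \<sigma> z < K"
    then have "z \<in> L \<or> z \<in> R" unfolding L_def R_def using that x0 by (cases z x0 rule: linorder_cases) auto
    then show False using L_le R_ge that by fastforce
  qed
  have dense: "\<exists>w\<in>D. u < w \<and> w < v" if "c \<le> u" "u < v" "v \<le> d" for u v
  proof -
    have "AE x in lborel. x \<in> {u<..<v} \<longrightarrow> x \<in> D" using D(2) by eventually_elim (use that ac in auto)
    from AE_Ioo_ex[OF this that(2)] show ?thesis by auto
  qed
  have Tleft: "T x \<le> c" if x: "a < x" "x < c" for x
  proof -
    obtain z where z: "z \<in> L" "x < z"
      using x(2) unfolding c_def by (metis L_def insert_not_empty less_cSupE)
    then have z': "z \<in> D" "z \<le> c" "K \<le> \<sigma> z" using L_le[OF z(1)] x by (auto simp: L_def)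
    have lt: "T z < w" if w: "w \<in> D" "c < w" "w < d" for w
    proof -
      have "\<sigma> w < \<sigma> z" using lev[OF w] z' by simp
      with lower_density_farther[OF opt z'(1) w(1)] have "0 < (w - z) * (w + z - 2 * T z)" by blast
      moreover have "z < w" using z' w by simp
      ultimately have "0 < w + z - 2 * T z" by (simp add: zero_less_mult_iff)
      then show ?thesis using \<open>z < w\<close> by simp
    qed
    have "T z \<le> c"
    proof (rule ccontr)
      assume "\<not> T z \<le> c"
      then obtain w where "w \<in> D" "c < w" "w < min d (T z)" using dense[of c "min d (T z)"] cx xd by auto
      then show False using lt[of w] by simp
    qed
    then show ?thesis using monoD[OF T(1), of x z] z by simp
  qed
  have Tright: "d \<le> T x" if x: "d < x" "x < b" for x
  proof -
    obtain z where z: "z \<in> R" "z < x"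
      using x(1) unfolding d_def by (metis R_def insert_not_empty cInf_lessD)
    then have z': "z \<in> D" "d \<le> z" "K \<le> \<sigma> z" using R_ge[OF z(1)] x by (auto simp: R_def)
    have lt: "w < T z" if w: "w \<in> D" "c < w" "w < d" for w
    proof -
      have "\<sigma> w < \<sigma> z" using lev[OF w] z' by simp
      with lower_density_farther[OF opt z'(1) w(1)] have "0 < (w - z) * (w + z - 2 * T z)" by blast
      moreover have "w < z" using z' w by simp
      ultimately have "w + z - 2 * T z < 0" by (simp add: zero_less_mult_iff)
      then show ?thesis using \<open>w < z\<close> by simp
    qed
    have "d \<le> T z"
    proof (rule ccontr)
      assume "\<not> d \<le> T z"
      then obtain w where "w \<in> D" "max c (T z) < w" "w < d" using dense[of "max c (T z)" d] cx xd by auto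
      then show False using lt[of w] by simp
    qed
    then show ?thesis using monoD[OF T(1), of z x] z by simp
  qed
  have "\<exists>y. c < y \<and> y < d \<and> y \<in> D' \<and> s y < K"
  proof (rule ccontr)
    assume neg: "\<not> ?thesis"
    have "ennreal (K * (d - c)) = (\<integral>\<^sup>+x. ennreal K * indicator {c<..<d} x \<partial>lborel)"
      using cx xd K0 by (simp add: nn_integral_cmult ennreal_mult)
    also have "\<dots> \<le> (\<integral>\<^sup>+x. ennreal (s x) * indicator ({c<..<d} \<inter> {a<..<b}) x \<partial>lborel)"
    proof (rule nn_integral_mono_AE)
      show "AE x in lborel. ennreal K * indicator {c<..<d} x \<le> ennreal (s x) * indicator ({c<..<d} \<inter> {a<..<b}) x"
        using D'
      proof eventually_elim
        case (elim x)
        then show ?case using neg[simplified, rule_format, of x] ac by (auto simp: indicator_def intro!: ennreal_leI)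
      qed
    qed
    also have "\<dots> = emeasure (dens a b s) {c<..<d}" by (rule emeasure_dens[symmetric]) auto
    also have "\<dots> = (\<integral>\<^sup>+x. ennreal (\<sigma> x) * indicator (T -` {c<..<d} \<inter> {a<..<b}) x \<partial>lborel)"
      by (subst emeasure_s_eq) (auto simp: emeasure_dens vimage_T_borel)
    also have "\<dots> \<le> (\<integral>\<^sup>+x. ennreal (\<sigma> x) * indicator {c<..<d} x \<partial>lborel)"
    proof (rule nn_integral_mono_AE)
      show "AE x in lborel. ennreal (\<sigma> x) * indicator (T -` {c<..<d} \<inter> {a<..<b}) x \<le> ennreal (\<sigma> x) * indicator {c<..<d} x"
        using AE_lborel_singleton[of c] AE_lborel_singleton[of d]
      proof eventually_elim
        case (elim x)
        then show ?case using Tleft[of x] Tright[of x] by (fastforce simp: indicator_def)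
      qed
    qed
    also have "\<dots> < ennreal (K * (d - c))"
    proof (rule nn_integral_lt_const)
      show "AE x in lborel. x \<in> {c<..<d} \<longrightarrow> \<sigma> x < K"
        using D(2) by eventually_elim (use lev ac in auto)
    qed (use cx xd \<sigma>_nonneg in auto)
    finally show False by simp
  qed
  then show ?thesis using that[OF cx xd] ac lev by blast
qed

lemma diffusion_bv:
  assumes D': "AE x in lborel. x \<in> {a<..<b} \<longrightarrow> x \<in> D'" "bv_on D' s V"
  obtains D where "D \<in> sets borel" "D \<subseteq> {a<..<b}" "AE x in lborel. x \<in> {a<..<b} \<longrightarrow> x \<in> D"
    "bv_on D \<sigma> V" "\<And>x. x \<in> D \<Longrightarrow> \<sigma> x \<le> M"
proof -
  obtain D where D: "D \<in> sets borel" "D \<subseteq> {a<..<b}" "AE x in lborel. x \<in> {a<..<b} \<longrightarrow> x \<in> D"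
    and opt: "\<And>x z. x \<in> D \<Longrightarrow> z \<in> D \<Longrightarrow> \<sigma> z < \<sigma> x \<Longrightarrow>
      energy_slope chi (\<sigma> x) - energy_slope chi (\<sigma> z) \<le> ((z - T x)\<^sup>2 - (x - T x)\<^sup>2) / (2 * \<tau>)"
    using optimality_condition by blast
  have sup: "\<exists>c d y. c < x \<and> x < d \<and> c < y \<and> y < d \<and> y \<in> D' \<and> K < s y \<and> a \<le> c \<and> d \<le> b \<and>
      (\<forall>z\<in>D. c < z \<and> z < d \<longrightarrow> K < \<sigma> z)" if "x \<in> D" "0 \<le> K" "K < \<sigma> x" for x K
    by (rule superlevel_interval[OF D(2,3) _ D'(1) that]) (erule (2) opt, blast)
  have sub: "\<exists>c d y. c < x \<and> x < d \<and> c < y \<and> y < d \<and> y \<in> D' \<and> s y < K \<and> a \<le> c \<and> d \<le> b \<and>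
      (\<forall>z\<in>D. c < z \<and> z < d \<longrightarrow> \<sigma> z < K)" if "x \<in> D" "\<sigma> x < K" for x K
    by (rule sublevel_interval[OF D(2,3) _ D'(1) that]) (erule (2) opt, blast)
  have M0: "0 \<le> M" using s[of 0] by linarith
  have bound: "\<sigma> x \<le> M" if x: "x \<in> D" for x
  proof (rule ccontr)
    assume "\<not> \<sigma> x \<le> M"
    then obtain y where "M < s y" using sup[OF x M0] by auto
    then show False using s(2)[of y] by simp
  qed
  have V0: "0 \<le> V" using bv_on_nonneg[OF D'(2)] .
  have "lvar \<sigma> xs \<le> V" if xs: "sorted_wrt (<) xs" "set xs \<subseteq> D" for xs
  proof (rule ccontr)
    assume "\<not> lvar \<sigma> xs \<le> V"
    then obtain ys where ys: "sorted_wrt (<) ys" "set ys \<subseteq> D" "lvar \<sigma> ys > V"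
      and alt: "\<And>i. Suc (Suc i) < length ys \<Longrightarrow> (\<sigma> (ys ! i) < \<sigma> (ys ! Suc i) \<and> \<sigma> (ys ! Suc (Suc i)) < \<sigma> (ys ! Suc i))
        \<or> (\<sigma> (ys ! Suc i) < \<sigma> (ys ! i) \<and> \<sigma> (ys ! Suc i) < \<sigma> (ys ! Suc (Suc i)))"
      using lvar_alternating[OF xs, of V \<sigma>] by (auto simp: not_le)
    define n where "n = length ys - 1"
    define x where "x i = ys ! i" for i
    define f where "f i = \<sigma> (x i)" for i
    have lv: "lvar \<sigma> ys = (\<Sum>i<n. \<bar>f (Suc i) - f i\<bar>)" unfolding lvar_def n_def f_def x_def ..
    have n: "n > 0" using ys(3) V0 unfolding lv by (cases n) auto
    then have len: "length ys = Suc n" unfolding n_def by simp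
    have xD: "x i \<in> D" if "i \<le> n" for i using that ys(2) len unfolding x_def by auto
    have xlt: "x i < x (Suc i)" if "i < n" for i
      using sorted_wrt_nth_less[OF ys(1), of i "Suc i"] that len unfolding x_def by auto
    have alt': "(f i < f (Suc i) \<and> f (Suc (Suc i)) < f (Suc i)) \<or> (f (Suc i) < f i \<and> f (Suc i) < f (Suc (Suc i)))"
      if "Suc i < n" for i using alt[of i] that len unfolding f_def x_def by auto
    have neq: "f i \<noteq> f (Suc i)" if "i < n" for i
    proof (cases "n = 1")
      case True
      then show ?thesis using ys(3) V0 that unfolding lv by auto
    next
      case False
      then show ?thesis using alt'[of i] alt'[of "i - 1"] that by (cases "Suc i < n"; cases i) auto
    qed
    define mx where "mx i \<longleftrightarrow> (if i < n then f (Suc i) < f i else f (i - 1) < f i)" for i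
    have mx_Suc: "mx (Suc i) \<longleftrightarrow> \<not> mx i" if "i < n" for i
      using that alt'[of i] neq[of i] unfolding mx_def by (cases "Suc i < n") auto
    define e where "e = Min (insert (lvar \<sigma> ys - V) ((\<lambda>i. \<bar>f (Suc i) - f i\<bar>) ` {..<n}))"
    have e: "0 < e" "e \<le> lvar \<sigma> ys - V" "\<And>i. i < n \<Longrightarrow> e \<le> \<bar>f (Suc i) - f i\<bar>"
      unfolding e_def using ys(3) neq by (auto simp: Min_gr_iff) (metis abs_0_eq abs_ge_zero eq_iff_diff_eq_0 less_eq_real_def)
    define \<delta> where "\<delta> = e / (4 * n)"
    have \<delta>: "0 < \<delta>" "2 * \<delta> < e" "2 * \<delta> * n < e"
      unfolding \<delta>_def using e(1) n by (auto simp: field_simps)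
    define K where "K i = (if mx i then f i - \<delta> else f i + \<delta>)" for i
    have "\<exists>c d y. c < x i \<and> x i < d \<and> c < y \<and> y < d \<and> y \<in> D' \<and> a \<le> c \<and> d \<le> b \<and> (mx i \<longrightarrow> K i < s y) \<and> (\<not> mx i \<longrightarrow> s y < K i) \<and>
       (\<forall>z\<in>D. c < z \<and> z < d \<longrightarrow> (mx i \<longrightarrow> K i < \<sigma> z) \<and> (\<not> mx i \<longrightarrow> \<sigma> z < K i))" if i: "i \<le> n" for i
    proof (cases "mx i")
      case True
      have "\<delta> \<le> f i"
      proof (cases "i < n")
        case True
        then show ?thesis using \<open>mx i\<close> e(3)[of i] \<delta> \<sigma>_nonneg[of "x (Suc i)"] unfolding mx_def f_def by auto
      next
        case False
        then show ?thesis using \<open>mx i\<close> e(3)[of "i - 1"] \<delta> \<sigma>_nonneg[of "x (i - 1)"] n i unfolding mx_def f_def by auto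
      qed
      then have "0 \<le> K i" "K i < \<sigma> (x i)" using True \<delta> unfolding K_def f_def by auto
      from sup[OF xD[OF i] this] show ?thesis using True by simp blast
    next
      case False
      then have "\<sigma> (x i) < K i" using \<delta> unfolding K_def f_def by auto
      from sub[OF xD[OF i] this] show ?thesis using False by simp blast
    qed
    then obtain c d y where cdy: "\<And>i. i \<le> n \<Longrightarrow> c i < x i \<and> x i < d i \<and> c i < y i \<and> y i < d i \<and> y i \<in> D' \<and>
         a \<le> c i \<and> d i \<le> b \<and> (mx i \<longrightarrow> K i < s (y i)) \<and> (\<not> mx i \<longrightarrow> s (y i) < K i) \<and>
       (\<forall>z\<in>D. c i < z \<and> z < d i \<longrightarrow> (mx i \<longrightarrow> K i < \<sigma> z) \<and> (\<not> mx i \<longrightarrow> \<sigma> z < K i))"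
      by metis
    have sep: "f (Suc i) - f i > 2 * \<delta> \<and> \<not> mx i \<and> mx (Suc i) \<or> f i - f (Suc i) > 2 * \<delta> \<and> mx i \<and> \<not> mx (Suc i)" if "i < n" for i
      using that e(3)[of i] \<delta> mx_Suc[of i] unfolding mx_def[of i] by auto
    have order: "d i \<le> c (Suc i)" if i: "i < n" for i
    proof (rule ccontr)
      assume "\<not> ?thesis"
      then have lt: "max (c i) (c (Suc i)) < min (d i) (d (Suc i))"
        using cdy[of i] cdy[of "Suc i"] xlt[OF i] i by auto
      have "AE z in lborel. z \<in> {max (c i) (c (Suc i))<..<min (d i) (d (Suc i))} \<longrightarrow> z \<in> D"
        using D(3) by eventually_elim (use cdy[of i] i in auto)
      from AE_Ioo_ex[OF this lt] obtain z where "z \<in> D" "c i < z" "z < d i" "c (Suc i) < z" "z < d (Suc i)" by auto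
      then have "(mx i \<longrightarrow> K i < \<sigma> z) \<and> (\<not> mx i \<longrightarrow> \<sigma> z < K i)"
          "(mx (Suc i) \<longrightarrow> K (Suc i) < \<sigma> z) \<and> (\<not> mx (Suc i) \<longrightarrow> \<sigma> z < K (Suc i))"
        using cdy[of i] cdy[of "Suc i"] i by simp_all
      then show False using sep[OF i] unfolding K_def by auto
    qed
    have ylt: "y i < y (Suc i)" if "i < n" for i
      using order[OF that] cdy[of i] cdy[of "Suc i"] that by linarith
    have ymono: "y i < y j" if "i < j" "j \<le> n" for i j
      using that
    proof (induction j)
      case (Suc j)
      then show ?case using ylt[of j] by (cases "i = j") auto
    qed simp
    define zs where "zs = map y [0..<Suc n]"
    have "sorted_wrt (<) zs" unfolding zs_def sorted_wrt_map
      by (rule sorted_wrt_mono_rel[OF _ sorted_wrt_upt]) (auto intro: ymono)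
    moreover have "set zs \<subseteq> D'" unfolding zs_def using cdy by auto
    ultimately have "lvar s zs \<le> V" by (rule bv_on_lvar_le[OF D'(2)])
    moreover have "lvar s zs = (\<Sum>i<n. \<bar>s (y (Suc i)) - s (y i)\<bar>)"
      unfolding lvar_def zs_def by (auto intro!: sum.cong simp del: upt_Suc)
    moreover have "(\<Sum>i<n. \<bar>f (Suc i) - f i\<bar> - 2 * \<delta>) \<le> (\<Sum>i<n. \<bar>s (y (Suc i)) - s (y i)\<bar>)"
    proof (rule sum_mono)
      fix i assume "i \<in> {..<n}"
      then have i: "i < n" by simp
      then have "(mx i \<longrightarrow> K i < s (y i)) \<and> (\<not> mx i \<longrightarrow> s (y i) < K i)"
          "(mx (Suc i) \<longrightarrow> K (Suc i) < s (y (Suc i))) \<and> (\<not> mx (Suc i) \<longrightarrow> s (y (Suc i)) < K (Suc i))"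
        using cdy[of i] cdy[of "Suc i"] by simp_all
      then show "\<bar>f (Suc i) - f i\<bar> - 2 * \<delta> \<le> \<bar>s (y (Suc i)) - s (y i)\<bar>"
        using sep[OF i] \<delta>(1) unfolding K_def by auto
    qed
    moreover have "(\<Sum>i<n. \<bar>f (Suc i) - f i\<bar> - 2 * \<delta>) = lvar \<sigma> ys - 2 * \<delta> * n"
      unfolding lv by (simp add: sum_subtractf)
    ultimately show False using e(2) \<delta>(3) by linarith
  qed
  then have "bv_on D \<sigma> V" by (rule bv_on_of_lvar)
  then show ?thesis using that D bound by blast
qed

lemma integrable_\<sigma>: "integrable lborel (\<lambda>x. \<sigma> x * indicator {a<..<b} x)"
  and integral_\<sigma>_le: "(LINT x|lborel. \<sigma> x * indicator {a<..<b} x) \<le> M * (b - a)"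
proof -
  have M0: "0 \<le> M" using s[of 0] by linarith
  have eq: "(\<integral>\<^sup>+x. ennreal (\<sigma> x * indicator {a<..<b} x) \<partial>lborel) = emeasure (dens a b \<sigma>) UNIV"
    by (subst emeasure_dens) (auto intro!: nn_integral_cong simp: indicator_def)
  also have "\<dots> = emeasure (dens a b s) UNIV"
    unfolding push_\<sigma>[symmetric] by (simp add: emeasure_distr)
  also have "\<dots> \<le> (\<integral>\<^sup>+x. ennreal M * indicator {a<..<b} x \<partial>lborel)"
    by (simp add: emeasure_dens) (intro nn_integral_mono mult_right_mono ennreal_leI s, simp)
  also have "\<dots> = ennreal (M * (b - a))" using ab M0 by (simp add: nn_integral_cmult ennreal_mult)
  finally have le: "(\<integral>\<^sup>+x. ennreal (\<sigma> x * indicator {a<..<b} x) \<partial>lborel) \<le> ennreal (M * (b - a))" .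
  show 1: "integrable lborel (\<lambda>x. \<sigma> x * indicator {a<..<b} x)"
    by (rule integrableI_nonneg) (use le in \<open>auto simp: \<sigma>_nonneg intro: le_less_trans\<close>)
  show "(LINT x|lborel. \<sigma> x * indicator {a<..<b} x) \<le> M * (b - a)"
    using le ab M0 by (subst (asm) nn_integral_eq_integral[OF 1]) (auto simp: \<sigma>_nonneg ennreal_le_iff)
qed

definition cost_real where "cost_real = (LINT x|lborel. \<sigma> x * (x - T x)\<^sup>2 * indicator {a<..<b} x)"

lemma cost_real_nonneg: "0 \<le> cost_real"
  unfolding cost_real_def by (rule integral_nonneg_AE) (auto simp: \<sigma>_nonneg)

lemma energy_dissipation_real:
  "cost_real / (2 * \<tau>) + (LINT x|lborel. (chi (\<sigma> x) - chi 0) * indicator {a<..<b} x)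
    \<le> (LINT x|lborel. (chi (s x) - chi 0) * indicator {a<..<b} x)"
proof -
  let ?E = "LINT x|lborel. (chi (\<sigma> x) - chi 0) * indicator {a<..<b} x"
  have [measurable]: "(\<lambda>x. chi (s x)) \<in> borel_measurable borel"
    by (rule borel_measurable_energy[OF chi]) (auto simp: s)
  have nns: "0 \<le> (chi (s x) - chi 0) * indicator {a<..<b} x" for x
    using energy_ge_zero_value[OF chi s(1)] by simp
  have eq: "(\<integral>\<^sup>+ x. ennreal (chi (s x) - chi 0) * indicator {a<..<b} x \<partial>lborel) = (\<integral>\<^sup>+ x. ennreal ((chi (s x) - chi 0) * indicator {a<..<b} x) \<partial>lborel)"
    by (rule nn_integral_cong) (auto simp: indicator_def)
  have 1: "integrable lborel (\<lambda>x. (chi (s x) - chi 0) * indicator {a<..<b} x)"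
    by (rule integrableI_nonneg) (use chi_s_finite nns in \<open>auto simp: eq\<close>)
  have E0: "0 \<le> ?E"
    by (rule integral_nonneg_AE) (use energy_ge_zero_value[OF chi \<sigma>_nonneg] in auto)
  have "ennreal (cost_real / (2 * \<tau>) + ?E) = cost * ennreal (1 / (2 * \<tau>)) + ener"
    unfolding cost_eq ener_eq cost_real_def[symmetric] using cost_real_nonneg E0 tau
    by (subst ennreal_mult[symmetric]) (auto simp flip: ennreal_plus)
  also have "\<dots> \<le> ennreal (LINT x|lborel. (chi (s x) - chi 0) * indicator {a<..<b} x)"
    using energy_dissipation unfolding eq nn_integral_eq_integral[OF 1 AE_I2[OF nns]] .
  finally show ?thesis
    by (subst (asm) ennreal_le_iff) (auto intro!: integral_nonneg_AE nns)
qed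

lemma transport_test_bound:
  assumes [measurable]: "\<theta> \<in> borel_measurable borel" "\<phi> \<in> borel_measurable borel"
    and \<theta>: "\<And>x. 0 \<le> \<theta> x" "\<And>x. \<theta> x \<le> 1" and \<phi>: "\<And>x. \<bar>\<phi> x\<bar> \<le> 1" "\<And>x y. \<bar>\<phi> x - \<phi> y\<bar> \<le> L * \<bar>x - y\<bar>"
    and l: "0 < l"
  shows "\<bar>(LINT x|lborel. \<phi> x * (\<theta> (T x) * \<sigma> x) * indicator {a<..<b} x) - (LINT x|lborel. \<phi> x * (\<theta> x * s x) * indicator {a<..<b} x)\<bar>
    \<le> L * (l * (M * (b - a)) + cost_real / l)"
proof -
  let ?I = "{a<..<b}"
  have L0: "0 \<le> L" using \<phi>(2)[of 0 1] by (simp add: abs_le_iff)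
  have bd: "\<bar>\<phi> x * \<theta> y\<bar> \<le> 1" for x y using \<phi>(1)[of x] \<theta>[of y] by (simp add: abs_mult mult_le_one)
  have int: "integrable lborel (\<lambda>x. \<phi> (g x) * (\<theta> (T x) * \<sigma> x) * indicator ?I x)" if [measurable]: "g \<in> borel_measurable borel" for g
  proof (rule Bochner_Integration.integrable_bound[OF integrable_\<sigma>])
    show "AE x in lborel. norm (\<phi> (g x) * (\<theta> (T x) * \<sigma> x) * indicator ?I x) \<le> norm (\<sigma> x * indicator ?I x)"
    proof (rule AE_I2)
      fix x
      have "\<bar>\<phi> (g x) * \<theta> (T x)\<bar> * \<bar>\<sigma> x * indicator ?I x\<bar> \<le> 1 * \<bar>\<sigma> x * indicator ?I x\<bar>"
        by (rule mult_right_mono[OF bd]) simp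
      then show "norm (\<phi> (g x) * (\<theta> (T x) * \<sigma> x) * indicator ?I x) \<le> norm (\<sigma> x * indicator ?I x)"
        by (simp add: abs_mult mult.assoc)
    qed
  qed simp
  have "(LINT x|lborel. \<phi> x * (\<theta> x * s x) * indicator ?I x) = (LINT x|dens a b s. \<phi> x * \<theta> x)"
    by (subst integral_dens) (auto simp: s mult_ac)
  also have "\<dots> = (LINT x|dens a b \<sigma>. \<phi> (T x) * \<theta> (T x))"
    unfolding push_\<sigma>[symmetric] by (rule integral_distr) auto
  also have "\<dots> = (LINT x|lborel. \<phi> (T x) * (\<theta> (T x) * \<sigma> x) * indicator ?I x)"
    by (subst integral_dens) (auto simp: \<sigma>_nonneg mult_ac)
  finally have eq: "(LINT x|lborel. \<phi> x * (\<theta> (T x) * \<sigma> x) * indicator ?I x) - (LINT x|lborel. \<phi> x * (\<theta> x * s x) * indicator ?I x)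
     = (LINT x|lborel. \<phi> x * (\<theta> (T x) * \<sigma> x) * indicator ?I x - \<phi> (T x) * (\<theta> (T x) * \<sigma> x) * indicator ?I x)"
    using int[of "\<lambda>x. x"] int[of T] by simp
  have "\<bar>LINT x|lborel. \<phi> x * (\<theta> (T x) * \<sigma> x) * indicator ?I x - \<phi> (T x) * (\<theta> (T x) * \<sigma> x) * indicator ?I x\<bar>
    \<le> (LINT x|lborel. L * (l * (\<sigma> x * indicator ?I x) + (\<sigma> x * (x - T x)\<^sup>2 * indicator ?I x) / l))"
  proof (rule order_trans[OF integral_abs_bound], rule integral_mono)
    fix x
    have amgm: "\<bar>x - T x\<bar> \<le> l + (x - T x)\<^sup>2 / l"
    proof -
      have "0 \<le> (\<bar>x - T x\<bar> - l)\<^sup>2" by simp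
      then have "\<bar>x - T x\<bar> * (2 * l) \<le> l\<^sup>2 + (x - T x)\<^sup>2" by (simp add: power2_diff algebra_simps)
      moreover have "0 \<le> \<bar>x - T x\<bar> * l" using l by simp
      ultimately have "\<bar>x - T x\<bar> * l \<le> l\<^sup>2 + (x - T x)\<^sup>2" by linarith
      then show ?thesis using l by (simp add: field_simps power2_eq_square)
    qed
    have "\<bar>\<phi> x - \<phi> (T x)\<bar> * \<theta> (T x) \<le> (L * (l + (x - T x)\<^sup>2 / l)) * 1"
    proof (rule mult_mono)
      show "\<bar>\<phi> x - \<phi> (T x)\<bar> \<le> L * (l + (x - T x)\<^sup>2 / l)"
        using \<phi>(2)[of x "T x"] mult_left_mono[OF amgm L0] by linarith
    qed (use \<theta> L0 l in auto)
    then have "(\<bar>\<phi> x - \<phi> (T x)\<bar> * \<theta> (T x)) * (\<sigma> x * indicator ?I x) \<le> (L * (l + (x - T x)\<^sup>2 / l)) * (\<sigma> x * indicator ?I x)"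
      using \<sigma>_nonneg by (intro mult_right_mono) auto
    moreover have "\<bar>\<phi> x * (\<theta> (T x) * \<sigma> x) * indicator ?I x - \<phi> (T x) * (\<theta> (T x) * \<sigma> x) * indicator ?I x\<bar>
      = (\<bar>\<phi> x - \<phi> (T x)\<bar> * \<theta> (T x)) * (\<sigma> x * indicator ?I x)"
      using \<sigma>_nonneg[of x] \<theta>(1)[of "T x"] by (simp add: abs_mult flip: left_diff_distrib)
    ultimately show "\<bar>\<phi> x * (\<theta> (T x) * \<sigma> x) * indicator ?I x - \<phi> (T x) * (\<theta> (T x) * \<sigma> x) * indicator ?I x\<bar>
      \<le> L * (l * (\<sigma> x * indicator ?I x) + (\<sigma> x * (x - T x)\<^sup>2 * indicator ?I x) / l)"
      by (simp add: algebra_simps)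
  next
    show "integrable lborel (\<lambda>x. \<bar>\<phi> x * (\<theta> (T x) * \<sigma> x) * indicator ?I x - \<phi> (T x) * (\<theta> (T x) * \<sigma> x) * indicator ?I x\<bar>)"
      using int[of "\<lambda>x. x"] int[of T] by auto
    show "integrable lborel (\<lambda>x. L * (l * (\<sigma> x * indicator ?I x) + (\<sigma> x * (x - T x)\<^sup>2 * indicator ?I x) / l))"
      by (intro integrable_mult_right integrable_divide Bochner_Integration.integrable_add integrable_\<sigma> integrable_cost)
  qed
  also have "\<dots> = L * (LINT x|lborel. l * (\<sigma> x * indicator ?I x) + (\<sigma> x * (x - T x)\<^sup>2 * indicator ?I x) / l)"
    by (rule integral_mult_right_zero)
  also have "(LINT x|lborel. l * (\<sigma> x * indicator ?I x) + (\<sigma> x * (x - T x)\<^sup>2 * indicator ?I x) / l)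
    = (LINT x|lborel. l * (\<sigma> x * indicator ?I x)) + (LINT x|lborel. (\<sigma> x * (x - T x)\<^sup>2 * indicator ?I x) / l)"
    by (rule Bochner_Integration.integral_add) (intro integrable_mult_right integrable_divide integrable_\<sigma> integrable_cost)+
  also have "\<dots> = l * (LINT x|lborel. \<sigma> x * indicator ?I x) + cost_real / l"
    unfolding cost_real_def integral_mult_right_zero integral_divide_zero ..
  also have "L * (l * (LINT x|lborel. \<sigma> x * indicator ?I x) + cost_real / l) \<le> L * (l * (M * (b - a)) + cost_real / l)"
    using L0 l integral_\<sigma>_le by (intro mult_left_mono add_right_mono) auto
  finally show ?thesis unfolding eq .
qed

end

section \<open>The reaction step\<close>

definition box_lip :: "real \<Rightarrow> (real \<Rightarrow> real \<Rightarrow> real) \<Rightarrow> bool" where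
  "box_lip M f \<longleftrightarrow> (\<exists>K C. 0 \<le> K \<and> 0 \<le> C \<and> (\<forall>s1\<in>{0..M}. \<forall>r1\<in>{0..1}. \<forall>s2\<in>{0..M}. \<forall>r2\<in>{0..1}.
     \<bar>f s1 r1\<bar> \<le> K \<and> \<bar>f s1 r1 - f s2 r2\<bar> \<le> C * (\<bar>s1 - s2\<bar> + \<bar>r1 - r2\<bar>)))"

lemma box_lip_const: "box_lip M (\<lambda>s r. c)"
  unfolding box_lip_def by (rule exI[of _ "\<bar>c\<bar>"], rule exI[of _ 0]) auto

lemma box_lip_fst: "0 \<le> M \<Longrightarrow> box_lip M (\<lambda>s r. s)"
  unfolding box_lip_def by (rule exI[of _ M], rule exI[of _ 1]) auto

lemma box_lip_snd: "box_lip M (\<lambda>s r. r)"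
  unfolding box_lip_def by (rule exI[of _ 1], rule exI[of _ 1]) auto

lemma box_lip_add:
  assumes "box_lip M f" "box_lip M g"
  shows "box_lip M (\<lambda>s r. f s r + g s r)"
proof -
  obtain K C where 1: "0 \<le> K" "0 \<le> C" "\<forall>s1\<in>{0..M}. \<forall>r1\<in>{0..1}. \<forall>s2\<in>{0..M}. \<forall>r2\<in>{0..1}.
     \<bar>f s1 r1\<bar> \<le> K \<and> \<bar>f s1 r1 - f s2 r2\<bar> \<le> C * (\<bar>s1 - s2\<bar> + \<bar>r1 - r2\<bar>)" using assms(1) unfolding box_lip_def by metis
  obtain K' C' where 2: "0 \<le> K'" "0 \<le> C'" "\<forall>s1\<in>{0..M}. \<forall>r1\<in>{0..1}. \<forall>s2\<in>{0..M}. \<forall>r2\<in>{0..1}.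
     \<bar>g s1 r1\<bar> \<le> K' \<and> \<bar>g s1 r1 - g s2 r2\<bar> \<le> C' * (\<bar>s1 - s2\<bar> + \<bar>r1 - r2\<bar>)" using assms(2) unfolding box_lip_def by metis
  show ?thesis unfolding box_lip_def
  proof (rule exI[of _ "K + K'"], rule exI[of _ "C + C'"], intro conjI ballI)
    fix s1 r1 s2 r2 assume "s1 \<in> {0..M}" "r1 \<in> {0..1::real}" "s2 \<in> {0..M}" "r2 \<in> {0..1::real}"
    then have "\<bar>f s1 r1\<bar> \<le> K \<and> \<bar>f s1 r1 - f s2 r2\<bar> \<le> C * (\<bar>s1 - s2\<bar> + \<bar>r1 - r2\<bar>)"
      "\<bar>g s1 r1\<bar> \<le> K' \<and> \<bar>g s1 r1 - g s2 r2\<bar> \<le> C' * (\<bar>s1 - s2\<bar> + \<bar>r1 - r2\<bar>)" using 1 2 by blast+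
    then show "\<bar>f s1 r1 + g s1 r1\<bar> \<le> K + K'"
      "\<bar>f s1 r1 + g s1 r1 - (f s2 r2 + g s2 r2)\<bar> \<le> (C + C') * (\<bar>s1 - s2\<bar> + \<bar>r1 - r2\<bar>)"
      unfolding distrib_right[of C] by linarith+
  qed (use 1 2 in auto)
qed

lemma box_lip_mult:
  assumes "box_lip M f" "box_lip M g"
  shows "box_lip M (\<lambda>s r. f s r * g s r)"
proof -
  obtain K C where 1: "0 \<le> K" "0 \<le> C" "\<forall>s1\<in>{0..M}. \<forall>r1\<in>{0..1}. \<forall>s2\<in>{0..M}. \<forall>r2\<in>{0..1}.
     \<bar>f s1 r1\<bar> \<le> K \<and> \<bar>f s1 r1 - f s2 r2\<bar> \<le> C * (\<bar>s1 - s2\<bar> + \<bar>r1 - r2\<bar>)" using assms(1) unfolding box_lip_def by metis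
  obtain K' C' where 2: "0 \<le> K'" "0 \<le> C'" "\<forall>s1\<in>{0..M}. \<forall>r1\<in>{0..1}. \<forall>s2\<in>{0..M}. \<forall>r2\<in>{0..1}.
     \<bar>g s1 r1\<bar> \<le> K' \<and> \<bar>g s1 r1 - g s2 r2\<bar> \<le> C' * (\<bar>s1 - s2\<bar> + \<bar>r1 - r2\<bar>)" using assms(2) unfolding box_lip_def by metis
  show ?thesis unfolding box_lip_def
  proof (rule exI[of _ "K * K'"], rule exI[of _ "K * C' + C * K'"], intro conjI ballI)
    fix s1 r1 s2 r2 assume m: "s1 \<in> {0..M}" "r1 \<in> {0..1::real}" "s2 \<in> {0..M}" "r2 \<in> {0..1::real}"
    let ?d = "\<bar>s1 - s2\<bar> + \<bar>r1 - r2\<bar>"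
    have fg: "\<bar>f s1 r1\<bar> \<le> K" "\<bar>f s1 r1 - f s2 r2\<bar> \<le> C * ?d" "\<bar>g s1 r1\<bar> \<le> K'" "\<bar>g s2 r2\<bar> \<le> K'" "\<bar>g s1 r1 - g s2 r2\<bar> \<le> C' * ?d"
      using 1(3) 2(3) m by blast+
    show "\<bar>f s1 r1 * g s1 r1\<bar> \<le> K * K'" unfolding abs_mult using fg 1 by (intro mult_mono) auto
    have "f s1 r1 * g s1 r1 - f s2 r2 * g s2 r2 = f s1 r1 * (g s1 r1 - g s2 r2) + (f s1 r1 - f s2 r2) * g s2 r2"
      by (simp add: algebra_simps)
    also have "\<bar>\<dots>\<bar> \<le> \<bar>f s1 r1\<bar> * \<bar>g s1 r1 - g s2 r2\<bar> + \<bar>f s1 r1 - f s2 r2\<bar> * \<bar>g s2 r2\<bar>"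
      unfolding abs_mult[symmetric] by (rule abs_triangle_ineq)
    also have "\<dots> \<le> K * (C' * ?d) + (C * ?d) * K'"
      using fg 1(1,2) by (intro add_mono mult_mono) auto
    also have "\<dots> = (K * C' + C * K') * ?d" by (simp add: algebra_simps)
    finally show "\<bar>f s1 r1 * g s1 r1 - f s2 r2 * g s2 r2\<bar> \<le> (K * C' + C * K') * ?d" .
  qed (use 1 2 in auto)
qed

lemma box_lip_diff: "box_lip M f \<Longrightarrow> box_lip M g \<Longrightarrow> box_lip M (\<lambda>s r. f s r - g s r)"
  using box_lip_add[OF _ box_lip_mult[OF box_lip_const[of M "-1"]], of f g] by simp

lemma box_lip_tld:
  assumes "bdd_lip F" "0 \<le> M"
  shows "box_lip M (tld F)"
proof -
  obtain K where K: "\<forall>x\<ge>0. \<forall>y\<ge>0. \<bar>F x y\<bar> \<le> K" using assms(1) unfolding bdd_lip_def by blast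
  obtain L where L: "\<forall>x1 y1 x2 y2. x1 \<ge> 0 \<and> y1 \<ge> 0 \<and> x2 \<ge> 0 \<and> y2 \<ge> 0 \<longrightarrow>
          \<bar>F x1 y1 - F x2 y2\<bar> \<le> L * (\<bar>x1 - x2\<bar> + \<bar>y1 - y2\<bar>)" using assms(1) unfolding bdd_lip_def by blast
  have K0: "0 \<le> K" using K[rule_format, of 0 0] by simp
  have prod: "box_lip M (\<lambda>s r. r * s)" "box_lip M (\<lambda>s r. (1 - r) * s)"
    by (intro box_lip_mult box_lip_diff box_lip_const box_lip_snd box_lip_fst assms(2))+
  obtain C1 where C1: "0 \<le> C1" "\<forall>s1\<in>{0..M}. \<forall>r1\<in>{0..1}. \<forall>s2\<in>{0..M}. \<forall>r2\<in>{0..1}.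
     \<bar>r1 * s1 - r2 * s2\<bar> \<le> C1 * (\<bar>s1 - s2\<bar> + \<bar>r1 - r2\<bar>)" using prod(1) unfolding box_lip_def by metis
  obtain C2 where C2: "0 \<le> C2" "\<forall>s1\<in>{0..M}. \<forall>r1\<in>{0..1}. \<forall>s2\<in>{0..M}. \<forall>r2\<in>{0..1}.
     \<bar>(1 - r1) * s1 - (1 - r2) * s2\<bar> \<le> C2 * (\<bar>s1 - s2\<bar> + \<bar>r1 - r2\<bar>)" using prod(2) unfolding box_lip_def by metis
  show ?thesis unfolding box_lip_def
  proof (rule exI[of _ K], rule exI[of _ "\<bar>L\<bar> * (C1 + C2)"], intro conjI ballI)
    fix s1 r1 s2 r2 assume m: "s1 \<in> {0..M}" "r1 \<in> {0..1::real}" "s2 \<in> {0..M}" "r2 \<in> {0..1::real}"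
    let ?d = "\<bar>s1 - s2\<bar> + \<bar>r1 - r2\<bar>"
    have pos: "0 \<le> r1 * s1" "0 \<le> (1 - r1) * s1" "0 \<le> r2 * s2" "0 \<le> (1 - r2) * s2" using m by auto
    show "\<bar>tld F s1 r1\<bar> \<le> K" unfolding tld_def using K pos by blast
    have "\<bar>tld F s1 r1 - tld F s2 r2\<bar> \<le> L * (\<bar>r1 * s1 - r2 * s2\<bar> + \<bar>(1 - r1) * s1 - (1 - r2) * s2\<bar>)"
      unfolding tld_def using L pos by blast
    also have "\<dots> \<le> \<bar>L\<bar> * (\<bar>r1 * s1 - r2 * s2\<bar> + \<bar>(1 - r1) * s1 - (1 - r2) * s2\<bar>)"
      by (intro mult_right_mono) auto
    also have "\<dots> \<le> \<bar>L\<bar> * (C1 * ?d + C2 * ?d)"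
      using C1(2) C2(2) m by (intro mult_left_mono add_mono) auto
    finally show "\<bar>tld F s1 r1 - tld F s2 r2\<bar> \<le> \<bar>L\<bar> * (C1 + C2) * ?d" by (simp add: algebra_simps)
  qed (use K0 C1 C2 in auto)
qed

lemma nonincreasing_of_deriv_within:
  fixes f f' :: "real \<Rightarrow> real"
  assumes "\<And>t. t \<in> {0..\<tau>} \<Longrightarrow> (f has_real_derivative f' t) (at t within {0..\<tau>})" "\<And>t. t \<in> {0..\<tau>} \<Longrightarrow> f' t \<le> 0"
    and "t \<in> {0..\<tau>}"
  shows "f t \<le> f 0"
proof (cases "t = 0")
  case False
  have "continuous_on {0..\<tau>} f"
    using assms(1) by (meson DERIV_continuous continuous_on_eq_continuous_within)
  then have "continuous_on {0..t} f" by (rule continuous_on_subset) (use assms(3) in auto)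
  moreover have "\<exists>y. (f has_real_derivative y) (at x) \<and> y \<le> 0" if "0 < x" "x < t" for x
    using assms(1)[of x] assms(2)[of x] assms(3) that by (auto simp: at_within_Icc_at intro!: exI[of _ "f' x"])
  ultimately show ?thesis using DERIV_nonpos_imp_decreasing_open[of 0 t f] assms(3) by simp
qed simp

lemma increment_bound_within:
  fixes f f' :: "real \<Rightarrow> real"
  assumes "\<And>t. t \<in> {0..\<tau>} \<Longrightarrow> (f has_real_derivative f' t) (at t within {0..\<tau>})" "\<And>t. t \<in> {0..\<tau>} \<Longrightarrow> \<bar>f' t\<bar> \<le> C"
    and "0 \<le> \<tau>"
  shows "\<bar>f \<tau> - f 0\<bar> \<le> C * \<tau>"
proof -
  have "norm (f \<tau> - f 0) \<le> C * norm (\<tau> - 0)"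
    by (rule field_differentiable_bound[of "{0..\<tau>}" f f' C]) (use assms in auto)
  then show ?thesis using assms(3) by simp
qed

lemma SigmaR_growth:
  assumes "bdd_lip F1" "bdd_lip F2" "bdd_lip G1" "bdd_lip G2"
  obtains B where "0 \<le> B" "\<And>s r. 0 \<le> s \<Longrightarrow> 0 \<le> r \<Longrightarrow> r \<le> 1 \<Longrightarrow> \<bar>SigmaR F1 F2 G1 G2 s r\<bar> \<le> B * s"
proof -
  have ex: "\<exists>B. \<forall>x\<ge>0. \<forall>y\<ge>0. \<bar>F x y\<bar> \<le> B" if "bdd_lip F" for F using that unfolding bdd_lip_def by blast
  obtain B1 where B1: "\<forall>x\<ge>0. \<forall>y\<ge>0. \<bar>F1 x y\<bar> \<le> B1" using ex[OF assms(1)] by blast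
  obtain B2 where B2: "\<forall>x\<ge>0. \<forall>y\<ge>0. \<bar>F2 x y\<bar> \<le> B2" using ex[OF assms(2)] by blast
  obtain B3 where B3: "\<forall>x\<ge>0. \<forall>y\<ge>0. \<bar>G1 x y\<bar> \<le> B3" using ex[OF assms(3)] by blast
  obtain B4 where B4: "\<forall>x\<ge>0. \<forall>y\<ge>0. \<bar>G2 x y\<bar> \<le> B4" using ex[OF assms(4)] by blast
  note B = B1 B2 B3 B4
  define B where "B = B1 + B2 + B3 + B4"
  have B0: "0 \<le> B1" "0 \<le> B2" "0 \<le> B3" "0 \<le> B4" using B[rule_format, of 0 0] by auto
  have "\<bar>SigmaR F1 F2 G1 G2 s r\<bar> \<le> B * s" if sr: "0 \<le> s" "0 \<le> r" "r \<le> 1" for s r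
  proof -
    have pos: "0 \<le> r * s" "0 \<le> (1 - r) * s" using sr by auto
    have t: "\<bar>tld F1 s r\<bar> \<le> B1" "\<bar>tld F2 s r\<bar> \<le> B2" "\<bar>tld G1 s r\<bar> \<le> B3" "\<bar>tld G2 s r\<bar> \<le> B4"
      unfolding tld_def using B pos by auto
    have "\<bar>r * (tld F1 s r + tld G2 s r) + (1 - r) * (tld G1 s r + tld F2 s r)\<bar>
       \<le> \<bar>r * (tld F1 s r + tld G2 s r)\<bar> + \<bar>(1 - r) * (tld G1 s r + tld F2 s r)\<bar>" by (rule abs_triangle_ineq)
    also have "\<dots> \<le> 1 * (B1 + B4) + 1 * (B3 + B2)"
      unfolding abs_mult using sr t by (intro add_mono mult_mono) auto
    finally have "\<bar>r * (tld F1 s r + tld G2 s r) + (1 - r) * (tld G1 s r + tld F2 s r)\<bar> \<le> B" unfolding B_def by simp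
    then show ?thesis unfolding SigmaR_def abs_mult using sr
      by (metis abs_of_nonneg mult.commute mult_left_mono)
  qed
  moreover have "0 \<le> B" unfolding B_def using B0 by simp
  ultimately show ?thesis using that by blast
qed

lemma reaction_sol_growth:
  assumes B: "\<And>s r. 0 \<le> s \<Longrightarrow> 0 \<le> r \<Longrightarrow> r \<le> 1 \<Longrightarrow> \<bar>S s r\<bar> \<le> B * s"
    and sol: "\<forall>t\<in>{0..\<tau>}. s t \<ge> 0 \<and> 0 \<le> r t \<and> r t \<le> 1 \<and>
           (s has_real_derivative S (s t) (r t)) (at t within {0..\<tau>})"
    and t: "t \<in> {0..\<tau>}"
  shows "s t \<le> exp (B * t) * s 0" "exp (- B * t) * s 0 \<le> s t"
proof -
  have S: "\<bar>S (s t) (r t)\<bar> \<le> B * s t" if "t \<in> {0..\<tau>}" for t using B sol that by blast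
  have "s t * exp (- B * t) \<le> s 0 * exp (- B * 0)"
  proof (rule nonincreasing_of_deriv_within[OF _ _ t, of "\<lambda>t. s t * exp (- B * t)" "\<lambda>t. (S (s t) (r t) - B * s t) * exp (- B * t)"])
    fix t assume t: "t \<in> {0..\<tau>}"
    have "(s has_real_derivative S (s t) (r t)) (at t within {0..\<tau>})" using sol t by blast
    then show "((\<lambda>t. s t * exp (- B * t)) has_real_derivative (S (s t) (r t) - B * s t) * exp (- B * t)) (at t within {0..\<tau>})"
      by (auto intro!: derivative_eq_intros simp: algebra_simps)
    show "(S (s t) (r t) - B * s t) * exp (- B * t) \<le> 0" using S[OF t] by (intro mult_nonpos_nonneg) auto
  qed
  then show "s t \<le> exp (B * t) * s 0" by (simp add: exp_minus field_simps)
  have "- (s t * exp (B * t)) \<le> - (s 0 * exp (B * 0))"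
  proof (rule nonincreasing_of_deriv_within[OF _ _ t, of "\<lambda>t. - (s t * exp (B * t))" "\<lambda>t. - ((S (s t) (r t) + B * s t) * exp (B * t))"])
    fix t assume t: "t \<in> {0..\<tau>}"
    have "(s has_real_derivative S (s t) (r t)) (at t within {0..\<tau>})" using sol t by blast
    then show "((\<lambda>t. - (s t * exp (B * t))) has_real_derivative - ((S (s t) (r t) + B * s t) * exp (B * t))) (at t within {0..\<tau>})"
      by (auto intro!: derivative_eq_intros simp: algebra_simps)
    show "- ((S (s t) (r t) + B * s t) * exp (B * t)) \<le> 0" using S[OF t] by auto
  qed
  then show "exp (- B * t) * s 0 \<le> s t" by (simp add: exp_minus field_simps)
qed

lemma abs_add_square_le: "(\<bar>x\<bar> + \<bar>y\<bar>)\<^sup>2 \<le> 2 * (x\<^sup>2 + y\<^sup>2)" for x y :: real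
  using zero_le_power2[of "\<bar>x\<bar> - \<bar>y\<bar>"] by (simp add: power2_eq_square algebra_simps abs_mult_self_eq)

lemma flow_stability:
  fixes s r s' r' :: "real \<Rightarrow> real"
  assumes C: "0 \<le> C" "\<And>s1 r1 s2 r2. s1 \<in> {0..M} \<Longrightarrow> r1 \<in> {0..1} \<Longrightarrow> s2 \<in> {0..M} \<Longrightarrow> r2 \<in> {0..1} \<Longrightarrow>
      \<bar>S s1 r1 - S s2 r2\<bar> \<le> C * (\<bar>s1 - s2\<bar> + \<bar>r1 - r2\<bar>) \<and> \<bar>R s1 r1 - R s2 r2\<bar> \<le> C * (\<bar>s1 - s2\<bar> + \<bar>r1 - r2\<bar>)"
    and \<tau>: "0 < \<tau>" "\<tau> \<le> 1"
    and sol: "\<And>t. t \<in> {0..\<tau>} \<Longrightarrow> s t \<in> {0..M} \<and> r t \<in> {0..1} \<and>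
        (s has_real_derivative S (s t) (r t)) (at t within {0..\<tau>}) \<and> (r has_real_derivative R (s t) (r t)) (at t within {0..\<tau>})"
    and sol': "\<And>t. t \<in> {0..\<tau>} \<Longrightarrow> s' t \<in> {0..M} \<and> r' t \<in> {0..1} \<and>
        (s' has_real_derivative S (s' t) (r' t)) (at t within {0..\<tau>}) \<and> (r' has_real_derivative R (s' t) (r' t)) (at t within {0..\<tau>})"
  shows "\<bar>(s \<tau> - s' \<tau>) - (s 0 - s' 0)\<bar> \<le> 2 * C * exp (2 * C) * \<tau> * (\<bar>s 0 - s' 0\<bar> + \<bar>r 0 - r' 0\<bar>)"
    and "\<bar>(r \<tau> - r' \<tau>) - (r 0 - r' 0)\<bar> \<le> 2 * C * exp (2 * C) * \<tau> * (\<bar>s 0 - s' 0\<bar> + \<bar>r 0 - r' 0\<bar>)"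
proof -
  define x y where "x t = s t - s' t" and "y t = r t - r' t" for t
  define x' y' where "x' t = S (s t) (r t) - S (s' t) (r' t)" and "y' t = R (s t) (r t) - R (s' t) (r' t)" for t
  have dx: "(x has_real_derivative x' t) (at t within {0..\<tau>})" and dy: "(y has_real_derivative y' t) (at t within {0..\<tau>})"
    if "t \<in> {0..\<tau>}" for t
    unfolding x_def y_def x'_def y'_def using sol[OF that] sol'[OF that] by (auto intro!: DERIV_diff)
  have bx: "\<bar>x' t\<bar> \<le> C * (\<bar>x t\<bar> + \<bar>y t\<bar>)" and byy: "\<bar>y' t\<bar> \<le> C * (\<bar>x t\<bar> + \<bar>y t\<bar>)" if "t \<in> {0..\<tau>}" for t
    unfolding x_def y_def x'_def y'_def using C(2) sol[OF that] sol'[OF that] by blast+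
  define E where "E t = (x t)\<^sup>2 + (y t)\<^sup>2" for t
  define d0 where "d0 = \<bar>x 0\<bar> + \<bar>y 0\<bar>"
  have d: "\<bar>x t\<bar> + \<bar>y t\<bar> \<le> 2 * exp (2 * C) * d0" if t: "t \<in> {0..\<tau>}" for t
  proof -
    have "E t * exp (- 4 * C * t) \<le> E 0 * exp (- 4 * C * 0)"
    proof (rule nonincreasing_of_deriv_within[OF _ _ t, of "\<lambda>t. E t * exp (- 4 * C * t)"
          "\<lambda>t. (2 * x t * x' t + 2 * y t * y' t - 4 * C * E t) * exp (- 4 * C * t)"])
      fix t assume t: "t \<in> {0..\<tau>}"
      show "((\<lambda>t. E t * exp (- 4 * C * t)) has_real_derivative (2 * x t * x' t + 2 * y t * y' t - 4 * C * E t) * exp (- 4 * C * t)) (at t within {0..\<tau>})"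
        unfolding E_def using dx[OF t] dy[OF t] by (auto intro!: derivative_eq_intros simp: algebra_simps)
      have "x t * x' t + y t * y' t \<le> \<bar>x t\<bar> * \<bar>x' t\<bar> + \<bar>y t\<bar> * \<bar>y' t\<bar>"
        unfolding abs_mult[symmetric] by linarith
      also have "\<dots> \<le> \<bar>x t\<bar> * (C * (\<bar>x t\<bar> + \<bar>y t\<bar>)) + \<bar>y t\<bar> * (C * (\<bar>x t\<bar> + \<bar>y t\<bar>))"
        using bx[OF t] byy[OF t] by (intro add_mono mult_left_mono) auto
      also have "\<dots> = C * (\<bar>x t\<bar> + \<bar>y t\<bar>)\<^sup>2" by (simp add: power2_eq_square algebra_simps)
      also have "\<dots> \<le> C * (2 * E t)" unfolding E_def by (intro mult_left_mono abs_add_square_le C)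
      finally have "2 * x t * x' t + 2 * y t * y' t \<le> 4 * C * E t" by simp
      then show "(2 * x t * x' t + 2 * y t * y' t - 4 * C * E t) * exp (- 4 * C * t) \<le> 0"
        by (intro mult_nonpos_nonneg) auto
    qed
    then have "E t \<le> E 0 * exp (4 * C * t)" by (simp add: exp_minus field_simps)
    also have "\<dots> \<le> E 0 * exp (4 * C)"
      using C(1) \<tau> t by (intro mult_left_mono) (auto simp: E_def mult_left_le)
    also have "E 0 \<le> d0\<^sup>2" unfolding E_def d0_def by (simp add: power2_eq_square algebra_simps abs_mult_self_eq)
    finally have Et: "E t \<le> d0\<^sup>2 * exp (4 * C)" by simp
    have "(\<bar>x t\<bar> + \<bar>y t\<bar>)\<^sup>2 \<le> 2 * E t" unfolding E_def by (rule abs_add_square_le)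
    also have "\<dots> \<le> 2 * (d0\<^sup>2 * exp (4 * C))" using Et by simp
    also have "\<dots> \<le> (2 * exp (2 * C) * d0)\<^sup>2"
      by (simp add: power_mult_distrib flip: exp_double)
    finally show ?thesis by (rule power2_le_imp_le) (simp add: d0_def)
  qed
  have "\<bar>x' t\<bar> \<le> C * (2 * exp (2 * C) * d0)" "\<bar>y' t\<bar> \<le> C * (2 * exp (2 * C) * d0)" if "t \<in> {0..\<tau>}" for t
    using bx[OF that] byy[OF that] mult_left_mono[OF d[OF that] C(1)] by linarith+
  then have "\<bar>x \<tau> - x 0\<bar> \<le> C * (2 * exp (2 * C) * d0) * \<tau>" "\<bar>y \<tau> - y 0\<bar> \<le> C * (2 * exp (2 * C) * d0) * \<tau>"
    using \<tau> by (intro increment_bound_within[OF dx] increment_bound_within[OF dy]; simp)+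
  then show "\<bar>(s \<tau> - s' \<tau>) - (s 0 - s' 0)\<bar> \<le> 2 * C * exp (2 * C) * \<tau> * (\<bar>s 0 - s' 0\<bar> + \<bar>r 0 - r' 0\<bar>)"
    "\<bar>(r \<tau> - r' \<tau>) - (r 0 - r' 0)\<bar> \<le> 2 * C * exp (2 * C) * \<tau> * (\<bar>s 0 - s' 0\<bar> + \<bar>r 0 - r' 0\<bar>)"
    unfolding x_def y_def d0_def by (simp_all add: mult_ac)
qed

lemma reaction_sol_bounds:
  assumes B: "\<And>s r. 0 \<le> s \<Longrightarrow> 0 \<le> r \<Longrightarrow> r \<le> 1 \<Longrightarrow> \<bar>S s r\<bar> \<le> B * s"
    and sol: "reaction_sol S R \<tau> s0 r0 s1 r1" and "0 \<le> \<tau>"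
  shows "0 \<le> s0" "0 \<le> s1" "0 \<le> r0" "r0 \<le> 1" "0 \<le> r1" "r1 \<le> 1"
    "s1 \<le> exp (B * \<tau>) * s0" "exp (- B * \<tau>) * s0 \<le> s1"
proof -
  obtain s r where sr: "s 0 = s0" "r 0 = r0" "s \<tau> = s1" "r \<tau> = r1"
    and sol: "\<forall>t\<in>{0..\<tau>}. s t \<ge> 0 \<and> 0 \<le> r t \<and> r t \<le> 1 \<and>
           (s has_real_derivative S (s t) (r t)) (at t within {0..\<tau>}) \<and>
           (r has_real_derivative R (s t) (r t)) (at t within {0..\<tau>})"
    using sol unfolding reaction_sol_def by blast
  have "0 \<in> {0..\<tau>}" "\<tau> \<in> {0..\<tau>}" using assms(3) by auto
  then show "0 \<le> s0" "0 \<le> s1" "0 \<le> r0" "r0 \<le> 1" "0 \<le> r1" "r1 \<le> 1"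
    using sol sr by blast+
  have sol': "\<forall>t\<in>{0..\<tau>}. s t \<ge> 0 \<and> 0 \<le> r t \<and> r t \<le> 1 \<and>
           (s has_real_derivative S (s t) (r t)) (at t within {0..\<tau>})" using sol by blast
  show "s1 \<le> exp (B * \<tau>) * s0" "exp (- B * \<tau>) * s0 \<le> s1"
    using reaction_sol_growth[OF B sol' \<open>\<tau> \<in> {0..\<tau>}\<close>] sr by auto
qed

lemma reaction_estimates:
  assumes F: "bdd_lip F1" "bdd_lip F2" "bdd_lip G1" "bdd_lip G2" and M: "0 \<le> M" and B0: "0 \<le> B"
    and B: "\<And>s r. 0 \<le> s \<Longrightarrow> 0 \<le> r \<Longrightarrow> r \<le> 1 \<Longrightarrow> \<bar>SigmaR F1 F2 G1 G2 s r\<bar> \<le> B * s"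
  obtains \<kappa> where "0 \<le> \<kappa>"
    "\<And>\<tau> s0 r0 s1 r1. 0 < \<tau> \<Longrightarrow> \<tau> \<le> 1 \<Longrightarrow> s0 \<le> M \<Longrightarrow>
       reaction_sol (SigmaR F1 F2 G1 G2) (RR F1 F2 G1 G2) \<tau> s0 r0 s1 r1 \<Longrightarrow>
       \<bar>s1 - s0\<bar> \<le> \<kappa> * \<tau> * s0 \<and> \<bar>r1 - r0\<bar> \<le> \<kappa> * \<tau>"
    "\<And>\<tau> s0 r0 s1 r1 s0' r0' s1' r1'. 0 < \<tau> \<Longrightarrow> \<tau> \<le> 1 \<Longrightarrow> s0 \<le> M \<Longrightarrow> s0' \<le> M \<Longrightarrow>
       reaction_sol (SigmaR F1 F2 G1 G2) (RR F1 F2 G1 G2) \<tau> s0 r0 s1 r1 \<Longrightarrow>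
       reaction_sol (SigmaR F1 F2 G1 G2) (RR F1 F2 G1 G2) \<tau> s0' r0' s1' r1' \<Longrightarrow>
       \<bar>s1 - s1'\<bar> \<le> \<bar>s0 - s0'\<bar> + \<kappa> * \<tau> * (\<bar>s0 - s0'\<bar> + \<bar>r0 - r0'\<bar>) \<and>
       \<bar>r1 - r1'\<bar> \<le> \<bar>r0 - r0'\<bar> + \<kappa> * \<tau> * (\<bar>s0 - s0'\<bar> + \<bar>r0 - r0'\<bar>)"
proof -
  let ?S = "SigmaR F1 F2 G1 G2" and ?R = "RR F1 F2 G1 G2"
  define M' where "M' = exp B * M"
  have M': "0 \<le> M'" unfolding M'_def using M by simp
  have "box_lip M' (\<lambda>s r. s * (r * (tld F1 s r + tld G2 s r) + (1 - r) * (tld G1 s r + tld F2 s r)))"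
    by (intro box_lip_mult box_lip_add box_lip_diff box_lip_const box_lip_fst box_lip_snd box_lip_tld F M')
  then have S: "box_lip M' ?S" unfolding SigmaR_def .
  have "box_lip M' (\<lambda>s r. r * (1 - r) * (tld F1 s r - tld F2 s r) + (1 - r) * (1 - r) * tld G1 s r - r * r * tld G2 s r)"
    by (intro box_lip_mult box_lip_add box_lip_diff box_lip_const box_lip_fst box_lip_snd box_lip_tld F M')
  then have R: "box_lip M' ?R" unfolding RR_def power2_eq_square .
  obtain C1 where C1: "0 \<le> C1" "\<forall>s1\<in>{0..M'}. \<forall>r1\<in>{0..1}. \<forall>s2\<in>{0..M'}. \<forall>r2\<in>{0..1}.
     \<bar>?S s1 r1 - ?S s2 r2\<bar> \<le> C1 * (\<bar>s1 - s2\<bar> + \<bar>r1 - r2\<bar>)" using S unfolding box_lip_def by blast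
  obtain K C2 where C2: "0 \<le> K" "0 \<le> C2" "\<forall>s1\<in>{0..M'}. \<forall>r1\<in>{0..1}. \<forall>s2\<in>{0..M'}. \<forall>r2\<in>{0..1}.
     \<bar>?R s1 r1\<bar> \<le> K \<and> \<bar>?R s1 r1 - ?R s2 r2\<bar> \<le> C2 * (\<bar>s1 - s2\<bar> + \<bar>r1 - r2\<bar>)" using R unfolding box_lip_def by blast
  define C where "C = C1 + C2"
  have C0: "0 \<le> C" unfolding C_def using C1 C2 by simp
  have C: "\<bar>?S s1 r1 - ?S s2 r2\<bar> \<le> C * (\<bar>s1 - s2\<bar> + \<bar>r1 - r2\<bar>) \<and> \<bar>?R s1 r1 - ?R s2 r2\<bar> \<le> C * (\<bar>s1 - s2\<bar> + \<bar>r1 - r2\<bar>)"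
    if m: "s1 \<in> {0..M'}" "r1 \<in> {0..1}" "s2 \<in> {0..M'}" "r2 \<in> {0..1}" for s1 r1 s2 r2
  proof -
    let ?d = "\<bar>s1 - s2\<bar> + \<bar>r1 - r2\<bar>"
    have "\<bar>?S s1 r1 - ?S s2 r2\<bar> \<le> C1 * ?d" "\<bar>?R s1 r1 - ?R s2 r2\<bar> \<le> C2 * ?d" using C1(2) C2(3) m by blast+
    moreover have "0 \<le> C1 * ?d" "0 \<le> C2 * ?d" using C1(1) C2(2) by simp_all
    ultimately show ?thesis unfolding C_def distrib_right[of C1 C2] by linarith
  qed
  have sol: "\<exists>s r. s 0 = s0 \<and> r 0 = r0 \<and> s \<tau> = s1 \<and> r \<tau> = r1 \<and> (\<forall>t\<in>{0..\<tau>}. s t \<in> {0..M'} \<and> s t \<le> exp B * s0 \<and> r t \<in> {0..1} \<and>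
        (s has_real_derivative ?S (s t) (r t)) (at t within {0..\<tau>}) \<and> (r has_real_derivative ?R (s t) (r t)) (at t within {0..\<tau>}))"
    if \<tau>: "0 < \<tau>" "\<tau> \<le> 1" and s0: "s0 \<le> M" and sol: "reaction_sol ?S ?R \<tau> s0 r0 s1 r1" for \<tau> s0 r0 s1 r1
  proof -
    obtain s r where sr: "s 0 = s0" "r 0 = r0" "s \<tau> = s1" "r \<tau> = r1"
      and sol: "\<forall>t\<in>{0..\<tau>}. s t \<ge> 0 \<and> 0 \<le> r t \<and> r t \<le> 1 \<and>
           (s has_real_derivative ?S (s t) (r t)) (at t within {0..\<tau>}) \<and>
           (r has_real_derivative ?R (s t) (r t)) (at t within {0..\<tau>})"
      using sol unfolding reaction_sol_def by blast
    have sol': "\<forall>t\<in>{0..\<tau>}. s t \<ge> 0 \<and> 0 \<le> r t \<and> r t \<le> 1 \<and>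
           (s has_real_derivative ?S (s t) (r t)) (at t within {0..\<tau>})" using sol by blast
    have s00: "0 \<le> s0" using sol[rule_format, of 0] sr \<tau> by auto
    have le: "s t \<le> exp B * s0" if t: "t \<in> {0..\<tau>}" for t
    proof -
      have "B * t \<le> B" using B0 t \<tau> by (simp add: mult_left_le)
      then have "exp (B * t) * s0 \<le> exp B * s0" using s00 by (intro mult_right_mono) auto
      then show ?thesis using reaction_sol_growth(1)[OF B sol' t] sr by simp
    qed
    have "exp B * s0 \<le> M'" unfolding M'_def using s0 by simp
    then have "\<forall>t\<in>{0..\<tau>}. s t \<in> {0..M'} \<and> s t \<le> exp B * s0 \<and> r t \<in> {0..1} \<and>
        (s has_real_derivative ?S (s t) (r t)) (at t within {0..\<tau>}) \<and> (r has_real_derivative ?R (s t) (r t)) (at t within {0..\<tau>})"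
      using sol le by (meson atLeastAtMost_iff order_trans)
    then show ?thesis using sr by blast
  qed
  define \<kappa> where "\<kappa> = B * exp B + K + 2 * C * exp (2 * C)"
  have k: "B * exp B \<le> \<kappa>" "K \<le> \<kappa>" "2 * C * exp (2 * C) \<le> \<kappa>" "0 \<le> \<kappa>"
    unfolding \<kappa>_def using B0 C0 C2(1) by auto
  show ?thesis
  proof (rule that[OF k(4)])
    fix \<tau> s0 r0 s1 r1 assume \<tau>: "0 < \<tau>" "\<tau> \<le> 1" and s0: "s0 \<le> M" and rs: "reaction_sol ?S ?R \<tau> s0 r0 s1 r1"
    obtain s r where sr: "s 0 = s0" "r 0 = r0" "s \<tau> = s1" "r \<tau> = r1" and pr: "\<And>t. t \<in> {0..\<tau>} \<Longrightarrow> s t \<in> {0..M'} \<and> s t \<le> exp B * s0 \<and> r t \<in> {0..1} \<and>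
        (s has_real_derivative ?S (s t) (r t)) (at t within {0..\<tau>}) \<and> (r has_real_derivative ?R (s t) (r t)) (at t within {0..\<tau>})"
      using sol[OF \<tau> s0 rs] by blast
    have s00: "0 \<le> s0" using pr[of 0] sr \<tau> by auto
    have "\<bar>s \<tau> - s 0\<bar> \<le> (B * (exp B * s0)) * \<tau>"
    proof (rule increment_bound_within)
      fix t assume t: "t \<in> {0..\<tau>}"
      show "(s has_real_derivative ?S (s t) (r t)) (at t within {0..\<tau>})" using pr[OF t] by blast
      have "\<bar>?S (s t) (r t)\<bar> \<le> B * s t" using pr[OF t] by (intro B) auto
      also have "\<dots> \<le> B * (exp B * s0)" using pr[OF t] B0 by (intro mult_left_mono) auto
      finally show "\<bar>?S (s t) (r t)\<bar> \<le> B * (exp B * s0)" .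
    qed (use \<tau> in simp)
    also have "\<dots> = (B * exp B) * (\<tau> * s0)" by simp
    also have "\<dots> \<le> \<kappa> * (\<tau> * s0)" using k(1) \<tau> s00 by (intro mult_right_mono) auto
    finally have 1: "\<bar>s1 - s0\<bar> \<le> \<kappa> * \<tau> * s0" using sr by (simp add: mult.assoc)
    have "\<bar>r \<tau> - r 0\<bar> \<le> K * \<tau>"
    proof (rule increment_bound_within)
      fix t assume t: "t \<in> {0..\<tau>}"
      show "(r has_real_derivative ?R (s t) (r t)) (at t within {0..\<tau>})" using pr[OF t] by blast
      show "\<bar>?R (s t) (r t)\<bar> \<le> K" using pr[OF t] C2(3) by blast
    qed (use \<tau> in simp)
    also have "\<dots> \<le> \<kappa> * \<tau>" using k(2) \<tau> by (intro mult_right_mono) auto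
    finally have 2: "\<bar>r1 - r0\<bar> \<le> \<kappa> * \<tau>" using sr by simp
    show "\<bar>s1 - s0\<bar> \<le> \<kappa> * \<tau> * s0 \<and> \<bar>r1 - r0\<bar> \<le> \<kappa> * \<tau>" using 1 2 by blast
  next
    fix \<tau> s0 r0 s1 r1 s0' r0' s1' r1' assume \<tau>: "0 < \<tau>" "\<tau> \<le> 1" and s0: "s0 \<le> M" "s0' \<le> M"
      and rs: "reaction_sol ?S ?R \<tau> s0 r0 s1 r1" "reaction_sol ?S ?R \<tau> s0' r0' s1' r1'"
    obtain s r where sr: "s 0 = s0" "r 0 = r0" "s \<tau> = s1" "r \<tau> = r1" and pr: "\<And>t. t \<in> {0..\<tau>} \<Longrightarrow> s t \<in> {0..M'} \<and> r t \<in> {0..1} \<and>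
        (s has_real_derivative ?S (s t) (r t)) (at t within {0..\<tau>}) \<and> (r has_real_derivative ?R (s t) (r t)) (at t within {0..\<tau>})"
      using sol[OF \<tau> s0(1) rs(1)] by blast
    obtain s' r' where sr': "s' 0 = s0'" "r' 0 = r0'" "s' \<tau> = s1'" "r' \<tau> = r1'" and pr': "\<And>t. t \<in> {0..\<tau>} \<Longrightarrow> s' t \<in> {0..M'} \<and> r' t \<in> {0..1} \<and>
        (s' has_real_derivative ?S (s' t) (r' t)) (at t within {0..\<tau>}) \<and> (r' has_real_derivative ?R (s' t) (r' t)) (at t within {0..\<tau>})"
      using sol[OF \<tau> s0(2) rs(2)] by blast
    let ?d = "\<bar>s0 - s0'\<bar> + \<bar>r0 - r0'\<bar>"
    have "2 * C * exp (2 * C) * \<tau> * ?d \<le> \<kappa> * \<tau> * ?d" using k(3) \<tau> by (intro mult_right_mono) auto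
    then show "\<bar>s1 - s1'\<bar> \<le> \<bar>s0 - s0'\<bar> + \<kappa> * \<tau> * ?d \<and> \<bar>r1 - r1'\<bar> \<le> \<bar>r0 - r0'\<bar> + \<kappa> * \<tau> * ?d"
      using flow_stability[OF C0 C \<tau> pr pr', unfolded sr sr'] by linarith
  qed
qed

section \<open>One step of the scheme\<close>

text \<open>The share of the first (c true) or second species at ratio r.\<close>
definition wt :: "bool \<Rightarrow> real \<Rightarrow> real" where "wt c r = (if c then r else 1 - r)"

definition good_state :: "real \<Rightarrow> real \<Rightarrow> real \<Rightarrow> real \<Rightarrow> real \<Rightarrow> (real \<Rightarrow> real) \<Rightarrow> (real \<Rightarrow> real) \<Rightarrow> real set \<Rightarrow> bool" where
  "good_state a b M V W sg r D \<longleftrightarrow> D \<in> sets borel \<and> D \<subseteq> {a<..<b} \<and> (AE x in lborel. x \<in> {a<..<b} \<longrightarrow> x \<in> D) \<and>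
     (\<forall>x\<in>D. 0 \<le> sg x \<and> sg x \<le> M \<and> 0 \<le> r x \<and> r x \<le> 1) \<and> bv_on D sg V \<and> bv_on {x\<in>D. 0 < sg x} r W"

lemma bv_on_mono_bound: "bv_on D f V \<Longrightarrow> V \<le> V' \<Longrightarrow> bv_on D f V'"
  unfolding bv_on_def by (meson order_trans)

lemma good_state_mono: "good_state a b M V W sg r D \<Longrightarrow> M \<le> M' \<Longrightarrow> V \<le> V' \<Longrightarrow> W \<le> W' \<Longrightarrow> good_state a b M' V' W' sg r D"
  unfolding good_state_def by (auto intro: bv_on_mono_bound order_trans)

lemma good_state_measurable:
  assumes "good_state a b M V W sg r D"
  shows "(\<lambda>x. indicator D x * sg x) \<in> borel_measurable borel"
    and "{x\<in>D. 0 < sg x} \<in> sets borel"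
    and "(\<lambda>x. indicator {x\<in>D. 0 < sg x} x * r x) \<in> borel_measurable borel"
    and "(\<lambda>x. wt c (r x) * sg x * indicator D x) \<in> borel_measurable borel"
proof -
  have D [measurable]: "D \<in> sets borel" and bv: "bv_on D sg V" "bv_on {x\<in>D. 0 < sg x} r W"
    and nn: "\<And>x. x \<in> D \<Longrightarrow> 0 \<le> sg x"
    using assms unfolding good_state_def by auto
  show 1 [measurable]: "(\<lambda>x. indicator D x * sg x) \<in> borel_measurable borel" by (rule bv_on_borel_measurable[OF bv(1) D])
  have "{x \<in> space borel. 0 < indicator D x * sg x} \<in> sets borel" by measurable
  moreover have "{x \<in> space borel. 0 < indicator D x * sg x} = {x\<in>D. 0 < sg x}" by (auto split: split_indicator_asm)
  ultimately show P [measurable]: "{x\<in>D. 0 < sg x} \<in> sets borel" by (simp only:)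
  show 3 [measurable]: "(\<lambda>x. indicator {x\<in>D. 0 < sg x} x * r x) \<in> borel_measurable borel" by (rule bv_on_borel_measurable[OF bv(2) P])
  have "(\<lambda>x. wt c (indicator {x\<in>D. 0 < sg x} x * r x) * (indicator D x * sg x)) \<in> borel_measurable borel"
    unfolding wt_def by (cases c) simp_all
  moreover have "(\<lambda>x. wt c (indicator {x\<in>D. 0 < sg x} x * r x) * (indicator D x * sg x)) = (\<lambda>x. wt c (r x) * sg x * indicator D x)"
    using nn by (fastforce simp: indicator_def fun_eq_iff)
  ultimately show "(\<lambda>x. wt c (r x) * sg x * indicator D x) \<in> borel_measurable borel" by simp
qed

lemma reaction_step_good:
  assumes good: "good_state a b M V W sg r D" and M: "M \<le> Mx" and \<tau>: "0 < \<tau>" "\<tau> \<le> 1" and \<kappa>: "0 \<le> \<kappa>"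
    and sol: "\<And>x. x \<in> D \<Longrightarrow> reaction_sol S R \<tau> (sg x) (r x) (sgh x) (rh x)"
    and B: "\<And>s r. 0 \<le> s \<Longrightarrow> 0 \<le> r \<Longrightarrow> r \<le> 1 \<Longrightarrow> \<bar>S s r\<bar> \<le> B * s"
    and e1: "\<And>s0 r0 s1 r1. s0 \<le> Mx \<Longrightarrow> reaction_sol S R \<tau> s0 r0 s1 r1 \<Longrightarrow>
       \<bar>s1 - s0\<bar> \<le> \<kappa> * \<tau> * s0 \<and> \<bar>r1 - r0\<bar> \<le> \<kappa> * \<tau>"
    and e2: "\<And>s0 r0 s1 r1 s0' r0' s1' r1'. s0 \<le> Mx \<Longrightarrow> s0' \<le> Mx \<Longrightarrow>
       reaction_sol S R \<tau> s0 r0 s1 r1 \<Longrightarrow> reaction_sol S R \<tau> s0' r0' s1' r1' \<Longrightarrow>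
       \<bar>s1 - s1'\<bar> \<le> \<bar>s0 - s0'\<bar> + \<kappa> * \<tau> * (\<bar>s0 - s0'\<bar> + \<bar>r0 - r0'\<bar>) \<and>
       \<bar>r1 - r1'\<bar> \<le> \<bar>r0 - r0'\<bar> + \<kappa> * \<tau> * (\<bar>s0 - s0'\<bar> + \<bar>r0 - r0'\<bar>)"
  shows "good_state a b (exp (B * \<tau>) * M) ((1 + \<kappa> * \<tau>) * V + \<kappa> * \<tau> * W) ((1 + \<kappa> * \<tau>) * W + \<kappa> * \<tau> * V) sgh rh D"
proof -
  have D: "D \<in> sets borel" "D \<subseteq> {a<..<b}" "AE x in lborel. x \<in> {a<..<b} \<longrightarrow> x \<in> D"
    and bd: "\<And>x. x \<in> D \<Longrightarrow> 0 \<le> sg x \<and> sg x \<le> M \<and> 0 \<le> r x \<and> r x \<le> 1"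
    and bv: "bv_on D sg V" "bv_on {x\<in>D. 0 < sg x} r W"
    using good unfolding good_state_def by auto
  note rb = reaction_sol_bounds[OF B sol less_imp_le[OF \<tau>(1)]]
  have k: "0 \<le> \<kappa> * \<tau>" using \<kappa> \<tau> by simp
  have pos: "0 < sgh x \<longleftrightarrow> 0 < sg x" if "x \<in> D" for x
  proof
    assume "0 < sgh x"
    then have "0 < exp (B * \<tau>) * sg x" using rb(7)[OF _ _ _ that] by linarith
    then show "0 < sg x" by (simp add: zero_less_mult_iff)
  next
    assume "0 < sg x"
    then have "0 < exp (- B * \<tau>) * sg x" by simp
    then show "0 < sgh x" using rb(8)[OF _ _ _ that] by linarith
  qed
  have est: "\<bar>sgh x - sgh y\<bar> \<le> \<bar>sg x - sg y\<bar> + \<kappa> * \<tau> * (\<bar>sg x - sg y\<bar> + \<bar>r x - r y\<bar>) \<and>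
       \<bar>rh x - rh y\<bar> \<le> \<bar>r x - r y\<bar> + \<kappa> * \<tau> * (\<bar>sg x - sg y\<bar> + \<bar>r x - r y\<bar>)" if "x \<in> D" "y \<in> D" for x y
    by (rule e2) (use bd[OF that(1)] bd[OF that(2)] M sol that in auto)
  have zero: "\<bar>sgh x - sgh y\<bar> \<le> (1 + \<kappa> * \<tau>) * \<bar>sg x - sg y\<bar>" if "x \<in> D" "y \<in> D" "sg y = 0" for x y
  proof -
    have "sgh y = 0" using pos[OF that(2)] that(3) rb(2)[OF _ _ _ that(2)] by auto
    moreover have "\<bar>sgh x - sg x\<bar> \<le> \<kappa> * \<tau> * sg x" using e1[OF _ sol[OF that(1)]] bd[OF that(1)] M by auto
    moreover have "0 \<le> sgh x" "0 \<le> sg x" using rb(2)[OF _ _ _ that(1)] bd[OF that(1)] by auto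
    ultimately show ?thesis using that(3) by (simp add: algebra_simps)
  qed
  have bvs: "bv_on D sgh ((1 + \<kappa> * \<tau>) * V + \<kappa> * \<tau> * W)"
  proof (rule bv_on_combine[OF bv])
    fix x y assume xy: "x \<in> D" "y \<in> D" "x \<le> y"
    show "x \<in> D \<and> y \<in> D \<and> \<bar>sgh y - sgh x\<bar> \<le> (1 + \<kappa> * \<tau>) * \<bar>sg y - sg x\<bar> +
       (if x \<in> {x \<in> D. 0 < sg x} \<and> y \<in> {x \<in> D. 0 < sg x} then \<kappa> * \<tau> * \<bar>r y - r x\<bar> else 0)"
    proof (cases "0 < sg x \<and> 0 < sg y")
      case True
      then show ?thesis using xy est[of y x] by (simp add: algebra_simps)
    next
      case False
      then consider "sg x = 0" | "sg y = 0" using bd[OF xy(1)] bd[OF xy(2)] by force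
      then have "\<bar>sgh y - sgh x\<bar> \<le> (1 + \<kappa> * \<tau>) * \<bar>sg y - sg x\<bar>"
        by cases (use zero[OF xy(2,1)] zero[OF xy(1,2)] in \<open>auto simp: abs_minus_commute\<close>)
      then show ?thesis using xy False by auto
    qed
  qed (use k in auto)
  have sets: "{x\<in>D. 0 < sgh x} = {x\<in>D. 0 < sg x}" using pos by auto
  have bvr: "bv_on {x\<in>D. 0 < sgh x} rh ((1 + \<kappa> * \<tau>) * W + \<kappa> * \<tau> * V)" unfolding sets
  proof (rule bv_on_combine[OF bv(2,1)])
    fix x y assume xy: "x \<in> {x\<in>D. 0 < sg x}" "y \<in> {x\<in>D. 0 < sg x}" "x \<le> y"
    then show "x \<in> {x\<in>D. 0 < sg x} \<and> y \<in> {x\<in>D. 0 < sg x} \<and> \<bar>rh y - rh x\<bar> \<le> (1 + \<kappa> * \<tau>) * \<bar>r y - r x\<bar> +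
       (if x \<in> D \<and> y \<in> D then \<kappa> * \<tau> * \<bar>sg y - sg x\<bar> else 0)"
      using est[of y x] by (simp add: algebra_simps)
  qed (use k in auto)
  have "0 \<le> sgh x \<and> sgh x \<le> exp (B * \<tau>) * M \<and> 0 \<le> rh x \<and> rh x \<le> 1" if "x \<in> D" for x
  proof -
    have "exp (B * \<tau>) * sg x \<le> exp (B * \<tau>) * M" using bd[OF that] by simp
    then show ?thesis using rb(2,5,6)[OF _ _ _ that] order_trans[OF rb(7)[OF _ _ _ that]] by blast
  qed
  then show ?thesis unfolding good_state_def using D bvs bvr by auto
qed

lemma diffusion_step_good:
  fixes \<tau> :: real
  assumes ab: "a < b" and \<tau>: "0 < \<tau>" and chi: "internal_energy chi" and M0: "0 \<le> M"
    and good: "good_state a b M V W sgh rh D" and rh: "\<And>x. x \<in> {a..b} \<Longrightarrow> 0 \<le> rh x \<and> rh x \<le> 1"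
    and m: "set_borel_measurable borel {a<..<b} \<rho>" "set_borel_measurable borel {a<..<b} \<eta>"
    and nn: "\<And>x. x \<in> {a..b} \<Longrightarrow> 0 \<le> \<rho> x \<and> 0 \<le> \<eta> x"
    and min: "\<And>\<mu> \<nu>. \<mu> \<in> Pm a b (emeasure (dens a b (\<lambda>x. rh x * sgh x)) UNIV) \<Longrightarrow>
      \<nu> \<in> Pm a b (emeasure (dens a b (\<lambda>x. (1 - rh x) * sgh x)) UNIV) \<Longrightarrow>
      JKO_functional chi a b \<tau> (dens a b (\<lambda>x. rh x * sgh x)) (dens a b (\<lambda>x. (1 - rh x) * sgh x)) (dens a b \<rho>) (dens a b \<eta>)
      \<le> JKO_functional chi a b \<tau> (dens a b (\<lambda>x. rh x * sgh x)) (dens a b (\<lambda>x. (1 - rh x) * sgh x)) \<mu> \<nu>"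
    and sg: "\<And>x. x \<in> {a..b} \<Longrightarrow> sg x = \<rho> x + \<eta> x"
    and Tm: "Tm \<in> borel_measurable borel" "mono_on {a..b} Tm" "Tm ` {a..b} \<subseteq> {a..b}"
      "distr (dens a b sg) borel Tm = dens a b sgh"
    and r: "\<And>x. x \<in> {a..b} \<Longrightarrow> r x = rh (Tm x)"
  obtains D' d where "good_state a b M V W sg r D'" "0 \<le> d"
    "d / (2 * \<tau>) + (LINT x|lborel. (chi (sg x) - chi 0) * indicator D' x) \<le> (LINT x|lborel. (chi (sgh x) - chi 0) * indicator D x)"
    "\<And>\<phi> L l c. \<phi> \<in> borel_measurable borel \<Longrightarrow> (\<And>x. \<bar>\<phi> x\<bar> \<le> 1) \<Longrightarrow> (\<And>x y. \<bar>\<phi> x - \<phi> y\<bar> \<le> L * \<bar>x - y\<bar>) \<Longrightarrow> 0 < l \<Longrightarrow>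
      \<bar>(LINT x|lborel. \<phi> x * (wt c (r x) * sg x * indicator D' x)) - (LINT x|lborel. \<phi> x * (wt c (rh x) * sgh x * indicator D x))\<bar>
       \<le> L * (l * (M * (b - a)) + d / l)"
proof -
  have D: "D \<in> sets borel" "D \<subseteq> {a<..<b}" "AE x in lborel. x \<in> {a<..<b} \<longrightarrow> x \<in> D"
    and bd: "\<And>x. x \<in> D \<Longrightarrow> 0 \<le> sgh x \<and> sgh x \<le> M \<and> 0 \<le> rh x \<and> rh x \<le> 1"
    and bv: "bv_on D sgh V" "bv_on {x\<in>D. 0 < sgh x} rh W"
    using good unfolding good_state_def by auto
  note [measurable] = D(1) Tm(1)
  define \<rho>' \<eta>' where "\<rho>' x = indicator {a<..<b} x * \<rho> x" and "\<eta>' x = indicator {a<..<b} x * \<eta> x" for x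
  define s q where "s x = indicator D x * sgh x" and "q x = indicator {x\<in>D. 0 < sgh x} x * rh x" for x
  define T where "T x = Tm (max a (min b x))" for x
  have clamp: "max a (min b x) \<in> {a..b}" for x using ab by auto
  have T_eq: "T x = Tm x" if "x \<in> {a..b}" for x using that unfolding T_def by (simp add: max_absorb2 min_absorb2)
  have [measurable]: "T \<in> borel_measurable borel" unfolding T_def[abs_def] by measurable
  have [measurable]: "s \<in> borel_measurable borel" "q \<in> borel_measurable borel"
    unfolding s_def[abs_def] q_def[abs_def] by (rule good_state_measurable[OF good])+
  have [measurable]: "\<rho>' \<in> borel_measurable borel" "\<eta>' \<in> borel_measurable borel"
    using m unfolding set_borel_measurable_def \<rho>'_def[abs_def] \<eta>'_def[abs_def] by simp_all
  have d\<rho>: "dens a b \<rho> = dens a b \<rho>'" and d\<eta>: "dens a b \<eta> = dens a b \<eta>'"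
    by (rule dens_cong_AE, simp add: \<rho>'_def \<eta>'_def)+
  have ds: "dens a b sgh = dens a b s" by (rule dens_cong_AE, use D(3) in eventually_elim) (auto simp: s_def)
  have qs: "rh x * sgh x = q x * s x" if "x \<in> D" for x using that bd[OF that] by (auto simp: s_def q_def indicator_def)
  have qs': "(1 - rh x) * sgh x = (1 - q x) * s x" if "x \<in> D" for x using that bd[OF that] by (auto simp: s_def q_def indicator_def)
  have dqs: "dens a b (\<lambda>x. rh x * sgh x) = dens a b (\<lambda>x. q x * s x)"
    by (rule dens_cong_AE, use D(3) in eventually_elim) (auto simp: qs)
  have dqs': "dens a b (\<lambda>x. (1 - rh x) * sgh x) = dens a b (\<lambda>x. (1 - q x) * s x)"
    by (rule dens_cong_AE, use D(3) in eventually_elim) (auto simp: qs')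
  have dsg: "dens a b sg = dens a b (\<lambda>x. \<rho>' x + \<eta>' x)"
    by (rule dens_cong_AE) (auto simp: \<rho>'_def \<eta>'_def sg)
  have push: "distr (dens a b (\<lambda>x. \<rho>' x + \<eta>' x)) borel T = dens a b s"
  proof -
    have "distr (dens a b (\<lambda>x. \<rho>' x + \<eta>' x)) borel T = distr (dens a b (\<lambda>x. \<rho>' x + \<eta>' x)) borel Tm"
    proof (rule distr_cong_AE)
      show "AE x in dens a b (\<lambda>x. \<rho>' x + \<eta>' x). T x = Tm x"
        by (subst AE_dens) (auto simp: T_eq)
    qed auto
    then show ?thesis using Tm(4) unfolding dsg ds by simp
  qed
  have Tmono: "mono T"
  proof (rule monoI)
    fix x y :: real assume "x \<le> y"
    then show "T x \<le> T y" unfolding T_def by (intro mono_onD[OF Tm(2) clamp clamp]) auto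
  qed
  interpret diffusion_step chi a b \<tau> M \<rho>' \<eta>' s q T
  proof
    show "a < b" "0 < \<tau>" "internal_energy chi" by fact+
    show "0 \<le> \<rho>' x" "0 \<le> \<eta>' x" for x using nn[of x] by (auto simp: \<rho>'_def \<eta>'_def indicator_def)
    show "0 \<le> s x" "s x \<le> M" for x using bd[of x] M0 by (auto simp: s_def indicator_def)
    show "0 \<le> q x" "q x \<le> 1" for x using bd[of x] by (auto simp: q_def indicator_def)
    show "mono T" by (rule Tmono)
    show "T x \<in> {a..b}" for x using Tm(3) clamp[of x] unfolding T_def by blast
    show "distr (dens a b (\<lambda>x. \<rho>' x + \<eta>' x)) borel T = dens a b s" by (rule push)
    show "JKO_functional chi a b \<tau> (dens a b (\<lambda>x. q x * s x)) (dens a b (\<lambda>x. (1 - q x) * s x)) (dens a b \<rho>') (dens a b \<eta>')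
      \<le> JKO_functional chi a b \<tau> (dens a b (\<lambda>x. q x * s x)) (dens a b (\<lambda>x. (1 - q x) * s x)) \<mu> \<nu>"
      if "\<mu> \<in> Pm a b (emeasure (dens a b (\<lambda>x. q x * s x)) UNIV)" "\<nu> \<in> Pm a b (emeasure (dens a b (\<lambda>x. (1 - q x) * s x)) UNIV)" for \<mu> \<nu>
      using min[of \<mu> \<nu>] that unfolding dqs dqs' d\<rho> d\<eta> by blast
  qed measurable
  have \<sigma>_eq: "\<sigma> x = sg x" if "x \<in> {a<..<b}" for x using that sg[of x] unfolding \<sigma>_def \<rho>'_def \<eta>'_def by simp
  have bvs: "bv_on D s V" by (rule bv_on_cong[OF bv(1)]) (simp add: s_def)
  obtain D1 where D1: "D1 \<in> sets borel" "D1 \<subseteq> {a<..<b}" "AE x in lborel. x \<in> {a<..<b} \<longrightarrow> x \<in> D1"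
    "bv_on D1 \<sigma> V" "\<And>x. x \<in> D1 \<Longrightarrow> \<sigma> x \<le> M" using diffusion_bv[OF D(3) bvs] by blast
  have "AE y in distr (dens a b \<sigma>) borel T. 0 < s y" unfolding push_\<sigma> by (subst AE_dens) auto
  then have "AE x in dens a b \<sigma>. 0 < s (T x)" by (rule AE_distrD[rotated]) simp
  then have "AE x in lborel. x \<in> {a<..<b} \<and> 0 < \<sigma> x \<longrightarrow> 0 < s (T x)" by (subst (asm) AE_dens) auto
  then have "AE x in lborel. x \<in> {a<..<b} \<longrightarrow> x \<in> D1 \<and> (0 < \<sigma> x \<longrightarrow> 0 < s (T x))"
    using D1(3) by eventually_elim auto
  then obtain D' where D': "D' \<in> sets borel" "D' \<subseteq> {a<..<b}" "\<And>x. x \<in> D' \<Longrightarrow> x \<in> D1 \<and> (0 < \<sigma> x \<longrightarrow> 0 < s (T x))"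
    "AE x in lborel. x \<in> {a<..<b} \<longrightarrow> x \<in> D'" by (rule AE_borel_subset) blast
  have TD: "T x \<in> {y\<in>D. 0 < sgh y}" if "x \<in> D'" "0 < sg x" for x
  proof -
    have "0 < s (T x)" using D'(2,3) that \<sigma>_eq[of x] by auto
    then show ?thesis by (auto simp: s_def split: split_indicator_asm)
  qed
  have D'I: "x \<in> {a<..<b}" if "x \<in> D'" for x using that D'(2) by blast
  have r_eq: "r x = rh (T x)" if "x \<in> D'" for x using D'I[OF that] r[of x] T_eq[of x] by simp
  have r01: "0 \<le> r x \<and> r x \<le> 1" if "x \<in> D'" for x using r_eq[OF that] rh[OF T(2)[of x]] by simp
  have good1: "bv_on D' sg V"
    by (rule bv_on_cong[OF bv_on_subset[OF D1(4)]]) (use D'(3) \<sigma>_eq D'I in auto)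
  have good2: "bv_on {x\<in>D'. 0 < sg x} r W"
    by (rule bv_on_cong[OF bv_on_comp_mono[OF bv(2) Tmono, of "{x\<in>D'. 0 < sg x}"]])
       (use TD r_eq in auto)
  have \<sigma>D: "\<sigma> x = sg x" if "x \<in> D'" for x using \<sigma>_eq[OF D'I[OF that]] .
  note [measurable] = D'(1)
  show ?thesis
  proof (rule that[of D' cost_real])
    have "0 \<le> sg x \<and> sg x \<le> M" if "x \<in> D'" for x
      using \<sigma>_nonneg[of x] D1(5)[of x] D'(3)[OF that] \<sigma>D[OF that] by simp
    then show "good_state a b M V W sg r D'"
      unfolding good_state_def using D'(1,2,4) good1 good2 r01 by blast
    show "0 \<le> cost_real" by (rule cost_real_nonneg)
    have [measurable]: "(\<lambda>x. chi (s x)) \<in> borel_measurable borel"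
      by (rule borel_measurable_energy[OF chi]) (auto simp: local.s)
    have "(LINT x|lborel. (chi (sg x) - chi 0) * indicator D' x) = (LINT x|lborel. (chi (\<sigma> x) - chi 0) * indicator D' x)"
      by (rule Bochner_Integration.integral_cong) (auto simp: \<sigma>D indicator_def)
    also have "\<dots> = (LINT x|lborel. (chi (\<sigma> x) - chi 0) * indicator {a<..<b} x)"
    proof (rule integral_cong_AE)
      show "AE x in lborel. (chi (\<sigma> x) - chi 0) * indicator D' x = (chi (\<sigma> x) - chi 0) * indicator {a<..<b} x"
        using D'(4) by eventually_elim (use D'(2) in \<open>auto split: split_indicator\<close>)
    qed measurable
    finally have 1: "(LINT x|lborel. (chi (sg x) - chi 0) * indicator D' x) = (LINT x|lborel. (chi (\<sigma> x) - chi 0) * indicator {a<..<b} x)" .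
    have "(LINT x|lborel. (chi (sgh x) - chi 0) * indicator D x) = (LINT x|lborel. (chi (s x) - chi 0) * indicator D x)"
      by (rule Bochner_Integration.integral_cong) (auto simp: s_def indicator_def)
    also have "\<dots> = (LINT x|lborel. (chi (s x) - chi 0) * indicator {a<..<b} x)"
    proof (rule integral_cong_AE)
      show "AE x in lborel. (chi (s x) - chi 0) * indicator D x = (chi (s x) - chi 0) * indicator {a<..<b} x"
        using D(3) by eventually_elim (use D(2) in \<open>auto split: split_indicator\<close>)
    qed measurable
    finally show "cost_real / (2 * \<tau>) + (LINT x|lborel. (chi (sg x) - chi 0) * indicator D' x) \<le> (LINT x|lborel. (chi (sgh x) - chi 0) * indicator D x)"
      using energy_dissipation_real unfolding 1 by simp
    fix \<phi> :: "real \<Rightarrow> real" and L l :: real and c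
    assume \<phi> [measurable]: "\<phi> \<in> borel_measurable borel" and \<phi>1: "\<And>x. \<bar>\<phi> x\<bar> \<le> 1" "\<And>x y. \<bar>\<phi> x - \<phi> y\<bar> \<le> L * \<bar>x - y\<bar>" and l: "0 < l"
    define \<theta> where "\<theta> x = wt c (q x)" for x
    have [measurable]: "\<theta> \<in> borel_measurable borel" unfolding \<theta>_def[abs_def] wt_def by (cases c) simp_all
    have \<theta>01: "0 \<le> \<theta> x" "\<theta> x \<le> 1" for x using local.q[of x] unfolding \<theta>_def wt_def by auto
    have [measurable]: "(\<lambda>x. wt c (r x) * sg x * indicator D' x) \<in> borel_measurable borel"
      by (rule good_state_measurable[OF \<open>good_state a b M V W sg r D'\<close>])
    have e1: "(LINT x|lborel. \<phi> x * (wt c (r x) * sg x * indicator D' x)) = (LINT x|lborel. \<phi> x * (\<theta> (T x) * \<sigma> x) * indicator {a<..<b} x)"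
    proof (rule integral_cong_AE)
      show "AE x in lborel. \<phi> x * (wt c (r x) * sg x * indicator D' x) = \<phi> x * (\<theta> (T x) * \<sigma> x) * indicator {a<..<b} x"
        using D'(4)
      proof eventually_elim
        case (elim x)
        show ?case
        proof (cases "x \<in> D'")
          case True
          have "wt c (r x) * sg x = \<theta> (T x) * sg x"
          proof (cases "0 < sg x")
            case True
            then show ?thesis using TD[OF \<open>x \<in> D'\<close>] r_eq[OF \<open>x \<in> D'\<close>] unfolding \<theta>_def q_def by simp
          next
            case False
            then show ?thesis using \<sigma>_nonneg[of x] \<sigma>D[OF \<open>x \<in> D'\<close>] by simp
          qed
          then show ?thesis using True \<sigma>D[OF True] D'I[OF True] by simp
        next
          case False
          then show ?thesis using elim by (auto simp: indicator_def)
        qed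
      qed
    qed simp_all
    have e2: "(LINT x|lborel. \<phi> x * (wt c (rh x) * sgh x * indicator D x)) = (LINT x|lborel. \<phi> x * (\<theta> x * s x) * indicator {a<..<b} x)"
    proof (rule Bochner_Integration.integral_cong[OF refl])
      fix x
      show "\<phi> x * (wt c (rh x) * sgh x * indicator D x) = \<phi> x * (\<theta> x * s x) * indicator {a<..<b} x"
        using D(2) bd[of x] by (cases "x \<in> D"; cases "0 < sgh x") (auto simp: \<theta>_def q_def s_def)
    qed
    show "\<bar>(LINT x|lborel. \<phi> x * (wt c (r x) * sg x * indicator D' x)) - (LINT x|lborel. \<phi> x * (wt c (rh x) * sgh x * indicator D x))\<bar>
       \<le> L * (l * (M * (b - a)) + cost_real / l)"
      unfolding e1 e2 by (rule transport_test_bound) (use \<theta>01 \<phi>1 l in auto)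
  qed
qed

section \<open>Uniform estimates for the scheme\<close>

lemma integrable_of_bounded_on_interval:
  fixes f :: "real \<Rightarrow> real"
  assumes "f \<in> borel_measurable borel" "\<And>x. \<bar>f x\<bar> \<le> K * indicator {a<..<b} x" "a \<le> b"
  shows "integrable lborel f" "\<bar>LINT x|lborel. f x\<bar> \<le> K * (b - a)"
proof -
  have i: "integrable lborel (\<lambda>x. K * indicator {a<..<b} x)"
    by (intro integrable_mult_right integrable_real_indicator) (use assms(3) in auto)
  show 1: "integrable lborel f"
    by (rule Bochner_Integration.integrable_bound[OF i]) (use assms in \<open>auto intro!: AE_I2 order_trans[OF _ abs_ge_self]\<close>)
  have "\<bar>LINT x|lborel. f x\<bar> \<le> (LINT x|lborel. \<bar>f x\<bar>)" by (rule integral_abs_bound)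
  also have "\<dots> \<le> (LINT x|lborel. K * indicator {a<..<b} x)"
    by (rule integral_mono[OF _ i]) (use 1 assms in auto)
  also have "\<dots> = K * (b - a)" using assms(3) by simp
  finally show "\<bar>LINT x|lborel. f x\<bar> \<le> K * (b - a)" .
qed

lemma good_state_energy:
  assumes "good_state a b M V W sg r D" "internal_energy chi" "a \<le> b" "0 \<le> M"
  shows "integrable lborel (\<lambda>x. (chi (sg x) - chi 0) * indicator D x)"
    "0 \<le> (LINT x|lborel. (chi (sg x) - chi 0) * indicator D x)"
    "(LINT x|lborel. (chi (sg x) - chi 0) * indicator D x) \<le> (chi M - chi 0) * (b - a)"
proof -
  have D [measurable]: "D \<in> sets borel" "D \<subseteq> {a<..<b}" and bd: "\<And>x. x \<in> D \<Longrightarrow> 0 \<le> sg x \<and> sg x \<le> M"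
    using assms(1) unfolding good_state_def by auto
  have [measurable]: "(\<lambda>x. chi (indicator D x * sg x)) \<in> borel_measurable borel"
    by (rule borel_measurable_energy[OF assms(2)])
       (use good_state_measurable[OF assms(1)] bd in \<open>auto simp: indicator_def\<close>)
  have eq: "(\<lambda>x. (chi (sg x) - chi 0) * indicator D x) = (\<lambda>x. (chi (indicator D x * sg x) - chi 0) * indicator D x)"
    by (auto simp: indicator_def)
  have m: "(\<lambda>x. (chi (sg x) - chi 0) * indicator D x) \<in> borel_measurable borel" unfolding eq by measurable
  have val: "0 \<le> chi (sg x) - chi 0" "chi (sg x) - chi 0 \<le> chi M - chi 0" if "x \<in> D" for x
    using energy_ge_zero_value[OF assms(2)] energy_diff_ge[OF assms(2), of 0 "sg x" M] bd[OF that] by (auto simp: energy_slope_def)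
  have le: "\<bar>(chi (sg x) - chi 0) * indicator D x\<bar> \<le> (chi M - chi 0) * indicator {a<..<b} x" for x
    using val[of x] D(2) energy_ge_zero_value[OF assms(2,4)] by (auto split: split_indicator)
  note * = integrable_of_bounded_on_interval[OF m le assms(3)]
  show "integrable lborel (\<lambda>x. (chi (sg x) - chi 0) * indicator D x)" by (rule *)
  show "0 \<le> (LINT x|lborel. (chi (sg x) - chi 0) * indicator D x)"
    by (rule integral_nonneg_AE) (use val in \<open>auto split: split_indicator\<close>)
  show "(LINT x|lborel. (chi (sg x) - chi 0) * indicator D x) \<le> (chi M - chi 0) * (b - a)"
    using *(2) by linarith
qed

lemma wt_bounds: "0 \<le> r \<Longrightarrow> r \<le> 1 \<Longrightarrow> 0 \<le> wt c r \<and> wt c r \<le> 1"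
  and wt_diff: "\<bar>wt c r - wt c r'\<bar> = \<bar>r - r'\<bar>"
  unfolding wt_def by auto

locale splitting_data =
  fixes chi :: "real \<Rightarrow> real" and F1 F2 G1 G2 :: "real \<Rightarrow> real \<Rightarrow> real" and a b T B \<kappa> M0 V0 W0 Mx :: real
    and \<sigma>0 r0 :: "real \<Rightarrow> real"
  assumes ab: "a < b" and T: "0 < T" and chi: "internal_energy chi"
    and B0: "0 \<le> B" and \<kappa>0: "0 \<le> \<kappa>" and M00: "0 \<le> M0"
    and B: "\<And>s r. 0 \<le> s \<Longrightarrow> 0 \<le> r \<Longrightarrow> r \<le> 1 \<Longrightarrow> \<bar>SigmaR F1 F2 G1 G2 s r\<bar> \<le> B * s"
    and Mx: "Mx = exp (B * T) * M0"
    and e1: "\<And>\<tau> s0 r0 s1 r1. 0 < \<tau> \<Longrightarrow> \<tau> \<le> 1 \<Longrightarrow> s0 \<le> Mx \<Longrightarrow>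
       reaction_sol (SigmaR F1 F2 G1 G2) (RR F1 F2 G1 G2) \<tau> s0 r0 s1 r1 \<Longrightarrow>
       \<bar>s1 - s0\<bar> \<le> \<kappa> * \<tau> * s0 \<and> \<bar>r1 - r0\<bar> \<le> \<kappa> * \<tau>"
    and e2: "\<And>\<tau> s0 r0 s1 r1 s0' r0' s1' r1'. 0 < \<tau> \<Longrightarrow> \<tau> \<le> 1 \<Longrightarrow> s0 \<le> Mx \<Longrightarrow> s0' \<le> Mx \<Longrightarrow>
       reaction_sol (SigmaR F1 F2 G1 G2) (RR F1 F2 G1 G2) \<tau> s0 r0 s1 r1 \<Longrightarrow>
       reaction_sol (SigmaR F1 F2 G1 G2) (RR F1 F2 G1 G2) \<tau> s0' r0' s1' r1' \<Longrightarrow>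
       \<bar>s1 - s1'\<bar> \<le> \<bar>s0 - s0'\<bar> + \<kappa> * \<tau> * (\<bar>s0 - s0'\<bar> + \<bar>r0 - r0'\<bar>) \<and>
       \<bar>r1 - r1'\<bar> \<le> \<bar>r0 - r0'\<bar> + \<kappa> * \<tau> * (\<bar>s0 - s0'\<bar> + \<bar>r0 - r0'\<bar>)"
    and init: "good_state a b M0 V0 W0 \<sigma>0 r0 {a<..<b}"
begin

definition C1 where "C1 = energy_slope chi Mx * (\<kappa> * Mx) * (b - a)"
definition C2 where "C2 = 2 * \<kappa> * Mx * (b - a)"
definition C3 where "C3 = 2 * ((chi Mx - chi 0) * (b - a) + C1 * T)"
definition Vx where "Vx = (V0 + W0) * exp (2 * \<kappa> * T)"

lemma Mx_nonneg: "0 \<le> Mx" unfolding Mx using M00 by simp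

lemma C1_nonneg: "0 \<le> C1"
  unfolding C1_def using energy_slope_nonneg[OF chi Mx_nonneg] \<kappa>0 Mx_nonneg ab by simp

lemma C3_nonneg: "0 \<le> C3"
  unfolding C3_def using C1_nonneg energy_ge_zero_value[OF chi Mx_nonneg] ab T by simp

lemma scheme_step:
  assumes \<tau>: "0 < \<tau>" "\<tau> < 1" and sch: "splitting_scheme chi F1 F2 G1 G2 a b T \<tau> \<sigma>0 r0 sig r sigh rh rho eta"
    and n: "real n * \<tau> < T" and good: "good_state a b M V W (sig n) (r n) D" and M: "0 \<le> M" "exp (B * \<tau>) * M \<le> Mx"
  obtains D' d where "good_state a b (exp (B * \<tau>) * M) ((1 + \<kappa> * \<tau>) * V + \<kappa> * \<tau> * W) ((1 + \<kappa> * \<tau>) * W + \<kappa> * \<tau> * V) (sig (Suc n)) (r (Suc n)) D'"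
    "0 \<le> d" "d / (2 * \<tau>) + (LINT x|lborel. (chi (sig (Suc n) x) - chi 0) * indicator D' x) \<le> (LINT x|lborel. (chi (sig n x) - chi 0) * indicator D x) + C1 * \<tau>"
    "\<And>\<phi> L l c. \<phi> \<in> borel_measurable borel \<Longrightarrow> (\<And>x. \<bar>\<phi> x\<bar> \<le> 1) \<Longrightarrow> (\<And>x y. \<bar>\<phi> x - \<phi> y\<bar> \<le> L * \<bar>x - y\<bar>) \<Longrightarrow> 0 < l \<Longrightarrow>
      \<bar>(LINT x|lborel. \<phi> x * (wt c (r (Suc n) x) * sig (Suc n) x * indicator D' x)) - (LINT x|lborel. \<phi> x * (wt c (r n x) * sig n x * indicator D x))\<bar>
       \<le> L * (l * (Mx * (b - a)) + d / l) + C2 * \<tau>"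
proof -
  let ?Mh = "exp (B * \<tau>) * M"
  have step: "\<forall>x\<in>{a..b}. reaction_sol (SigmaR F1 F2 G1 G2) (RR F1 F2 G1 G2) \<tau> (sig n x) (r n x) (sigh n x) (rh n x)"
    "set_borel_measurable borel {a<..<b} (rho (Suc n))" "set_borel_measurable borel {a<..<b} (eta (Suc n))"
    "\<forall>x\<in>{a..b}. rho (Suc n) x \<ge> 0 \<and> eta (Suc n) x \<ge> 0"
    "\<forall>\<mu>\<in>Pm a b (emeasure (dens a b (\<lambda>x. rh n x * sigh n x)) UNIV). \<forall>\<nu>\<in>Pm a b (emeasure (dens a b (\<lambda>x. (1 - rh n x) * sigh n x)) UNIV).
              JKO_functional chi a b \<tau> (dens a b (\<lambda>x. rh n x * sigh n x)) (dens a b (\<lambda>x. (1 - rh n x) * sigh n x))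
                 (dens a b (rho (Suc n))) (dens a b (eta (Suc n)))
              \<le> JKO_functional chi a b \<tau> (dens a b (\<lambda>x. rh n x * sigh n x)) (dens a b (\<lambda>x. (1 - rh n x) * sigh n x)) \<mu> \<nu>"
    "\<forall>x\<in>{a..b}. sig (Suc n) x = rho (Suc n) x + eta (Suc n) x"
    "\<exists>Tm. Tm \<in> borel_measurable borel \<and> mono_on {a..b} Tm \<and> Tm ` {a..b} \<subseteq> {a..b} \<and>
              distr (dens a b (sig (Suc n))) borel Tm = dens a b (sigh n) \<and>
              (\<forall>x\<in>{a..b}. r (Suc n) x = rh n (Tm x))"
    using sch n unfolding splitting_scheme_def Let_def by blast+
  obtain Tm where Tm: "Tm \<in> borel_measurable borel" "mono_on {a..b} Tm" "Tm ` {a..b} \<subseteq> {a..b}"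
      "distr (dens a b (sig (Suc n))) borel Tm = dens a b (sigh n)" "\<forall>x\<in>{a..b}. r (Suc n) x = rh n (Tm x)"
    using step(7) by blast
  have D: "D \<in> sets borel" "D \<subseteq> {a<..<b}" "AE x in lborel. x \<in> {a<..<b} \<longrightarrow> x \<in> D"
    and bd: "\<And>x. x \<in> D \<Longrightarrow> 0 \<le> sig n x \<and> sig n x \<le> M \<and> 0 \<le> r n x \<and> r n x \<le> 1"
    using good unfolding good_state_def by auto
  have DI: "x \<in> {a..b}" if "x \<in> D" for x using that D(2) by auto
  have "1 \<le> exp (B * \<tau>)" using B0 \<tau> by simp
  then have MM: "M \<le> ?Mh" using mult_right_mono[of 1 "exp (B * \<tau>)" M] M(1) by simp
  then have MMx: "M \<le> Mx" using M(2) by linarith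
  have Mh0: "0 \<le> ?Mh" using M by simp
  have solD: "reaction_sol (SigmaR F1 F2 G1 G2) (RR F1 F2 G1 G2) \<tau> (sig n x) (r n x) (sigh n x) (rh n x)" if "x \<in> D" for x
    using step(1) DI[OF that] by blast
  have goodh: "good_state a b ?Mh ((1 + \<kappa> * \<tau>) * V + \<kappa> * \<tau> * W) ((1 + \<kappa> * \<tau>) * W + \<kappa> * \<tau> * V) (sigh n) (rh n) D"
    by (rule reaction_step_good[OF good MMx \<tau>(1) less_imp_le[OF \<tau>(2)] \<kappa>0 solD B e1 e2]) (use \<tau> in auto)
  have bdh: "\<And>x. x \<in> D \<Longrightarrow> 0 \<le> sigh n x \<and> sigh n x \<le> ?Mh \<and> 0 \<le> rh n x \<and> rh n x \<le> 1"
    using goodh unfolding good_state_def by auto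
  have rh01: "0 \<le> rh n x \<and> rh n x \<le> 1" if "x \<in> {a..b}" for x
    using reaction_sol_bounds(5,6)[OF B step(1)[rule_format, OF that]] \<tau> by auto
  have inc: "\<bar>sigh n x - sig n x\<bar> \<le> \<kappa> * Mx * \<tau>" "\<bar>rh n x - r n x\<bar> \<le> \<kappa> * \<tau>" if x: "x \<in> D" for x
  proof -
    have *: "\<bar>sigh n x - sig n x\<bar> \<le> \<kappa> * \<tau> * sig n x \<and> \<bar>rh n x - r n x\<bar> \<le> \<kappa> * \<tau>"
      by (rule e1[OF \<tau>(1) less_imp_le[OF \<tau>(2)] _ solD[OF x]]) (use bd[OF x] MMx in linarith)
    then show "\<bar>rh n x - r n x\<bar> \<le> \<kappa> * \<tau>" by simp
    have "\<kappa> * \<tau> * sig n x \<le> \<kappa> * \<tau> * Mx" using bd[OF x] MMx \<kappa>0 \<tau> by (intro mult_left_mono) auto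
    then show "\<bar>sigh n x - sig n x\<bar> \<le> \<kappa> * Mx * \<tau>" using * by (simp add: mult_ac)
  qed
  obtain D' d where D': "good_state a b ?Mh ((1 + \<kappa> * \<tau>) * V + \<kappa> * \<tau> * W) ((1 + \<kappa> * \<tau>) * W + \<kappa> * \<tau> * V) (sig (Suc n)) (r (Suc n)) D'" "0 \<le> d"
    and ener: "d / (2 * \<tau>) + (LINT x|lborel. (chi (sig (Suc n) x) - chi 0) * indicator D' x) \<le> (LINT x|lborel. (chi (sigh n x) - chi 0) * indicator D x)"
    and test: "\<And>\<phi> L l c. \<phi> \<in> borel_measurable borel \<Longrightarrow> (\<And>x. \<bar>\<phi> x\<bar> \<le> 1) \<Longrightarrow> (\<And>x y. \<bar>\<phi> x - \<phi> y\<bar> \<le> L * \<bar>x - y\<bar>) \<Longrightarrow> 0 < l \<Longrightarrow>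
      \<bar>(LINT x|lborel. \<phi> x * (wt c (r (Suc n) x) * sig (Suc n) x * indicator D' x)) - (LINT x|lborel. \<phi> x * (wt c (rh n x) * sigh n x * indicator D x))\<bar>
       \<le> L * (l * (?Mh * (b - a)) + d / l)"
    by (rule diffusion_step_good[OF ab \<tau>(1) chi Mh0 goodh rh01 step(2,3), where sg="sig (Suc n)" and r="r (Suc n)" and Tm=Tm])
       (use step Tm in auto)
  have "(LINT x|lborel. (chi (sigh n x) - chi 0) * indicator D x) - (LINT x|lborel. (chi (sig n x) - chi 0) * indicator D x)
     = (LINT x|lborel. (chi (sigh n x) - chi 0) * indicator D x - (chi (sig n x) - chi 0) * indicator D x)"
    by (rule Bochner_Integration.integral_diff[symmetric])
       (use good_state_energy(1)[OF goodh chi _ Mh0] good_state_energy(1)[OF good chi _ M(1)] ab in auto)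
  also have "\<dots> \<le> (LINT x|lborel. (energy_slope chi Mx * (\<kappa> * Mx * \<tau>)) * indicator {a<..<b} x)"
  proof (rule integral_mono)
    show "integrable lborel (\<lambda>x. (chi (sigh n x) - chi 0) * indicator D x - (chi (sig n x) - chi 0) * indicator D x)"
      using good_state_energy(1)[OF goodh chi _ Mh0] good_state_energy(1)[OF good chi _ M(1)] ab by auto
    show "integrable lborel (\<lambda>x. (energy_slope chi Mx * (\<kappa> * Mx * \<tau>)) * indicator {a<..<b} x)"
      by (intro integrable_mult_right integrable_real_indicator) (use ab in auto)
    fix x
    have nn: "0 \<le> energy_slope chi Mx" by (rule energy_slope_nonneg[OF chi Mx_nonneg])
    have "chi (sigh n x) - chi (sig n x) \<le> energy_slope chi Mx * (\<kappa> * Mx * \<tau>)" if x: "x \<in> D"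
    proof (cases "sig n x \<le> sigh n x")
      case True
      have "chi (sigh n x) - chi (sig n x) \<le> energy_slope chi Mx * (sigh n x - sig n x)"
        by (rule energy_diff_le[OF chi]) (use True bd[OF x] bdh[OF x] M(2) in auto)
      also have "\<dots> \<le> energy_slope chi Mx * (\<kappa> * Mx * \<tau>)" using inc(1)[OF x] nn by (intro mult_left_mono) auto
      finally show ?thesis .
    next
      case False
      have "energy_slope chi 0 * (sig n x - sigh n x) \<le> chi (sig n x) - chi (sigh n x)"
        by (rule energy_diff_ge[OF chi]) (use False bdh[OF x] in auto)
      moreover have "0 \<le> energy_slope chi Mx * (\<kappa> * Mx * \<tau>)" using nn \<kappa>0 Mx_nonneg \<tau> by simp
      ultimately show ?thesis by (simp add: energy_slope_def)
    qed
    then show "(chi (sigh n x) - chi 0) * indicator D x - (chi (sig n x) - chi 0) * indicator D x \<le> (energy_slope chi Mx * (\<kappa> * Mx * \<tau>)) * indicator {a<..<b} x"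
      using D(2) nn \<kappa>0 Mx_nonneg \<tau> by (auto split: split_indicator)
  qed
  also have "\<dots> = C1 * \<tau>" unfolding C1_def using ab by (simp add: mult_ac)
  finally have 3: "d / (2 * \<tau>) + (LINT x|lborel. (chi (sig (Suc n) x) - chi 0) * indicator D' x) \<le> (LINT x|lborel. (chi (sig n x) - chi 0) * indicator D x) + C1 * \<tau>"
    using ener by linarith
  show ?thesis
  proof (rule that[OF D' 3])
    fix \<phi> :: "real \<Rightarrow> real" and L l :: real and c
    assume \<phi> [measurable]: "\<phi> \<in> borel_measurable borel" and \<phi>1: "\<And>x. \<bar>\<phi> x\<bar> \<le> 1" "\<And>x y. \<bar>\<phi> x - \<phi> y\<bar> \<le> L * \<bar>x - y\<bar>" and l: "0 < l"
    have L0: "0 \<le> L" using \<phi>1(2)[of 0 1] by (simp add: abs_le_iff)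
    define f g where "f x = \<phi> x * (wt c (rh n x) * sigh n x * indicator D x)" and "g x = \<phi> x * (wt c (r n x) * sig n x * indicator D x)" for x
    have [measurable]: "(\<lambda>x. wt c (rh n x) * sigh n x * indicator D x) \<in> borel_measurable borel"
        "(\<lambda>x. wt c (r n x) * sig n x * indicator D x) \<in> borel_measurable borel"
      by (rule good_state_measurable[OF goodh], rule good_state_measurable[OF good])
    have fm: "f \<in> borel_measurable borel" "g \<in> borel_measurable borel" unfolding f_def[abs_def] g_def[abs_def] by measurable
    have fle: "\<bar>f x\<bar> \<le> Mx * indicator {a<..<b} x" for x
    proof (cases "x \<in> D")
      case True
      have "\<bar>\<phi> x\<bar> * (wt c (rh n x) * sigh n x) \<le> 1 * (1 * Mx)"
        using \<phi>1(1)[of x] bdh[OF True] M(2) wt_bounds[of "rh n x" c] by (intro mult_mono) auto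
      then show ?thesis using True D(2) bdh[OF True] wt_bounds[of "rh n x" c] by (auto simp: f_def abs_mult)
    qed (use Mx_nonneg in \<open>auto simp: f_def split: split_indicator\<close>)
    have gle: "\<bar>g x\<bar> \<le> Mx * indicator {a<..<b} x" for x
    proof (cases "x \<in> D")
      case True
      have "\<bar>\<phi> x\<bar> * (wt c (r n x) * sig n x) \<le> 1 * (1 * Mx)"
        using \<phi>1(1)[of x] bd[OF True] MMx wt_bounds[of "r n x" c] by (intro mult_mono) auto
      then show ?thesis using True D(2) bd[OF True] wt_bounds[of "r n x" c] by (auto simp: g_def abs_mult)
    qed (use Mx_nonneg in \<open>auto simp: g_def split: split_indicator\<close>)
    have fgle: "\<bar>f x - g x\<bar> \<le> (2 * \<kappa> * Mx * \<tau>) * indicator {a<..<b} x" for x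
    proof (cases "x \<in> D")
      case True
      have "wt c (rh n x) * sigh n x - wt c (r n x) * sig n x = (wt c (rh n x) - wt c (r n x)) * sigh n x + wt c (r n x) * (sigh n x - sig n x)"
        by (simp add: algebra_simps)
      also have "\<bar>\<dots>\<bar> \<le> \<bar>wt c (rh n x) - wt c (r n x)\<bar> * \<bar>sigh n x\<bar> + \<bar>wt c (r n x)\<bar> * \<bar>sigh n x - sig n x\<bar>"
        unfolding abs_mult[symmetric] by (rule abs_triangle_ineq)
      also have "\<dots> \<le> (\<kappa> * \<tau>) * Mx + 1 * (\<kappa> * Mx * \<tau>)"
        using inc[OF True] bdh[OF True] bd[OF True] M(2) wt_bounds[of "r n x" c] \<kappa>0 \<tau> unfolding wt_diff
        by (intro add_mono mult_mono) auto
      finally have *: "\<bar>wt c (rh n x) * sigh n x - wt c (r n x) * sig n x\<bar> \<le> 2 * \<kappa> * Mx * \<tau>" by (simp add: mult_ac)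
      have "\<bar>f x - g x\<bar> = \<bar>\<phi> x\<bar> * \<bar>wt c (rh n x) * sigh n x - wt c (r n x) * sig n x\<bar>"
        using True unfolding f_def g_def abs_mult[symmetric] by (simp add: algebra_simps)
      also have "\<dots> \<le> 1 * (2 * \<kappa> * Mx * \<tau>)" by (rule mult_mono[OF \<phi>1(1) *]) auto
      finally show ?thesis using True D(2) by auto
    qed (use Mx_nonneg \<kappa>0 \<tau> in \<open>auto simp: f_def g_def split: split_indicator\<close>)
    have "\<bar>LINT x|lborel. f x - g x\<bar> \<le> (2 * \<kappa> * Mx * \<tau>) * (b - a)"
      by (rule integrable_of_bounded_on_interval[OF _ fgle]) (use fm ab in auto)
    moreover have "(LINT x|lborel. f x - g x) = (LINT x|lborel. f x) - (LINT x|lborel. g x)"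
      by (rule Bochner_Integration.integral_diff)
         (use integrable_of_bounded_on_interval[OF fm(1) fle] integrable_of_bounded_on_interval[OF fm(2) gle] ab in auto)
    moreover have "(2 * \<kappa> * Mx * \<tau>) * (b - a) = C2 * \<tau>" unfolding C2_def by simp
    moreover have "\<bar>(LINT x|lborel. \<phi> x * (wt c (r (Suc n) x) * sig (Suc n) x * indicator D' x)) - (LINT x|lborel. f x)\<bar> \<le> L * (l * (?Mh * (b - a)) + d / l)"
      unfolding f_def by (rule test[OF \<phi> \<phi>1 l])
    moreover have "L * (l * (?Mh * (b - a)) + d / l) \<le> L * (l * (Mx * (b - a)) + d / l)"
      using L0 l ab M(2) by (intro mult_left_mono add_right_mono mult_right_mono) auto
    ultimately show "\<bar>(LINT x|lborel. \<phi> x * (wt c (r (Suc n) x) * sig (Suc n) x * indicator D' x)) - (LINT x|lborel. \<phi> x * (wt c (r n x) * sig n x * indicator D x))\<bar>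
       \<le> L * (l * (Mx * (b - a)) + d / l) + C2 * \<tau>" unfolding g_def[symmetric] by linarith
  qed
qed

lemma scheme_estimates:
  assumes adm: "admissible_step T \<tau>" and sch: "splitting_scheme chi F1 F2 G1 G2 a b T \<tau> \<sigma>0 r0 sig r sigh rh rho eta"
  obtains D where "\<And>n. real n * \<tau> \<le> T \<Longrightarrow> good_state a b Mx Vx Vx (sig n) (r n) (D n)"
    "\<And>\<phi> L c m n \<omega>. \<phi> \<in> borel_measurable borel \<Longrightarrow> (\<And>x. \<bar>\<phi> x\<bar> \<le> 1) \<Longrightarrow> (\<And>x y. \<bar>\<phi> x - \<phi> y\<bar> \<le> L * \<bar>x - y\<bar>) \<Longrightarrow>
      m \<le> n \<Longrightarrow> real n * \<tau> \<le> T \<Longrightarrow> 0 < \<omega> \<Longrightarrow>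
      \<bar>(LINT x|lborel. \<phi> x * (wt c (r n x) * sig n x * indicator (D n) x)) - (LINT x|lborel. \<phi> x * (wt c (r m x) * sig m x * indicator (D m) x))\<bar>
       \<le> L * (Mx * (b - a) * ((real n - real m) * \<tau>) / \<omega> + C3 * \<omega>) + C2 * ((real n - real m) * \<tau>)"
proof -
  have \<tau>: "0 < \<tau>" "\<tau> < 1" using adm by (auto simp: admissible_step_def)
  define P where "P n D \<longleftrightarrow> (real n * \<tau> \<le> T \<longrightarrow> (\<exists>V W. good_state a b (exp (B * (n * \<tau>)) * M0) V W (sig n) (r n) D \<and>
      V + W \<le> (V0 + W0) * exp (2 * \<kappa> * (n * \<tau>))))" for n D
  define en where "en n D = (LINT x|lborel. (chi (sig n x) - chi 0) * indicator D x)" for n D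
  define tst where "tst \<phi> c n D = (LINT x|lborel. \<phi> x * (wt c (r n x) * sig n x * indicator D x))" for \<phi> c n D
  define Q where "Q n D D' \<longleftrightarrow> (real (Suc n) * \<tau> \<le> T \<longrightarrow> (\<exists>d\<ge>0. d / (2 * \<tau>) + en (Suc n) D' \<le> en n D + C1 * \<tau> \<and>
     (\<forall>\<phi> L l c. \<phi> \<in> borel_measurable borel \<longrightarrow> (\<forall>x. \<bar>\<phi> x\<bar> \<le> 1) \<longrightarrow> (\<forall>x y. \<bar>\<phi> x - \<phi> y\<bar> \<le> L * \<bar>x - y\<bar>) \<longrightarrow> 0 < l \<longrightarrow>
       \<bar>tst \<phi> c (Suc n) D' - tst \<phi> c n D\<bar> \<le> L * (l * (Mx * (b - a)) + d / l) + C2 * \<tau>)))" for n D D'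
  have "\<exists>D. \<forall>n. P n (D n) \<and> Q n (D n) (D (Suc n))"
  proof (rule dependent_nat_choice)
    have s0: "\<And>x. x \<in> {a<..<b} \<Longrightarrow> \<sigma>0 x = sig 0 x \<and> r0 x = r 0 x"
      using sch unfolding splitting_scheme_def by (auto dest: bspec)
    have eqs: "{x \<in> {a<..<b}. 0 < sig 0 x} = {x \<in> {a<..<b}. 0 < \<sigma>0 x}" using s0 by auto
    have "good_state a b M0 V0 W0 (sig 0) (r 0) {a<..<b}"
      using init s0 bv_on_cong[of "{a<..<b}" \<sigma>0 V0 "sig 0"] bv_on_cong[of "{x \<in> {a<..<b}. 0 < \<sigma>0 x}" r0 W0 "r 0"]
      unfolding good_state_def eqs by simp
    then show "\<exists>D. P 0 D" unfolding P_def by (intro exI[of _ "{a<..<b}"] impI exI[of _ V0] exI[of _ W0]) simp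
  next
    fix D n assume PD: "P n D"
    show "\<exists>D'. P (Suc n) D' \<and> Q n D D'"
    proof (cases "real (Suc n) * \<tau> \<le> T")
      case False
      then show ?thesis unfolding P_def Q_def by blast
    next
      case True
      then have n: "real n * \<tau> < T" using \<tau> by (simp add: algebra_simps)
      obtain V W where good: "good_state a b (exp (B * (n * \<tau>)) * M0) V W (sig n) (r n) D"
        and VW: "V + W \<le> (V0 + W0) * exp (2 * \<kappa> * (n * \<tau>))" using PD n unfolding P_def by auto
      have ex: "exp (B * \<tau>) * (exp (B * (n * \<tau>)) * M0) = exp (B * (Suc n * \<tau>)) * M0"
        by (simp add: algebra_simps flip: exp_add)
      have "B * (Suc n * \<tau>) \<le> B * T" using True B0 by (intro mult_left_mono) auto
      then have le: "exp (B * \<tau>) * (exp (B * (n * \<tau>)) * M0) \<le> Mx"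
        unfolding ex Mx using M00 by (intro mult_right_mono) auto
      obtain D' d where D': "good_state a b (exp (B * \<tau>) * (exp (B * (n * \<tau>)) * M0)) ((1 + \<kappa> * \<tau>) * V + \<kappa> * \<tau> * W) ((1 + \<kappa> * \<tau>) * W + \<kappa> * \<tau> * V) (sig (Suc n)) (r (Suc n)) D'"
        "0 \<le> d" "d / (2 * \<tau>) + en (Suc n) D' \<le> en n D + C1 * \<tau>"
        and ts: "\<And>\<phi> L l c. \<phi> \<in> borel_measurable borel \<Longrightarrow> (\<And>x. \<bar>\<phi> x\<bar> \<le> 1) \<Longrightarrow> (\<And>x y. \<bar>\<phi> x - \<phi> y\<bar> \<le> L * \<bar>x - y\<bar>) \<Longrightarrow> 0 < l \<Longrightarrow>
            \<bar>tst \<phi> c (Suc n) D' - tst \<phi> c n D\<bar> \<le> L * (l * (Mx * (b - a)) + d / l) + C2 * \<tau>"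
        unfolding en_def tst_def
        by (rule scheme_step[OF \<tau> sch n good _ le]) (use M00 in auto)
      have VW0: "0 \<le> V + W" using good bv_on_nonneg unfolding good_state_def by (meson add_nonneg_nonneg)
      have "(1 + \<kappa> * \<tau>) * V + \<kappa> * \<tau> * W + ((1 + \<kappa> * \<tau>) * W + \<kappa> * \<tau> * V) = (1 + 2 * \<kappa> * \<tau>) * (V + W)"
        by (simp add: algebra_simps)
      also have "\<dots> \<le> exp (2 * \<kappa> * \<tau>) * ((V0 + W0) * exp (2 * \<kappa> * (n * \<tau>)))"
        using VW VW0 by (intro mult_mono exp_ge_add_one_self) auto
      also have "\<dots> = (V0 + W0) * exp (2 * \<kappa> * (Suc n * \<tau>))"
        by (simp add: algebra_simps flip: exp_add)
      finally have "P (Suc n) D'" unfolding P_def using D'(1) unfolding ex by blast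
      moreover have "Q n D D'" unfolding Q_def using D'(2,3) ts by blast
      ultimately show ?thesis by blast
    qed
  qed
  then obtain D where PD: "\<And>n. P n (D n)" and QD: "\<And>n. Q n (D n) (D (Suc n))" by blast
  have good: "good_state a b Mx Vx Vx (sig n) (r n) (D n)" if n: "real n * \<tau> \<le> T" for n
  proof -
    obtain V W where g: "good_state a b (exp (B * (n * \<tau>)) * M0) V W (sig n) (r n) (D n)"
        and VW: "V + W \<le> (V0 + W0) * exp (2 * \<kappa> * (n * \<tau>))" using PD[of n] n unfolding P_def by auto
    have VW0: "0 \<le> V" "0 \<le> W" using g bv_on_nonneg unfolding good_state_def by blast+
    have i0: "0 \<le> V0 + W0" using init bv_on_nonneg unfolding good_state_def by (meson add_nonneg_nonneg)
    have "2 * \<kappa> * (n * \<tau>) \<le> 2 * \<kappa> * T" using n \<kappa>0 by (intro mult_left_mono) auto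
    then have "(V0 + W0) * exp (2 * \<kappa> * (n * \<tau>)) \<le> Vx" unfolding Vx_def using i0 by (intro mult_left_mono) auto
    moreover have "B * (n * \<tau>) \<le> B * T" using n B0 by (intro mult_left_mono) auto
    then have "exp (B * (n * \<tau>)) * M0 \<le> Mx" unfolding Mx using M00 by (intro mult_right_mono) auto
    ultimately show ?thesis using VW VW0 by (intro good_state_mono[OF g]) auto
  qed
  obtain d where d: "\<And>n. real (Suc n) * \<tau> \<le> T \<Longrightarrow> 0 \<le> d n" "\<And>n. real (Suc n) * \<tau> \<le> T \<Longrightarrow> d n / (2 * \<tau>) + en (Suc n) (D (Suc n)) \<le> en n (D n) + C1 * \<tau>"
    and ts: "\<And>n \<phi> L l c. real (Suc n) * \<tau> \<le> T \<Longrightarrow> \<phi> \<in> borel_measurable borel \<Longrightarrow> (\<forall>x. \<bar>\<phi> x\<bar> \<le> 1) \<Longrightarrow> (\<forall>x y. \<bar>\<phi> x - \<phi> y\<bar> \<le> L * \<bar>x - y\<bar>) \<Longrightarrow> 0 < l \<Longrightarrow>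
       \<bar>tst \<phi> c (Suc n) (D (Suc n)) - tst \<phi> c n (D n)\<bar> \<le> L * (l * (Mx * (b - a)) + d n / l) + C2 * \<tau>"
    using QD unfolding Q_def by metis
  have en0: "0 \<le> en n (D n)" "en n (D n) \<le> (chi Mx - chi 0) * (b - a)" if "real n * \<tau> \<le> T" for n
    unfolding en_def using good_state_energy(2,3)[OF good[OF that] chi _ Mx_nonneg] ab by auto
  have mono: "real k * \<tau> \<le> T" if "k \<le> n" "real n * \<tau> \<le> T" for k n
    using that \<tau> by (meson mult_right_mono of_nat_le_iff order_trans less_imp_le)
  have sumd: "(\<Sum>k<n. d k) \<le> C3 * \<tau>" if n: "real n * \<tau> \<le> T" for n
  proof -
    have "(\<Sum>k<n. d k) / (2 * \<tau>) + en n (D n) \<le> en 0 (D 0) + C1 * (real n * \<tau>)" using n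
    proof (induction n)
      case (Suc n)
      then have "(\<Sum>k<n. d k) / (2 * \<tau>) + en n (D n) \<le> en 0 (D 0) + C1 * (real n * \<tau>)" using mono[of n "Suc n"] by simp
      then show ?case using d(2)[OF Suc.prems] by (simp add: add_divide_distrib algebra_simps)
    qed simp
    moreover have "C1 * (real n * \<tau>) \<le> C1 * T" using C1_nonneg n by (intro mult_left_mono) auto
    ultimately have "(\<Sum>k<n. d k) / (2 * \<tau>) \<le> (chi Mx - chi 0) * (b - a) + C1 * T"
      using en0[OF n] en0(2)[of 0] T by simp
    then show ?thesis using \<tau> unfolding C3_def by (simp add: pos_divide_le_eq mult_ac)
  qed
  show ?thesis
  proof (rule that[of D])
    show "good_state a b Mx Vx Vx (sig n) (r n) (D n)" if "real n * \<tau> \<le> T" for n by (rule good[OF that])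
    fix \<phi> :: "real \<Rightarrow> real" and L \<omega> :: real and c and m n :: nat
    assume \<phi>: "\<phi> \<in> borel_measurable borel" "\<And>x. \<bar>\<phi> x\<bar> \<le> 1" "\<And>x y. \<bar>\<phi> x - \<phi> y\<bar> \<le> L * \<bar>x - y\<bar>"
      and mn: "m \<le> n" "real n * \<tau> \<le> T" and \<omega>: "0 < \<omega>"
    have L0: "0 \<le> L" using \<phi>(3)[of 0 1] by (simp add: abs_le_iff)
    define l where "l = \<tau> / \<omega>"
    have l: "0 < l" unfolding l_def using \<tau> \<omega> by simp
    have "\<bar>tst \<phi> c n (D n) - tst \<phi> c m (D m)\<bar> \<le> (\<Sum>k=m..<n. L * (l * (Mx * (b - a)) + d k / l) + C2 * \<tau>)"
      using mn
    proof (induction n rule: dec_induct)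
      case (step n)
      then have "\<bar>tst \<phi> c n (D n) - tst \<phi> c m (D m)\<bar> \<le> (\<Sum>k=m..<n. L * (l * (Mx * (b - a)) + d k / l) + C2 * \<tau>)"
        using mono[of n "Suc n"] by simp
      moreover have "\<bar>tst \<phi> c (Suc n) (D (Suc n)) - tst \<phi> c n (D n)\<bar> \<le> L * (l * (Mx * (b - a)) + d n / l) + C2 * \<tau>"
        by (rule ts) (use step \<phi> l in auto)
      ultimately show ?case using step by simp
    qed simp
    also have "\<dots> = L * (l * (Mx * (b - a)) * (real n - real m) + (\<Sum>k=m..<n. d k) / l) + C2 * \<tau> * (real n - real m)"
      unfolding sum.distrib sum_distrib_left[symmetric] sum_divide_distrib[symmetric]
      using mn by (simp add: of_nat_diff mult_ac)
    also have "\<dots> \<le> L * (Mx * (b - a) * ((real n - real m) * \<tau>) / \<omega> + C3 * \<omega>) + C2 * ((real n - real m) * \<tau>)"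
    proof -
      have "(\<Sum>k=m..<n. d k) \<le> (\<Sum>k<n. d k)"
      proof (rule sum_mono2)
        fix k assume "k \<in> {..<n} - {m..<n}"
        then show "0 \<le> d k" using mono[of "Suc k" n] mn(2) by (intro d(1)) auto
      qed auto
      then have "(\<Sum>k=m..<n. d k) / l \<le> C3 * \<tau> / l" using sumd[OF mn(2)] l by (intro divide_right_mono) auto
      also have "\<dots> = C3 * \<omega>" unfolding l_def using \<tau> \<omega> by simp
      finally have "L * (l * (Mx * (b - a)) * (real n - real m) + (\<Sum>k=m..<n. d k) / l) \<le> L * (l * (Mx * (b - a)) * (real n - real m) + C3 * \<omega>)"
        using L0 by (intro mult_left_mono) auto
      moreover have "l * (Mx * (b - a)) * (real n - real m) = Mx * (b - a) * ((real n - real m) * \<tau>) / \<omega>"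
        unfolding l_def by simp
      ultimately show ?thesis by (simp add: mult_ac)
    qed
    finally show "\<bar>(LINT x|lborel. \<phi> x * (wt c (r n x) * sig n x * indicator (D n) x)) - (LINT x|lborel. \<phi> x * (wt c (r m x) * sig m x * indicator (D m) x))\<bar>
       \<le> L * (Mx * (b - a) * ((real n - real m) * \<tau>) / \<omega> + C3 * \<omega>) + C2 * ((real n - real m) * \<tau>)"
      unfolding tst_def .
  qed
qed

lemma wt_state_bv:
  assumes "good_state a b Mx V W sg r D"
  shows "bv_on D (\<lambda>x. wt c (r x) * sg x) (V + Mx * W)"
proof -
  have bd: "\<And>x. x \<in> D \<Longrightarrow> 0 \<le> sg x \<and> sg x \<le> Mx \<and> 0 \<le> r x \<and> r x \<le> 1"
    and bv: "bv_on D sg V" "bv_on {x\<in>D. 0 < sg x} r W"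
    using assms unfolding good_state_def by auto
  have "bv_on D (\<lambda>x. wt c (r x) * sg x) (1 * V + Mx * W)"
  proof (rule bv_on_combine[OF bv])
    fix x y assume xy: "x \<in> D" "y \<in> D" "x \<le> y"
    have eq: "wt c (r y) * sg y - wt c (r x) * sg x = wt c (r y) * (sg y - sg x) + (wt c (r y) - wt c (r x)) * sg x"
      by (simp add: algebra_simps)
    have "\<bar>wt c (r y) * (sg y - sg x) + (wt c (r y) - wt c (r x)) * sg x\<bar> \<le> wt c (r y) * \<bar>sg y - sg x\<bar> + \<bar>r y - r x\<bar> * sg x"
      using abs_triangle_ineq[of "wt c (r y) * (sg y - sg x)" "(wt c (r y) - wt c (r x)) * sg x"] bd[OF xy(1)] bd[OF xy(2)] wt_bounds[of "r y" c]
      by (simp add: abs_mult wt_diff)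
    also have "\<dots> \<le> 1 * \<bar>sg y - sg x\<bar> + \<bar>r y - r x\<bar> * Mx"
      using bd[OF xy(1)] bd[OF xy(2)] wt_bounds[of "r y" c] by (intro add_mono mult_mono) auto
    finally have full: "\<bar>wt c (r y) * sg y - wt c (r x) * sg x\<bar> \<le> 1 * \<bar>sg y - sg x\<bar> + Mx * \<bar>r y - r x\<bar>"
      unfolding eq by (simp add: mult.commute)
    show "x \<in> D \<and> y \<in> D \<and> \<bar>wt c (r y) * sg y - wt c (r x) * sg x\<bar> \<le> 1 * \<bar>sg y - sg x\<bar> +
      (if x \<in> {x \<in> D. 0 < sg x} \<and> y \<in> {x \<in> D. 0 < sg x} then Mx * \<bar>r y - r x\<bar> else 0)"
    proof (cases "0 < sg x \<and> 0 < sg y")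
      case False
      then consider "sg x = 0" | "sg y = 0" using bd[OF xy(1)] bd[OF xy(2)] by force
      then have "\<bar>wt c (r y) * sg y - wt c (r x) * sg x\<bar> \<le> \<bar>sg y - sg x\<bar>"
        by cases (use bd[OF xy(1)] bd[OF xy(2)] wt_bounds[of "r y" c] wt_bounds[of "r x" c] in \<open>auto simp: abs_mult mult_left_le_one_le\<close>)
      then show ?thesis using xy False by auto
    qed (use xy full in auto)
  qed (use Mx_nonneg in auto)
  then show ?thesis by simp
qed

end

section \<open>Cell averages\<close>

definition cell :: "real \<Rightarrow> real \<Rightarrow> nat \<Rightarrow> real set" where
  "cell a h i = {a + real i * h ..< a + real (Suc i) * h}"

definition cell_index :: "real \<Rightarrow> real \<Rightarrow> real \<Rightarrow> nat" where
  "cell_index a h x = nat \<lfloor>(x - a) / h\<rfloor>"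

definition cell_avg :: "real \<Rightarrow> real \<Rightarrow> (real \<Rightarrow> real) \<Rightarrow> nat \<Rightarrow> real" where
  "cell_avg a h f i = (LINT y|lborel. f y * indicator (cell a h i) y) / h"

lemma cell_borel [measurable]: "cell a h i \<in> sets borel" unfolding cell_def by simp

lemma cell_index_mem:
  assumes "0 < h" "a \<le> x"
  shows "x \<in> cell a h (cell_index a h x)"
proof -
  have "0 \<le> (x - a) / h" using assms by simp
  then have i: "real (cell_index a h x) = of_int \<lfloor>(x - a) / h\<rfloor>" unfolding cell_index_def by simp
  have "real (cell_index a h x) \<le> (x - a) / h" "(x - a) / h < real (cell_index a h x) + 1" unfolding i by linarith+
  then have "real (cell_index a h x) * h \<le> x - a" "x - a < (real (cell_index a h x) + 1) * h"
    using assms(1) by (auto simp: pos_le_divide_eq pos_divide_less_eq)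
  then show ?thesis unfolding cell_def by (simp add: algebra_simps)
qed

lemma cell_index_less:
  assumes "a < b" "0 < n" "x \<in> {a<..<b}"
  shows "cell_index a ((b - a) / real n) x < n"
proof -
  have "(x - a) / ((b - a) / real n) < real n" using assms by (simp add: field_simps)
  then have "\<lfloor>(x - a) / ((b - a) / real n)\<rfloor> < int n" by (simp add: floor_less_iff)
  then show ?thesis unfolding cell_index_def using assms by (simp add: nat_less_iff)
qed

lemma emeasure_cell: "0 < h \<Longrightarrow> emeasure lborel (cell a h i) = ennreal h"
  unfolding cell_def by (simp add: algebra_simps)

lemma integrable_cell:
  fixes f :: "real \<Rightarrow> real"
  assumes [measurable]: "f \<in> borel_measurable borel" and "\<And>x. \<bar>f x\<bar> \<le> M" "0 < h"
  shows "integrable lborel (\<lambda>y. f y * indicator (cell a h i) y)"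
    "\<bar>LINT y|lborel. f y * indicator (cell a h i) y\<bar> \<le> M * h"
proof -
  have ind: "integrable lborel (\<lambda>y. M * indicator (cell a h i) y)"
    by (intro integrable_mult_right integrable_real_indicator) (use emeasure_cell[OF assms(3)] in auto)
  have le: "\<bar>f y * indicator (cell a h i) y\<bar> \<le> M * indicator (cell a h i) y" for y
    using assms(2)[of y] by (auto split: split_indicator)
  show 1: "integrable lborel (\<lambda>y. f y * indicator (cell a h i) y)"
    by (rule Bochner_Integration.integrable_bound[OF ind]) (use le in \<open>auto intro!: AE_I2 order_trans[OF _ abs_ge_self]\<close>)
  have "\<bar>LINT y|lborel. f y * indicator (cell a h i) y\<bar> \<le> (LINT y|lborel. \<bar>f y * indicator (cell a h i) y\<bar>)" by (rule integral_abs_bound)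
  also have "\<dots> \<le> (LINT y|lborel. M * indicator (cell a h i) y)"
    by (rule integral_mono[OF _ ind]) (use 1 le in auto)
  also have "\<dots> = M * h" using emeasure_cell[OF assms(3)] assms(3) by (simp add: measure_def)
  finally show "\<bar>LINT y|lborel. f y * indicator (cell a h i) y\<bar> \<le> M * h" .
qed

lemma cell_avg_le:
  assumes "f \<in> borel_measurable borel" "\<And>x. \<bar>f x\<bar> \<le> M" "0 < h"
  shows "\<bar>cell_avg a h f i\<bar> \<le> M"
  using integrable_cell(2)[OF assms] assms(3) unfolding cell_avg_def by (simp add: pos_divide_le_eq)

lemma measurable_cell_index [measurable]: "cell_index a h \<in> measurable borel (count_space UNIV)"
  unfolding cell_index_def[abs_def] by measurable

lemma cell_avg_bv_bound:
  assumes ab: "a < b" and n: "0 < n" and f [measurable]: "f \<in> borel_measurable borel" and M: "\<And>x. \<bar>f x\<bar> \<le> M"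
    and D: "AE x in lborel. x \<in> {a<..<b} \<longrightarrow> x \<in> D" "bv_on D f V" and h: "h = (b - a) / real n"
  shows "(LINT x|lborel. \<bar>f x - cell_avg a h f (cell_index a h x)\<bar> * indicator {a<..<b} x) \<le> h * V"
proof -
  obtain v where v: "mono v" "\<And>x. 0 \<le> v x \<and> v x \<le> V"
    "\<And>x y. x \<in> D \<Longrightarrow> y \<in> D \<Longrightarrow> x \<le> y \<Longrightarrow> \<bar>f y - f x\<bar> \<le> v y - v x"
    using D(2) unfolding bv_on_def by blast
  have h0: "0 < h" using ab n by (simp add: h)
  define p where "p i = a + real i * h" for i
  define osc where "osc i = v (p (Suc i)) - v (p i)" for i
  have pn: "p n = b" unfolding p_def h using n by simp
  have pmono: "p i \<le> p j" if "i \<le> j" for i j unfolding p_def using that h0 by (simp add: mult_right_mono)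
  have osc0: "0 \<le> osc i" for i unfolding osc_def using monoD[OF v(1) pmono[of i "Suc i"]] by simp
  have cp: "cell a h i = {p i..<p (Suc i)}" for i unfolding cell_def p_def ..
  have dev: "\<bar>f x - cell_avg a h f i\<bar> \<le> osc i" if x: "x \<in> D" "x \<in> cell a h i" and i: "i < n" for x i
  proof -
    have int: "integrable lborel (\<lambda>y. f y * indicator (cell a h i) y)" by (rule integrable_cell[OF f M h0])
    have ic: "integrable lborel (\<lambda>y. c * indicator (cell a h i) y)" for c :: real
      by (intro integrable_mult_right integrable_real_indicator) (use emeasure_cell[OF h0] in auto)
    have mc: "(LINT y|lborel. c * indicator (cell a h i) y) = c * h" for c
      using emeasure_cell[OF h0] h0 by (simp add: measure_def)
    have "f x * h - (LINT y|lborel. f y * indicator (cell a h i) y) = (LINT y|lborel. f x * indicator (cell a h i) y - f y * indicator (cell a h i) y)"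
      unfolding Bochner_Integration.integral_diff[OF ic int] mc ..
    also have "\<bar>\<dots>\<bar> \<le> (LINT y|lborel. \<bar>f x * indicator (cell a h i) y - f y * indicator (cell a h i) y\<bar>)"
      by (rule integral_abs_bound)
    finally have *: "\<bar>f x * h - (LINT y|lborel. f y * indicator (cell a h i) y)\<bar> \<le> (LINT y|lborel. \<bar>f x * indicator (cell a h i) y - f y * indicator (cell a h i) y\<bar>)" .
    have "(LINT y|lborel. \<bar>f x * indicator (cell a h i) y - f y * indicator (cell a h i) y\<bar>) \<le> (LINT y|lborel. osc i * indicator (cell a h i) y)"
    proof (rule integral_mono_AE)
      show "integrable lborel (\<lambda>y. \<bar>f x * indicator (cell a h i) y - f y * indicator (cell a h i) y\<bar>)" using ic[of "f x"] int by auto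
      show "integrable lborel (\<lambda>y. osc i * indicator (cell a h i) y)" by (rule ic)
      show "AE y in lborel. \<bar>f x * indicator (cell a h i) y - f y * indicator (cell a h i) y\<bar> \<le> osc i * indicator (cell a h i) y"
        using D(1) AE_lborel_singleton[of a]
      proof eventually_elim
        case (elim y)
        show ?case
        proof (cases "y \<in> cell a h i")
          case True
          have "a \<le> p i" "p (Suc i) \<le> b" using pmono[of 0 i] pmono[of "Suc i" n] i pn by (auto simp: p_def)
          then have "y \<in> D" using True elim unfolding cp by auto
          have vz: "v (p i) \<le> v z \<and> v z \<le> v (p (Suc i))" if "z \<in> cell a h i" for z
            using that unfolding cp by (auto intro!: monoD[OF v(1)])
          have "\<bar>f x - f y\<bar> \<le> \<bar>v x - v y\<bar>"
            using v(3)[OF x(1) \<open>y \<in> D\<close>] v(3)[OF \<open>y \<in> D\<close> x(1)] by (cases "x \<le> y") auto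
          then have "\<bar>f x - f y\<bar> \<le> osc i" using vz[OF x(2)] vz[OF True] unfolding osc_def by linarith
          then show ?thesis using True by simp
        qed simp
      qed
    qed
    then have "\<bar>f x * h - (LINT y|lborel. f y * indicator (cell a h i) y)\<bar> \<le> osc i * h" using * unfolding mc by linarith
    moreover have "f x - cell_avg a h f i = (f x * h - (LINT y|lborel. f y * indicator (cell a h i) y)) / h"
      unfolding cell_avg_def using h0 by (simp add: field_simps)
    ultimately show ?thesis using h0 by (simp add: pos_divide_le_eq abs_divide)
  qed
  have [measurable]: "(\<lambda>x. cell_avg a h f (cell_index a h x)) \<in> borel_measurable borel"
    by (rule measurable_compose[OF measurable_cell_index]) simp
  have sum_int: "integrable lborel (\<lambda>x. \<Sum>i<n. osc i * indicator (cell a h i) x)"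
    by (intro Bochner_Integration.integrable_sum integrable_mult_right integrable_real_indicator)
       (use emeasure_cell[OF h0] in auto)
  have "(LINT x|lborel. \<bar>f x - cell_avg a h f (cell_index a h x)\<bar> * indicator {a<..<b} x) \<le> (LINT x|lborel. (\<Sum>i<n. osc i * indicator (cell a h i) x))"
  proof (rule integral_mono_AE[OF _ sum_int])
    show "integrable lborel (\<lambda>x. \<bar>f x - cell_avg a h f (cell_index a h x)\<bar> * indicator {a<..<b} x)"
    proof (rule integrable_of_bounded_on_interval)
      show "\<bar>\<bar>f x - cell_avg a h f (cell_index a h x)\<bar> * indicator {a<..<b} x\<bar> \<le> 2 * M * indicator {a<..<b} x" for x
        using M[of x] cell_avg_le[OF f M h0, of a "cell_index a h x"] by (auto split: split_indicator)
    qed (use ab in auto)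
    show "AE x in lborel. \<bar>f x - cell_avg a h f (cell_index a h x)\<bar> * indicator {a<..<b} x \<le> (\<Sum>i<n. osc i * indicator (cell a h i) x)"
      using D(1)
    proof eventually_elim
      case (elim x)
      show ?case
      proof (cases "x \<in> {a<..<b}")
        case True
        let ?i = "cell_index a h x"
        have i: "?i < n" using cell_index_less[OF ab n True] unfolding h .
        have c: "x \<in> cell a h ?i" by (rule cell_index_mem[OF h0]) (use True in auto)
        have "\<bar>f x - cell_avg a h f ?i\<bar> \<le> osc ?i" using dev[OF _ c i] elim True by simp
        also have "\<dots> = osc ?i * indicator (cell a h ?i) x" using c by simp
        also have "\<dots> \<le> (\<Sum>i<n. osc i * indicator (cell a h i) x)"
          by (rule member_le_sum[where f="\<lambda>i. osc i * indicator (cell a h i) x"]) (use i osc0 in auto)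
        finally show ?thesis using True by simp
      qed (auto intro!: sum_nonneg simp: osc0)
    qed
  qed
  also have "\<dots> = (\<Sum>i<n. osc i * h)"
    using emeasure_cell[OF h0] h0 by (subst Bochner_Integration.integral_sum) (auto simp: measure_def)
  also have "\<dots> = h * (v (p n) - v (p 0))"
    unfolding osc_def sum_distrib_right[symmetric] sum_lessThan_telescope[of "\<lambda>i. v (p i)"] by (rule mult.commute)
  also have "\<dots> \<le> h * V" using h0 v(2)[of "p n"] v(2)[of "p 0"] by (intro mult_left_mono) linarith+
  finally show ?thesis .
qed

lemma lipschitz_cell_cutoff:
  assumes "c < d" "0 < e"
  obtains \<phi> :: "real \<Rightarrow> real" where "\<phi> \<in> borel_measurable borel" "\<And>x. \<bar>\<phi> x\<bar> \<le> 1"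
    "\<And>x y. \<bar>\<phi> x - \<phi> y\<bar> \<le> (1 / e) * \<bar>x - y\<bar>" "\<And>x. \<bar>\<phi> x - indicator {c..<d} x\<bar> \<le> indicator {c - e..c} x + indicator {d..d + e} x"
proof -
  define g where "g x = min (x - c) (d - x)" for x
  define \<phi> where "\<phi> x = max 0 (min 1 (g x / e + 1))" for x
  have g: "\<bar>g x - g y\<bar> \<le> \<bar>x - y\<bar>" for x y unfolding g_def by (auto simp: min_def)
  have "\<bar>\<phi> x - \<phi> y\<bar> \<le> (1 / e) * \<bar>x - y\<bar>" for x y
  proof -
    have "\<bar>\<phi> x - \<phi> y\<bar> \<le> \<bar>g x / e - g y / e\<bar>" unfolding \<phi>_def by (auto simp: min_def max_def)
    also have "\<dots> = (1 / e) * \<bar>g x - g y\<bar>" using assms(2) by (simp add: abs_divide flip: diff_divide_distrib)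
    also have "\<dots> \<le> (1 / e) * \<bar>x - y\<bar>" using g assms(2) by (intro mult_left_mono) auto
    finally show ?thesis .
  qed
  moreover have "\<phi> \<in> borel_measurable borel" unfolding \<phi>_def[abs_def] g_def by measurable
  moreover have "\<bar>\<phi> x\<bar> \<le> 1" for x unfolding \<phi>_def by auto
  moreover have "\<bar>\<phi> x - indicator {c..<d} x\<bar> \<le> indicator {c - e..c} x + indicator {d..d + e} x" for x
  proof -
    have 1: "\<phi> x = 1" if "c \<le> x" "x \<le> d" using that assms unfolding \<phi>_def g_def by (auto simp: min_def max_def)
    have 0: "\<phi> x = 0" if "x \<le> c - e \<or> d + e \<le> x"
    proof -
      have "g x \<le> - e" using that unfolding g_def by auto
      then have "g x / e \<le> - 1" using assms(2) by (simp add: pos_divide_le_eq)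
      then show ?thesis unfolding \<phi>_def by auto
    qed
    have "0 \<le> \<phi> x" "\<phi> x \<le> 1" unfolding \<phi>_def by auto
    then show ?thesis using 0 1 assms by (auto simp: indicator_def)
  qed
  ultimately show ?thesis using that by blast
qed

lemma diagonal_convergent_subseq:
  fixes f :: "nat \<Rightarrow> nat \<Rightarrow> real"
  assumes "\<And>k n. \<bar>f k n\<bar> \<le> C"
  obtains s where "strict_mono (s :: nat \<Rightarrow> nat)" "\<And>n. convergent (\<lambda>k. f (s k) n)"
proof -
  have "compact (PiE UNIV (\<lambda>_::nat. {- C..C}))"
    unfolding compactin_euclidean_iff[symmetric] euclidean_product_topology[symmetric] by (simp add: compactin_PiE)
  then have "seq_compact (PiE UNIV (\<lambda>_::nat. {- C..C}))" by (rule compact_imp_seq_compact)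
  moreover have "\<forall>k. f k \<in> PiE UNIV (\<lambda>_. {- C..C})" using assms by (auto simp: PiE_def abs_le_iff minus_le_iff)
  ultimately obtain l s where s: "strict_mono s" "(f \<circ> s) \<longlonglongrightarrow> l" unfolding seq_compact_def by blast
  have "(\<lambda>k. f (s k) n) \<longlonglongrightarrow> l n" for n
    using continuous_on_tendsto_compose[OF continuous_on_product_coordinates[of n] s(2)] by (simp add: o_def)
  then show ?thesis using that[OF s(1)] unfolding convergent_def by blast
qed

section \<open>Compactness\<close>

locale bv_family =
  fixes a b T M V :: real and U :: "nat \<Rightarrow> nat \<Rightarrow> real \<Rightarrow> real" and \<tau> :: "nat \<Rightarrow> real"
  assumes ab: "a < b" and T: "0 < T" and \<tau>: "\<And>k. 0 < \<tau> k" "\<tau> \<longlonglongrightarrow> 0"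
    and U [measurable]: "\<And>k n. U k n \<in> borel_measurable borel" and M: "\<And>k n x. \<bar>U k n x\<bar> \<le> M"
    and bv: "\<And>k n. \<exists>D. (AE x in lborel. x \<in> {a<..<b} \<longrightarrow> x \<in> D) \<and> bv_on D (U k n) V"
    and equicont: "\<And>\<phi> L \<epsilon>. \<phi> \<in> borel_measurable borel \<Longrightarrow> (\<And>x. \<bar>\<phi> x\<bar> \<le> 1) \<Longrightarrow> (\<And>x y. \<bar>\<phi> x - \<phi> y\<bar> \<le> L * \<bar>x - y\<bar>) \<Longrightarrow> 0 < \<epsilon> \<Longrightarrow>
      \<exists>\<delta>>0. \<forall>k m n. m \<le> n \<and> real n * \<tau> k \<le> T \<and> (real n - real m) * \<tau> k < \<delta> \<longrightarrow>
        \<bar>(LINT x|lborel. \<phi> x * U k n x * indicator {a<..<b} x) - (LINT x|lborel. \<phi> x * U k m x * indicator {a<..<b} x)\<bar> \<le> \<epsilon>"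
begin

definition N where "N k t = nat \<lfloor>t / \<tau> k\<rfloor>"

lemma N_le: "0 \<le> t \<Longrightarrow> real (N k t) * \<tau> k \<le> t"
  using \<tau>(1)[of k] unfolding N_def by (simp add: pos_le_divide_eq[symmetric])

lemma N_diff: "0 \<le> t \<Longrightarrow> 0 \<le> t' \<Longrightarrow> (real (N k t) - real (N k t')) * \<tau> k \<le> t - t' + \<tau> k"
proof -
  assume t: "0 \<le> t" "0 \<le> t'"
  have "t' / \<tau> k < real (N k t') + 1" using t \<tau>(1)[of k] unfolding N_def by (simp; linarith)
  then have "t' < (real (N k t') + 1) * \<tau> k" using \<tau>(1)[of k] by (simp add: pos_divide_less_eq)
  then show ?thesis using N_le[OF t(1), of k] by (simp add: algebra_simps)
qed

lemma N_mono: "t \<le> t' \<Longrightarrow> N k t \<le> N k t'"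
  using \<tau>(1)[of k] unfolding N_def by (intro nat_mono floor_mono divide_right_mono) auto

definition h where "h j = (b - a) / real (2 ^ j)"

lemma h_pos: "0 < h j" unfolding h_def using ab by simp

definition A where "A k t j i = cell_avg a (h j) (\<lambda>x. U k (N k t) x * indicator {a<..<b} x) i"

lemma M_nonneg: "0 \<le> M" using M[of 0 0 0] by linarith

lemma UI_le: "\<bar>U k n x * indicator {a<..<b} x\<bar> \<le> M" using M[of k n x] M_nonneg by (auto split: split_indicator)

lemma A_le: "\<bar>A k t j i\<bar> \<le> M"
  unfolding A_def by (rule cell_avg_le[OF _ UI_le h_pos]) simp

lemma test_integrable:
  assumes [measurable]: "\<phi> \<in> borel_measurable borel" and "\<And>x. \<bar>\<phi> x\<bar> \<le> 1"
  shows "integrable lborel (\<lambda>x. \<phi> x * U k n x * indicator {a<..<b} x)"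
proof (rule integrable_of_bounded_on_interval)
  fix x
  have "\<bar>\<phi> x\<bar> * \<bar>U k n x\<bar> \<le> 1 * M" using assms(2) M by (intro mult_mono) auto
  then show "\<bar>\<phi> x * U k n x * indicator {a<..<b} x\<bar> \<le> M * indicator {a<..<b} x"
    by (auto simp: abs_mult split: split_indicator)
qed (use ab in auto)

lemma A_equicont:
  assumes "0 < \<epsilon>"
  obtains \<delta> K where "0 < \<delta>" "\<And>k t t'. K \<le> k \<Longrightarrow> t \<in> {0..T} \<Longrightarrow> t' \<in> {0..T} \<Longrightarrow> \<bar>t - t'\<bar> < \<delta> \<Longrightarrow> \<bar>A k t j i - A k t' j i\<bar> \<le> \<epsilon>"
proof -
  define c d where "c = a + real i * h j" and "d = a + real (Suc i) * h j"
  have cd: "c < d" unfolding c_def d_def using h_pos[of j] by simp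
  define e where "e = \<epsilon> * h j / (8 * (M + 1))"
  have e: "0 < e" unfolding e_def using assms h_pos[of j] M_nonneg by simp
  obtain \<phi> where \<phi> [measurable]: "\<phi> \<in> borel_measurable borel" and \<phi>1: "\<And>x. \<bar>\<phi> x\<bar> \<le> 1"
    "\<And>x y. \<bar>\<phi> x - \<phi> y\<bar> \<le> (1 / e) * \<bar>x - y\<bar>" and ap: "\<And>x. \<bar>\<phi> x - indicator {c..<d} x\<bar> \<le> indicator {c - e..c} x + indicator {d..d + e} x"
    by (rule lipschitz_cell_cutoff[OF cd e], rule that)
  have "0 < \<epsilon> * h j / 2" using assms h_pos[of j] by simp
  from equicont[OF \<phi> \<phi>1 this]
  obtain \<delta> where \<delta>: "0 < \<delta>" "\<And>k m n. m \<le> n \<Longrightarrow> real n * \<tau> k \<le> T \<Longrightarrow> (real n - real m) * \<tau> k < \<delta> \<Longrightarrow>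
        \<bar>(LINT x|lborel. \<phi> x * U k n x * indicator {a<..<b} x) - (LINT x|lborel. \<phi> x * U k m x * indicator {a<..<b} x)\<bar> \<le> \<epsilon> * h j / 2"
    by auto
  have close: "\<bar>(LINT x|lborel. \<phi> x * U k n x * indicator {a<..<b} x) - (LINT x|lborel. U k n x * indicator {a<..<b} x * indicator {c..<d} x)\<bar> \<le> \<epsilon> * h j / 4" for k n
  proof -
    let ?f = "\<lambda>x. \<phi> x * U k n x * indicator {a<..<b} x" and ?g = "\<lambda>x. U k n x * indicator {a<..<b} x * indicator {c..<d} x"
    have int: "integrable lborel ?f" by (rule test_integrable[OF \<phi> \<phi>1(1)])
    have int': "integrable lborel ?g"
      using test_integrable[of "indicator {c..<d}" k n] by (auto simp: mult_ac split: split_indicator)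
    have ii: "integrable lborel (\<lambda>x. M * (indicator {c - e..c} x + indicator {d..d + e} x))"
      by (intro integrable_mult_right Bochner_Integration.integrable_add integrable_real_indicator) (use e in auto)
    have "\<bar>(LINT x|lborel. ?f x) - (LINT x|lborel. ?g x)\<bar> = \<bar>LINT x|lborel. ?f x - ?g x\<bar>"
      using int int' by simp
    also have "\<dots> \<le> (LINT x|lborel. \<bar>?f x - ?g x\<bar>)" by (rule integral_abs_bound)
    also have "\<dots> \<le> (LINT x|lborel. M * (indicator {c - e..c} x + indicator {d..d + e} x))"
    proof (rule integral_mono[OF _ ii])
      show "integrable lborel (\<lambda>x. \<bar>?f x - ?g x\<bar>)" using int int' by auto
      fix x
      have "\<bar>?f x - ?g x\<bar> = \<bar>U k n x * indicator {a<..<b} x\<bar> * \<bar>\<phi> x - indicator {c..<d} x\<bar>"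
        unfolding abs_mult[symmetric] by (simp add: algebra_simps)
      also have "\<dots> \<le> M * (indicator {c - e..c} x + indicator {d..d + e} x)"
        by (rule mult_mono[OF UI_le ap M_nonneg]) simp
      finally show "\<bar>?f x - ?g x\<bar> \<le> M * (indicator {c - e..c} x + indicator {d..d + e} x)" .
    qed
    also have "\<dots> = M * (e + e)"
      by (subst integral_mult_right_zero, subst Bochner_Integration.integral_add) (use e in auto)
    also have "\<dots> \<le> (M + 1) * (e + e)" using e by (intro mult_right_mono) auto
    also have "\<dots> = (8 * (M + 1) * e) / 4" by simp
    also have "8 * (M + 1) * e = \<epsilon> * h j" unfolding e_def using M_nonneg by simp
    finally show ?thesis .
  qed
  obtain K where K: "\<And>k. K \<le> k \<Longrightarrow> \<tau> k < \<delta> / 2"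
    using \<tau>(2)[THEN order_tendstoD(2), of "\<delta> / 2"] \<delta>(1) unfolding eventually_sequentially by auto
  have main: "\<bar>A k t j i - A k t' j i\<bar> \<le> \<epsilon>" if k: "K \<le> k" and t: "t \<in> {0..T}" "t' \<in> {0..T}" and le: "t' \<le> t" "t - t' < \<delta> / 2" for k t t'
  proof -
    let ?I = "\<lambda>n. LINT x|lborel. \<phi> x * U k n x * indicator {a<..<b} x"
    let ?J = "\<lambda>n. LINT x|lborel. U k n x * indicator {a<..<b} x * indicator {c..<d} x"
    have "(real (N k t) - real (N k t')) * \<tau> k < \<delta>" using N_diff[of t t' k] K[OF k] t le by auto
    then have 1: "\<bar>?I (N k t) - ?I (N k t')\<bar> \<le> \<epsilon> * h j / 2"
      using N_mono[OF le(1)] N_le[of t k] t by (intro \<delta>(2)) auto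
    have 2: "\<bar>?J (N k t) - ?J (N k t')\<bar> \<le> \<epsilon> * h j" using 1 close[of k "N k t"] close[of k "N k t'"] by linarith
    have "A k t j i - A k t' j i = (?J (N k t) - ?J (N k t')) / h j"
      unfolding A_def cell_avg_def cell_def c_def[symmetric] d_def[symmetric] by (simp add: diff_divide_distrib)
    then show ?thesis using 2 h_pos[of j] by (simp add: abs_divide pos_divide_le_eq)
  qed
  show ?thesis
  proof (rule that[of "\<delta> / 2" K])
    show "\<bar>A k t j i - A k t' j i\<bar> \<le> \<epsilon>" if "K \<le> k" "t \<in> {0..T}" "t' \<in> {0..T}" "\<bar>t - t'\<bar> < \<delta> / 2" for k t t'
      using main[OF that(1-3)] main[OF that(1,3,2)] that(4) by (cases "t' \<le> t") (auto simp: abs_minus_commute)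
  qed (use \<delta> in auto)
qed

lemma avg_error:
  "(LINT x|lborel. \<bar>U k n x - cell_avg a (h j) (\<lambda>x. U k n x * indicator {a<..<b} x) (cell_index a (h j) x)\<bar> * indicator {a<..<b} x) \<le> h j * V"
proof -
  let ?f = "\<lambda>x. U k n x * indicator {a<..<b} x"
  obtain D where D: "AE x in lborel. x \<in> {a<..<b} \<longrightarrow> x \<in> D" "bv_on D (U k n) V" using bv by blast
  have D': "AE x in lborel. x \<in> {a<..<b} \<longrightarrow> x \<in> D \<inter> {a<..<b}" using D(1) by eventually_elim auto
  have "bv_on (D \<inter> {a<..<b}) ?f V"
    by (rule bv_on_cong[OF bv_on_subset[OF D(2)]]) auto
  from cell_avg_bv_bound[OF ab _ _ UI_le D' this, of "2 ^ j" "h j"]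
  have "(LINT x|lborel. \<bar>?f x - cell_avg a (h j) ?f (cell_index a (h j) x)\<bar> * indicator {a<..<b} x) \<le> h j * V"
    unfolding h_def by simp
  moreover have "(\<lambda>x. \<bar>?f x - cell_avg a (h j) ?f (cell_index a (h j) x)\<bar> * indicator {a<..<b} x) = (\<lambda>x. \<bar>U k n x - cell_avg a (h j) ?f (cell_index a (h j) x)\<bar> * indicator {a<..<b} x)"
    by (auto split: split_indicator)
  ultimately show ?thesis by simp
qed

lemma A_convergent_subseq:
  obtains s where "strict_mono (s :: nat \<Rightarrow> nat)" "\<And>t j i. t \<in> {0..T} \<Longrightarrow> convergent (\<lambda>k. A (s k) t j i)"
proof -
  define f where "f k n = (case from_nat n of (t :: rat, j, i) \<Rightarrow> A k (real_of_rat t) j i)" for k n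
  have "\<bar>f k n\<bar> \<le> M" for k n unfolding f_def by (auto simp: A_le split: prod.split)
  then obtain s where s: "strict_mono (s :: nat \<Rightarrow> nat)" "\<And>n. convergent (\<lambda>k. f (s k) n)"
    using diagonal_convergent_subseq[of f M] by blast
  have rat: "convergent (\<lambda>k. A (s k) (real_of_rat t) j i)" for t j i
    using s(2)[of "to_nat (t, j, i)"] unfolding f_def by simp
  have "convergent (\<lambda>k. A (s k) t j i)" if t: "t \<in> {0..T}" for t j i
  proof -
    have "Cauchy (\<lambda>k. A (s k) t j i)"
    proof (rule metric_CauchyI)
      fix \<epsilon> :: real assume \<epsilon>: "0 < \<epsilon>"
      obtain \<delta> K where \<delta>: "0 < \<delta>" "\<And>k t t'. K \<le> k \<Longrightarrow> t \<in> {0..T} \<Longrightarrow> t' \<in> {0..T} \<Longrightarrow> \<bar>t - t'\<bar> < \<delta> \<Longrightarrow> \<bar>A k t j i - A k t' j i\<bar> \<le> \<epsilon> / 4"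
        using A_equicont[of "\<epsilon> / 4" j i] \<epsilon> by auto
      obtain q where q: "real_of_rat q \<in> {0..T}" "\<bar>t - real_of_rat q\<bar> < \<delta>"
      proof -
        have "max 0 (t - \<delta>) < min T (t + \<delta>)" using t T \<delta>(1) by auto
        then obtain q where "max 0 (t - \<delta>) < real_of_rat q" "real_of_rat q < min T (t + \<delta>)" using of_rat_dense by blast
        then show ?thesis using that[of q] by auto
      qed
      obtain K' where K': "\<And>m n. K' \<le> m \<Longrightarrow> K' \<le> n \<Longrightarrow> dist (A (s m) (real_of_rat q) j i) (A (s n) (real_of_rat q) j i) < \<epsilon> / 4"
        using convergent_Cauchy[OF rat[of q j i]] \<epsilon> unfolding Cauchy_def by (metis zero_less_divide_iff zero_less_numeral)
      have "dist (A (s m) t j i) (A (s n) t j i) < \<epsilon>" if mn: "max K K' \<le> m" "max K K' \<le> n" for m n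
      proof -
        have "K \<le> s m" "K \<le> s n" using mn seq_suble[OF s(1)] by (meson max.boundedE order_trans)+
        then have "\<bar>A (s m) t j i - A (s m) (real_of_rat q) j i\<bar> \<le> \<epsilon> / 4" "\<bar>A (s n) t j i - A (s n) (real_of_rat q) j i\<bar> \<le> \<epsilon> / 4"
          using \<delta>(2) t q by blast+
        moreover have "\<bar>A (s m) (real_of_rat q) j i - A (s n) (real_of_rat q) j i\<bar> < \<epsilon> / 4"
          using K'[of m n] mn by (simp add: dist_real_def)
        ultimately show ?thesis unfolding dist_real_def using \<epsilon> by linarith
      qed
      then show "\<exists>K. \<forall>m\<ge>K. \<forall>n\<ge>K. dist (A (s m) t j i) (A (s n) t j i) < \<epsilon>" by blast
    qed
    then show ?thesis by (simp add: Cauchy_convergent_iff)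
  qed
  then show ?thesis using that s(1) by blast
qed

definition l1_norm where "l1_norm f = (LINT x|lborel. \<bar>f x\<bar> * indicator {a<..<b} x)" for f :: "real \<Rightarrow> real"

lemma l1_norm_integrable:
  fixes f :: "real \<Rightarrow> real"
  assumes "f \<in> borel_measurable borel" "\<And>x. \<bar>f x\<bar> \<le> C"
  shows "integrable lborel (\<lambda>x. \<bar>f x\<bar> * indicator {a<..<b} x)"
  by (rule integrable_of_bounded_on_interval[where K=C]) (use assms ab in \<open>auto split: split_indicator\<close>)

lemma l1_norm_nonneg: "0 \<le> l1_norm f" unfolding l1_norm_def by (rule integral_nonneg_AE) auto

lemma l1_norm_triangle:
  assumes [measurable]: "f \<in> borel_measurable borel" "g \<in> borel_measurable borel" "w \<in> borel_measurable borel"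
    and "\<And>x. \<bar>f x\<bar> \<le> C" "\<And>x. \<bar>g x\<bar> \<le> C" "\<And>x. \<bar>w x\<bar> \<le> C"
  shows "l1_norm (\<lambda>x. f x - g x) \<le> l1_norm (\<lambda>x. f x - w x) + l1_norm (\<lambda>x. w x - g x)"
proof -
  have le: "\<bar>u x - v x\<bar> \<le> 2 * C" if "\<And>x. \<bar>u x\<bar> \<le> C" "\<And>x. \<bar>v x\<bar> \<le> C" for u v :: "real \<Rightarrow> real" and x
    using that(1)[of x] that(2)[of x] by linarith
  have i: "integrable lborel (\<lambda>x. \<bar>f x - g x\<bar> * indicator {a<..<b} x)" "integrable lborel (\<lambda>x. \<bar>f x - w x\<bar> * indicator {a<..<b} x)"
    "integrable lborel (\<lambda>x. \<bar>w x - g x\<bar> * indicator {a<..<b} x)"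
    by (rule l1_norm_integrable[OF _ le]; use assms in simp)+
  have "l1_norm (\<lambda>x. f x - g x) \<le> (LINT x|lborel. \<bar>f x - w x\<bar> * indicator {a<..<b} x + \<bar>w x - g x\<bar> * indicator {a<..<b} x)"
    unfolding l1_norm_def
    by (rule integral_mono[OF i(1)]) (use i in \<open>auto split: split_indicator\<close>)
  then show ?thesis unfolding l1_norm_def using i by simp
qed

lemma l1_norm_sym: "l1_norm (\<lambda>x. f x - g x) = l1_norm (\<lambda>x. g x - f x)"
  unfolding l1_norm_def by (simp add: abs_minus_commute)

lemma l1_norm_dominated:
  fixes f :: "nat \<Rightarrow> real \<Rightarrow> real" and g :: "real \<Rightarrow> real"
  assumes [measurable]: "\<And>k. f k \<in> borel_measurable borel" "g \<in> borel_measurable borel"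
    and "\<And>k x. \<bar>f k x\<bar> \<le> C" "\<And>x. \<bar>g x\<bar> \<le> C" and ae: "AE x in lborel. x \<in> {a<..<b} \<longrightarrow> (\<lambda>k. f k x) \<longlonglongrightarrow> g x"
  shows "(\<lambda>k. l1_norm (\<lambda>x. f k x - g x)) \<longlonglongrightarrow> 0"
proof -
  have "(\<lambda>k. LINT x|lborel. \<bar>f k x - g x\<bar> * indicator {a<..<b} x) \<longlonglongrightarrow> (LINT x|(lborel :: real measure). (0::real))"
  proof (rule integral_dominated_convergence[where w="\<lambda>x. 2 * C * indicator {a<..<b} x"])
    show "integrable lborel (\<lambda>x. 2 * C * indicator {a<..<b} x)"
      by (intro integrable_mult_right integrable_real_indicator) (use ab in auto)
    show "AE x in lborel. (\<lambda>k. \<bar>f k x - g x\<bar> * indicator {a<..<b} x) \<longlonglongrightarrow> 0"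
      using ae
    proof eventually_elim
      case (elim x)
      show ?case
      proof (cases "x \<in> {a<..<b}")
        case True
        then have "(\<lambda>k. \<bar>f k x - g x\<bar>) \<longlonglongrightarrow> \<bar>g x - g x\<bar>" using elim by (intro tendsto_intros) auto
        then show ?thesis using True by simp
      qed simp
    qed
    show "AE x in lborel. norm (\<bar>f k x - g x\<bar> * indicator {a<..<b} x) \<le> 2 * C * indicator {a<..<b} x" for k
    proof (rule AE_I2)
      fix x show "norm (\<bar>f k x - g x\<bar> * indicator {a<..<b} x) \<le> 2 * C * indicator {a<..<b} x"
        using assms(3)[of k x] assms(4)[of x] by (auto split: split_indicator)
    qed
  qed auto
  then show ?thesis unfolding l1_norm_def by simp
qed

lemma h_tendsto: "(\<lambda>j. h j * c) \<longlonglongrightarrow> 0" and summable_h: "summable (\<lambda>j. h j * c)"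
proof -
  have eq: "(\<lambda>j. h j * c) = (\<lambda>j. (b - a) * c * (1 / 2) ^ j)" unfolding h_def by (auto simp: field_simps power_one_over)
  show "summable (\<lambda>j. h j * c)" unfolding eq by (intro summable_mult summable_geometric) simp
  then show "(\<lambda>j. h j * c) \<longlonglongrightarrow> 0" by (rule summable_LIMSEQ_zero)
qed

lemma V_nonneg: "0 \<le> V" using bv[of 0 0] bv_on_nonneg by blast

theorem compactness:
  obtains s u where "strict_mono (s :: nat \<Rightarrow> nat)" "(\<lambda>(t, x). u t x) \<in> borel_measurable (borel \<Otimes>\<^sub>M borel)"
    "\<And>t x. \<bar>u t x\<bar> \<le> M" "\<And>t. t \<in> {0..T} \<Longrightarrow> (\<lambda>k. l1_norm (\<lambda>x. U (s k) (N (s k) t) x - u t x)) \<longlonglongrightarrow> 0"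
proof -
  obtain s where s: "strict_mono (s :: nat \<Rightarrow> nat)" "\<And>t j i. t \<in> {0..T} \<Longrightarrow> convergent (\<lambda>k. A (s k) t j i)"
    using A_convergent_subseq by blast
  define Lm where "Lm t j i = lim (\<lambda>k. A (s k) t j i)" for t j i
  define uj where "uj j t x = Lm t j (cell_index a (h j) x)" for j t x
  define u where "u t x = max (- M) (min M (lim (\<lambda>j. uj j t x)))" for t x
  have N_meas [measurable]: "N k \<in> measurable borel (count_space UNIV)" for k
    unfolding N_def[abs_def] by measurable
  have A_meas [measurable]: "(\<lambda>t. A k t j i) \<in> borel_measurable borel" for k j i
    unfolding A_def by (rule measurable_compose[OF N_meas]) simp
  have L_meas [measurable]: "(\<lambda>t. Lm t j i) \<in> borel_measurable borel" for j i
    unfolding Lm_def by (rule borel_measurable_lim_metric) simp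
  have uj_meas [measurable]: "(\<lambda>p. uj j (fst p) (snd p)) \<in> borel_measurable (borel \<Otimes>\<^sub>M borel)" for j
    unfolding uj_def by (rule measurable_compose_countable[where f="\<lambda>i p. Lm (fst p) j i"]) measurable
  have u_meas: "(\<lambda>p. u (fst p) (snd p)) \<in> borel_measurable (borel \<Otimes>\<^sub>M borel)"
    unfolding u_def by (intro borel_measurable_max borel_measurable_min borel_measurable_const borel_measurable_lim_metric uj_meas)
  have uj_t [measurable]: "uj j t \<in> borel_measurable borel" for j t
    unfolding uj_def[abs_def] by (rule measurable_compose[OF measurable_cell_index]) simp
  have u_t [measurable]: "u t \<in> borel_measurable borel" for t
    unfolding u_def[abs_def] by (intro borel_measurable_max borel_measurable_min borel_measurable_const borel_measurable_lim_metric uj_t)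
  have u_le: "\<bar>u t x\<bar> \<le> M" for t x unfolding u_def using M_nonneg by auto
  have main: "(\<lambda>k. l1_norm (\<lambda>x. U (s k) (N (s k) t) x - u t x)) \<longlonglongrightarrow> 0" if t: "t \<in> {0..T}" for t
  proof -
    define W where "W j k x = A (s k) t j (cell_index a (h j) x)" for j k x
    have W_meas [measurable]: "W j k \<in> borel_measurable borel" for j k
      unfolding W_def[abs_def] by (rule measurable_compose[OF measurable_cell_index]) simp
    have W_le: "\<bar>W j k x\<bar> \<le> M" for j k x unfolding W_def by (rule A_le)
    have L_lim: "(\<lambda>k. A (s k) t j i) \<longlonglongrightarrow> Lm t j i" for j i
      using s(2)[OF t] unfolding Lm_def by (simp add: convergent_LIMSEQ_iff)
    have "\<bar>Lm t j i\<bar> \<le> M" for j i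
      by (rule LIMSEQ_le_const2[OF tendsto_rabs[OF L_lim]]) (use A_le in auto)
    then have uj_le: "\<bar>uj j t x\<bar> \<le> M" for j x unfolding uj_def .
    have Wu: "(\<lambda>k. l1_norm (\<lambda>x. W j k x - uj j t x)) \<longlonglongrightarrow> 0" for j
      by (rule l1_norm_dominated[where C=M]) (use W_le uj_le L_lim in \<open>auto simp: W_def uj_def\<close>)
    have UW: "l1_norm (\<lambda>x. U (s k) (N (s k) t) x - W j k x) \<le> h j * V" for j k
      using avg_error[of "s k" "N (s k) t" j] unfolding l1_norm_def W_def A_def .
    have step: "l1_norm (\<lambda>x. uj j t x - uj (Suc j) t x) \<le> h j * V + h (Suc j) * V" for j
    proof (rule LIMSEQ_le_const)
      show "(\<lambda>k. l1_norm (\<lambda>x. W j k x - uj j t x) + (h j * V + h (Suc j) * V) + l1_norm (\<lambda>x. W (Suc j) k x - uj (Suc j) t x)) \<longlonglongrightarrow> h j * V + h (Suc j) * V"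
        using tendsto_add[OF tendsto_add[OF Wu[of j] tendsto_const[of "h j * V + h (Suc j) * V"]] Wu[of "Suc j"]] by simp
      have "l1_norm (\<lambda>x. uj j t x - uj (Suc j) t x) \<le> l1_norm (\<lambda>x. W j k x - uj j t x) + (h j * V + h (Suc j) * V) + l1_norm (\<lambda>x. W (Suc j) k x - uj (Suc j) t x)" for k
      proof -
        let ?U = "U (s k) (N (s k) t)"
        have "l1_norm (\<lambda>x. uj j t x - uj (Suc j) t x) \<le> l1_norm (\<lambda>x. uj j t x - W j k x) + l1_norm (\<lambda>x. W j k x - uj (Suc j) t x)"
          by (rule l1_norm_triangle[where C=M]) (use uj_le W_le in auto)
        moreover have "l1_norm (\<lambda>x. W j k x - uj (Suc j) t x) \<le> l1_norm (\<lambda>x. W j k x - ?U x) + l1_norm (\<lambda>x. ?U x - uj (Suc j) t x)"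
          by (rule l1_norm_triangle[where C=M]) (use uj_le W_le M in auto)
        moreover have "l1_norm (\<lambda>x. ?U x - uj (Suc j) t x) \<le> l1_norm (\<lambda>x. ?U x - W (Suc j) k x) + l1_norm (\<lambda>x. W (Suc j) k x - uj (Suc j) t x)"
          by (rule l1_norm_triangle[where C=M]) (use uj_le W_le M in auto)
        ultimately show ?thesis
          using UW[of k j] UW[of k "Suc j"] l1_norm_sym[of "uj j t" "W j k"] l1_norm_sym[of "W j k" ?U] by linarith
      qed
      then show "\<exists>K. \<forall>k\<ge>K. l1_norm (\<lambda>x. uj j t x - uj (Suc j) t x) \<le> l1_norm (\<lambda>x. W j k x - uj j t x) + (h j * V + h (Suc j) * V) + l1_norm (\<lambda>x. W (Suc j) k x - uj (Suc j) t x)"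
        by blast
    qed
    define g where "g j x = \<bar>uj j t x - uj (Suc j) t x\<bar> * indicator {a<..<b} x" for j x
    have [measurable]: "g j \<in> borel_measurable borel" for j unfolding g_def[abs_def] by measurable
    have g_nn: "0 \<le> g j x" for j x unfolding g_def by simp
    have g_int: "integrable lborel (g j)" for j unfolding g_def[abs_def]
    proof (rule l1_norm_integrable[where C="2 * M"])
      show "\<bar>uj j t x - uj (Suc j) t x\<bar> \<le> 2 * M" for x using uj_le[of j x] uj_le[of "Suc j" x] by linarith
    qed simp
    have "(\<integral>\<^sup>+x. (\<Sum>j. ennreal (g j x)) \<partial>lborel) = (\<Sum>j. \<integral>\<^sup>+x. ennreal (g j x) \<partial>lborel)"
      by (rule nn_integral_suminf) simp
    also have "\<dots> = (\<Sum>j. ennreal (l1_norm (\<lambda>x. uj j t x - uj (Suc j) t x)))"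
      unfolding l1_norm_def g_def[symmetric] by (simp add: nn_integral_eq_integral[OF g_int AE_I2[OF g_nn]])
    also have "\<dots> \<le> (\<Sum>j. ennreal (h j * V + h (Suc j) * V))"
      by (intro suminf_le ennreal_leI step summableI)
    also have "\<dots> = ennreal (\<Sum>j. h j * V + h (Suc j) * V)"
    proof (rule suminf_ennreal2)
      show "0 \<le> h j * V + h (Suc j) * V" for j using h_pos[of j] h_pos[of "Suc j"] V_nonneg by (simp add: less_imp_le)
      show "summable (\<lambda>j. h j * V + h (Suc j) * V)"
        using summable_h[of V] summable_Suc_iff[of "\<lambda>j. h j * V"] by (intro summable_add) auto
    qed
    finally have "(\<integral>\<^sup>+x. (\<Sum>j. ennreal (g j x)) \<partial>lborel) \<noteq> \<infinity>" by (auto simp: top_unique)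
    then have "AE x in lborel. (\<Sum>j. ennreal (g j x)) \<noteq> \<infinity>" by (intro nn_integral_noteq_infinite) auto
    then have "AE x in lborel. x \<in> {a<..<b} \<longrightarrow> (\<lambda>j. uj j t x) \<longlonglongrightarrow> u t x"
    proof eventually_elim
      case (elim x)
      show ?case
      proof
        assume x: "x \<in> {a<..<b}"
        have "summable (\<lambda>j. g j x)" using elim g_nn by (intro summable_suminf_not_top) auto
        then have "summable (\<lambda>j. \<bar>uj (Suc j) t x - uj j t x\<bar>)" using x unfolding g_def by (simp add: abs_minus_commute)
        then have "summable (\<lambda>j. uj (Suc j) t x - uj j t x)" by (rule summable_rabs_cancel)
        then obtain l where "(\<lambda>n. \<Sum>j<n. uj (Suc j) t x - uj j t x) \<longlonglongrightarrow> l" unfolding summable_def sums_def by blast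
        then have "(\<lambda>n. uj n t x - uj 0 t x) \<longlonglongrightarrow> l" by (simp add: sum_lessThan_telescope[of "\<lambda>j. uj j t x"])
        from tendsto_add[OF this tendsto_const[of "uj 0 t x"]] have lim: "(\<lambda>n. uj n t x) \<longlonglongrightarrow> l + uj 0 t x" by simp
        have "\<bar>l + uj 0 t x\<bar> \<le> M" by (rule LIMSEQ_le_const2[OF tendsto_rabs[OF lim]]) (use uj_le in auto)
        then have "u t x = l + uj 0 t x" unfolding u_def limI[OF lim] by auto
        then show "(\<lambda>j. uj j t x) \<longlonglongrightarrow> u t x" using lim by simp
      qed
    qed
    then have uju: "(\<lambda>j. l1_norm (\<lambda>x. uj j t x - u t x)) \<longlonglongrightarrow> 0"
      by (intro l1_norm_dominated[where C=M]) (use uj_le u_le in auto)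
    show ?thesis
    proof (rule LIMSEQ_I)
      fix \<epsilon> :: real assume \<epsilon>: "0 < \<epsilon>"
      have "eventually (\<lambda>j. h j * V < \<epsilon> / 3 \<and> l1_norm (\<lambda>x. uj j t x - u t x) < \<epsilon> / 3) sequentially"
        using order_tendstoD(2)[OF h_tendsto, of "\<epsilon> / 3" V] order_tendstoD(2)[OF uju, of "\<epsilon> / 3"] \<epsilon> by (auto intro: eventually_conj)
      then obtain j where j: "h j * V < \<epsilon> / 3" "l1_norm (\<lambda>x. uj j t x - u t x) < \<epsilon> / 3"
        unfolding eventually_sequentially by blast
      obtain K where K: "\<And>k. K \<le> k \<Longrightarrow> l1_norm (\<lambda>x. W j k x - uj j t x) < \<epsilon> / 3"
        using order_tendstoD(2)[OF Wu[of j], of "\<epsilon> / 3"] \<epsilon> unfolding eventually_sequentially by auto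
      have "norm (l1_norm (\<lambda>x. U (s k) (N (s k) t) x - u t x) - 0) < \<epsilon>" if k: "K \<le> k" for k
      proof -
        let ?U = "U (s k) (N (s k) t)"
        have "l1_norm (\<lambda>x. ?U x - u t x) \<le> l1_norm (\<lambda>x. ?U x - W j k x) + l1_norm (\<lambda>x. W j k x - u t x)"
          by (rule l1_norm_triangle[where C=M]) (use u_le W_le M in auto)
        moreover have "l1_norm (\<lambda>x. W j k x - u t x) \<le> l1_norm (\<lambda>x. W j k x - uj j t x) + l1_norm (\<lambda>x. uj j t x - u t x)"
          by (rule l1_norm_triangle[where C=M]) (use u_le W_le uj_le in auto)
        ultimately have "l1_norm (\<lambda>x. ?U x - u t x) < \<epsilon>" using UW[of k j] K[OF k] j by linarith
        then show ?thesis using l1_norm_nonneg[of "\<lambda>x. ?U x - u t x"] by simp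
      qed
      then show "\<exists>K. \<forall>k\<ge>K. norm (l1_norm (\<lambda>x. U (s k) (N (s k) t) x - u t x) - 0) < \<epsilon>" by blast
    qed
  qed
  show ?thesis
    by (rule that[OF s(1) _ u_le main]) (use u_meas in \<open>simp_all add: case_prod_beta\<close>)
qed

end

section \<open>Mixed Lebesgue norms\<close>

lemma enn_powr_ennreal: "0 \<le> x \<Longrightarrow> enn_powr (ennreal x) e = ennreal (x powr e)"
  unfolding enn_powr_def by simp

lemma Lq_norm_cong_AE:
  assumes "AE x in lborel. x \<in> {a<..<b} \<longrightarrow> f x = g x"
  shows "Lq_norm q a b f = Lq_norm q a b g"
proof -
  have "(\<integral>\<^sup>+ x \<in> {a<..<b}. ennreal (\<bar>f x\<bar> powr q) \<partial>lborel) = (\<integral>\<^sup>+ x \<in> {a<..<b}. ennreal (\<bar>g x\<bar> powr q) \<partial>lborel)"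
    by (rule nn_integral_cong_AE, use assms in eventually_elim) (auto split: split_indicator)
  then show ?thesis unfolding Lq_norm_def by simp
qed

lemma Lq_norm_bounded:
  fixes w :: "real \<Rightarrow> real"
  assumes ab: "a < b" and q: "1 \<le> q" and [measurable]: "w \<in> borel_measurable borel" and C: "\<And>x. \<bar>w x\<bar> \<le> C"
  shows "Lq_norm q a b w = ennreal ((LINT x|lborel. \<bar>w x\<bar> powr q * indicator {a<..<b} x) powr (1 / q))"
    and "(LINT x|lborel. \<bar>w x\<bar> powr q * indicator {a<..<b} x) \<le> C powr q * (b - a)"
    and "(LINT x|lborel. \<bar>w x\<bar> powr q * indicator {a<..<b} x) \<le> C powr (q - 1) * (LINT x|lborel. \<bar>w x\<bar> * indicator {a<..<b} x)"
proof -
  let ?f = "\<lambda>x. \<bar>w x\<bar> powr q * indicator {a<..<b} x"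
  have le: "\<bar>?f x\<bar> \<le> C powr q * indicator {a<..<b} x" for x
    using C[of x] q by (auto split: split_indicator intro!: powr_mono2)
  have m: "?f \<in> borel_measurable borel" by measurable
  note i = integrable_of_bounded_on_interval[OF m le less_imp_le[OF ab]]
  have nn: "0 \<le> (LINT x|lborel. ?f x)" by (rule integral_nonneg_AE) auto
  have "(\<integral>\<^sup>+ x \<in> {a<..<b}. ennreal (\<bar>w x\<bar> powr q) \<partial>lborel) = (\<integral>\<^sup>+ x. ennreal (?f x) \<partial>lborel)"
    by (rule nn_integral_cong) (auto split: split_indicator)
  also have "\<dots> = ennreal (LINT x|lborel. ?f x)" by (rule nn_integral_eq_integral[OF i(1)]) auto
  finally show "Lq_norm q a b w = ennreal ((LINT x|lborel. ?f x) powr (1 / q))"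
    unfolding Lq_norm_def using enn_powr_ennreal[OF nn] by simp
  show "(LINT x|lborel. ?f x) \<le> C powr q * (b - a)" using i(2) by linarith
  have C0: "0 \<le> C" using C[of 0] by linarith
  have j: "integrable lborel (\<lambda>x. C powr (q - 1) * (\<bar>w x\<bar> * indicator {a<..<b} x))"
    by (intro integrable_mult_right integrable_of_bounded_on_interval(1)[of _ C a b])
       (use C ab in \<open>auto split: split_indicator\<close>)
  have "(LINT x|lborel. ?f x) \<le> (LINT x|lborel. C powr (q - 1) * (\<bar>w x\<bar> * indicator {a<..<b} x))"
  proof (rule integral_mono[OF i(1) j])
    fix x
    have "\<bar>w x\<bar> powr q = \<bar>w x\<bar> powr (q - 1) * \<bar>w x\<bar>"
    proof (cases "w x = 0")
      case False
      then show ?thesis using powr_add[of "\<bar>w x\<bar>" "q - 1" 1] by simp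
    qed simp
    also have "\<dots> \<le> C powr (q - 1) * \<bar>w x\<bar>" using C[of x] q by (intro mult_right_mono powr_mono2) auto
    finally show "?f x \<le> C powr (q - 1) * (\<bar>w x\<bar> * indicator {a<..<b} x)" by (auto split: split_indicator)
  qed
  then show "(LINT x|lborel. ?f x) \<le> C powr (q - 1) * (LINT x|lborel. \<bar>w x\<bar> * indicator {a<..<b} x)" by simp
qed

lemma LpLq_norm_bounded:
  assumes T: "0 < T" and p: "1 \<le> p" and [measurable]: "y \<in> borel_measurable borel" and y: "\<And>t. 0 \<le> y t" "\<And>t. y t \<le> C"
    and eq: "\<And>t. t \<in> {0<..<T} \<Longrightarrow> Lq_norm q a b (f t) = ennreal (y t)"
  shows "LpLq_norm p q T a b f = ennreal ((LINT t|lborel. y t powr p * indicator {0<..<T} t) powr (1 / p))"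
proof -
  let ?g = "\<lambda>t. y t powr p * indicator {0<..<T} t"
  have le: "\<bar>?g t\<bar> \<le> C powr p * indicator {0<..<T} t" for t
    using y[of t] p by (auto split: split_indicator intro!: powr_mono2)
  have m: "?g \<in> borel_measurable borel" by measurable
  have i: "integrable lborel ?g" by (rule integrable_of_bounded_on_interval[OF m le less_imp_le[OF T]])
  have nn: "0 \<le> (LINT t|lborel. ?g t)" by (rule integral_nonneg_AE) auto
  have "(\<integral>\<^sup>+ t \<in> {0<..<T}. enn_powr (Lq_norm q a b (f t)) p \<partial>lborel) = (\<integral>\<^sup>+ t. ennreal (?g t) \<partial>lborel)"
    by (rule nn_integral_cong) (use y in \<open>auto simp: eq enn_powr_ennreal split: split_indicator\<close>)
  also have "\<dots> = ennreal (LINT t|lborel. ?g t)" by (rule nn_integral_eq_integral[OF i]) auto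
  finally show ?thesis unfolding LpLq_norm_def using enn_powr_ennreal[OF nn] by simp
qed

context bv_family begin

lemma strong_convergence:
  fixes f :: "nat \<Rightarrow> real \<Rightarrow> real \<Rightarrow> real" and s :: "nat \<Rightarrow> nat"
  assumes p: "1 \<le> p" and q: "1 \<le> q"
    and u: "(\<lambda>(t, x). u t x) \<in> borel_measurable (borel \<Otimes>\<^sub>M borel)" "\<And>t x. \<bar>u t x\<bar> \<le> M"
    and conv: "\<And>t. t \<in> {0..T} \<Longrightarrow> (\<lambda>k. l1_norm (\<lambda>x. U (s k) (N (s k) t) x - u t x)) \<longlonglongrightarrow> 0"
    and f: "\<And>k t. t \<in> {0..T} \<Longrightarrow> AE x in lborel. x \<in> {a<..<b} \<longrightarrow> f k t x = U (s k) (N (s k) t) x"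
  shows "in_LpLq p q T a b u" "(\<lambda>k. LpLq_norm p q T a b (\<lambda>t x. f k t x - u t x)) \<longlonglongrightarrow> 0"
    "\<And>t. set_borel_measurable borel {a<..<b} (u t)"
    "\<And>t. t \<in> {0..T} \<Longrightarrow> (\<lambda>k. Lq_norm q a b (\<lambda>x. f k t x - u t x)) \<longlonglongrightarrow> 0"
proof -
  note u(1)[measurable]
  have u_t [measurable]: "u t \<in> borel_measurable borel" for t
    using measurable_compose_Pair1[OF _ u(1), of t] by simp
  have N_meas [measurable]: "N k \<in> measurable borel (count_space UNIV)" for k
    unfolding N_def[abs_def] by measurable
  show ut: "set_borel_measurable borel {a<..<b} (u t)" for t unfolding set_borel_measurable_def by measurable
  define w where "w k t x = U (s k) (N (s k) t) x - u t x" for k t x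
  define X where "X k t = (LINT x|lborel. \<bar>w k t x\<bar> powr q * indicator {a<..<b} x)" for k t
  have [measurable]: "w k t \<in> borel_measurable borel" for k t unfolding w_def[abs_def] by measurable
  have w_le: "\<bar>w k t x\<bar> \<le> 2 * M" for k t x unfolding w_def using M[of "s k" "N (s k) t" x] u(2)[of t x] by linarith
  have U_meas [measurable]: "(\<lambda>z. U (s k) (N (s k) (fst z)) (snd z)) \<in> borel_measurable (borel \<Otimes>\<^sub>M borel)" for k
    by (rule measurable_compose_countable[where f="\<lambda>n z. U (s k) n (snd z)" and g="\<lambda>z. N (s k) (fst z)"]) measurable
  have u_meas [measurable]: "(\<lambda>z. u (fst z) (snd z)) \<in> borel_measurable (borel \<Otimes>\<^sub>M borel)" using u(1) by (simp add: case_prod_beta')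
  have X_meas [measurable]: "X k \<in> borel_measurable borel" for k
    unfolding X_def[abs_def] by (rule lborel.borel_measurable_lebesgue_integral) (simp add: w_def case_prod_beta')
  have X0: "0 \<le> X k t" for k t unfolding X_def by (rule integral_nonneg_AE) auto
  have Lq: "Lq_norm q a b (w k t) = ennreal (X k t powr (1 / q))" for k t
    unfolding X_def by (rule Lq_norm_bounded[OF ab q _ w_le]) simp
  have Xb: "X k t \<le> (2 * M) powr q * (b - a)" for k t
    unfolding X_def by (rule Lq_norm_bounded[OF ab q _ w_le]) simp
  have Xt: "(\<lambda>k. X k t) \<longlonglongrightarrow> 0" if t: "t \<in> {0..T}" for t
  proof (rule tendsto_sandwich[OF _ _ tendsto_const])
    show "eventually (\<lambda>k. X k t \<le> (2 * M) powr (q - 1) * l1_norm (w k t)) sequentially"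
      unfolding X_def l1_norm_def by (intro always_eventually allI Lq_norm_bounded(3)[OF ab q _ w_le]) simp
    show "(\<lambda>k. (2 * M) powr (q - 1) * l1_norm (w k t)) \<longlonglongrightarrow> 0"
      using tendsto_mult[OF tendsto_const conv[OF t]] unfolding w_def by simp
  qed (use X0 in auto)
  have Xq: "(\<lambda>k. X k t powr (1 / q)) \<longlonglongrightarrow> 0" if t: "t \<in> {0..T}" for t
    by (rule tendsto_zero_powrI[OF Xt[OF t] tendsto_const]) (use X0 q in auto)
  have fw: "Lq_norm q a b (\<lambda>x. f k t x - u t x) = Lq_norm q a b (w k t)" if t: "t \<in> {0..T}" for k t
    by (rule Lq_norm_cong_AE, use f[OF t] in eventually_elim) (auto simp: w_def)
  show "(\<lambda>k. Lq_norm q a b (\<lambda>x. f k t x - u t x)) \<longlonglongrightarrow> 0" if t: "t \<in> {0..T}" for t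
    using tendsto_ennrealI[OF Xq[OF t]] unfolding fw[OF t] Lq by simp
  define C where "C = ((2 * M) powr q * (b - a)) powr (1 / q)"
  have yC: "X k t powr (1 / q) \<le> C" for k t unfolding C_def using Xb X0 q by (intro powr_mono2) auto
  have Lp: "LpLq_norm p q T a b (\<lambda>t x. f k t x - u t x) = ennreal ((LINT t|lborel. (X k t powr (1 / q)) powr p * indicator {0<..<T} t) powr (1 / p))" for k
    by (rule LpLq_norm_bounded[OF T p, where C=C]) (use yC in \<open>auto simp: fw Lq\<close>)
  have "(\<lambda>k. LINT t|lborel. (X k t powr (1 / q)) powr p * indicator {0<..<T} t) \<longlonglongrightarrow> (LINT t|(lborel :: real measure). (0::real))"
  proof (rule integral_dominated_convergence[where w="\<lambda>t. C powr p * indicator {0<..<T} t"])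
    show "integrable lborel (\<lambda>t. C powr p * indicator {0<..<T} t)"
      by (intro integrable_mult_right integrable_real_indicator) (use T in auto)
    show "AE t in lborel. (\<lambda>k. (X k t powr (1 / q)) powr p * indicator {0<..<T} t) \<longlonglongrightarrow> 0"
    proof (rule AE_I2)
      fix t
      show "(\<lambda>k. (X k t powr (1 / q)) powr p * indicator {0<..<T} t) \<longlonglongrightarrow> 0"
      proof (cases "t \<in> {0<..<T}")
        case True
        then have "(\<lambda>k. (X k t powr (1 / q)) powr p) \<longlonglongrightarrow> 0"
          using p by (intro tendsto_zero_powrI[OF Xq tendsto_const]) auto
        then show ?thesis using True by simp
      qed simp
    qed
    show "AE t in lborel. norm ((X k t powr (1 / q)) powr p * indicator {0<..<T} t) \<le> C powr p * indicator {0<..<T} t" for k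
      using yC[of k] p by (intro AE_I2) (auto split: split_indicator intro!: powr_mono2)
  qed auto
  then have "(\<lambda>k. (LINT t|lborel. (X k t powr (1 / q)) powr p * indicator {0<..<T} t) powr (1 / p)) \<longlonglongrightarrow> 0"
    using p by (intro tendsto_zero_powrI[OF _ tendsto_const]) (auto intro!: always_eventually integral_nonneg_AE)
  from tendsto_ennrealI[OF this] show "(\<lambda>k. LpLq_norm p q T a b (\<lambda>t x. f k t x - u t x)) \<longlonglongrightarrow> 0"
    unfolding Lp by simp
  define Y where "Y t = (LINT x|lborel. \<bar>u t x\<bar> powr q * indicator {a<..<b} x) powr (1 / q)" for t
  have [measurable]: "(\<lambda>t. LINT x|lborel. \<bar>u t x\<bar> powr q * indicator {a<..<b} x) \<in> borel_measurable borel"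
    by (rule lborel.borel_measurable_lebesgue_integral) (simp add: case_prod_beta')
  have [measurable]: "Y \<in> borel_measurable borel" unfolding Y_def[abs_def] by measurable
  have YC: "Y t \<le> (M powr q * (b - a)) powr (1 / q)" for t
    unfolding Y_def using Lq_norm_bounded(2)[OF ab q u_t u(2), of t] q by (intro powr_mono2) (auto intro!: integral_nonneg_AE)
  have "LpLq_norm p q T a b u = ennreal ((LINT t|lborel. Y t powr p * indicator {0<..<T} t) powr (1 / p))"
    by (rule LpLq_norm_bounded[OF T p _ _ YC]) (use Lq_norm_bounded(1)[OF ab q u_t u(2)] in \<open>auto simp: Y_def\<close>)
  moreover have "set_borel_measurable borel ({0<..<T} \<times> {a<..<b}) (\<lambda>(t, x). u t x)"
  proof -
    have "(\<lambda>z. indicator ({0<..<T} \<times> {a<..<b}) z * u (fst z) (snd z)) \<in> borel_measurable (borel \<Otimes>\<^sub>M borel)" by measurable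
    then show ?thesis unfolding set_borel_measurable_def borel_prod by (simp add: case_prod_beta')
  qed
  ultimately show "in_LpLq p q T a b u" unfolding in_LpLq_def using ut
    by (auto intro!: exI[of _ u])
qed

end

section \<open>Convergence of the scheme\<close>

context splitting_data begin

lemma scheme_bv_family:
  fixes sig r :: "real \<Rightarrow> nat \<Rightarrow> real \<Rightarrow> real" and \<tau> :: "nat \<Rightarrow> real" and D :: "real \<Rightarrow> nat \<Rightarrow> real set"
  assumes \<tau>: "\<And>k. 0 < \<tau> k" "\<tau> \<longlonglongrightarrow> 0"
    and good: "\<And>k n. real n * \<tau> k \<le> T \<Longrightarrow> good_state a b Mx Vx Vx (sig (\<tau> k) n) (r (\<tau> k) n) (D (\<tau> k) n)"
    and est: "\<And>k \<phi> L m n \<omega>. \<phi> \<in> borel_measurable borel \<Longrightarrow> (\<And>x. \<bar>\<phi> x\<bar> \<le> 1) \<Longrightarrow> (\<And>x y. \<bar>\<phi> x - \<phi> y\<bar> \<le> L * \<bar>x - y\<bar>) \<Longrightarrow>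
      m \<le> n \<Longrightarrow> real n * \<tau> k \<le> T \<Longrightarrow> 0 < \<omega> \<Longrightarrow>
      \<bar>(LINT x|lborel. \<phi> x * (wt c (r (\<tau> k) n x) * sig (\<tau> k) n x * indicator (D (\<tau> k) n) x)) - (LINT x|lborel. \<phi> x * (wt c (r (\<tau> k) m x) * sig (\<tau> k) m x * indicator (D (\<tau> k) m) x))\<bar>
       \<le> L * (Mx * (b - a) * ((real n - real m) * \<tau> k) / \<omega> + C3 * \<omega>) + C2 * ((real n - real m) * \<tau> k)"
    and U: "\<And>k n x. U k n x = (if real n * \<tau> k \<le> T then wt c (r (\<tau> k) n x) * sig (\<tau> k) n x * indicator (D (\<tau> k) n) x else 0)"
  shows "bv_family a b T Mx (Vx + Mx * Vx) U \<tau>"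
proof
  show "a < b" "0 < T" by (rule ab, rule T)
  show "0 < \<tau> k" for k by (rule \<tau>)
  show "\<tau> \<longlonglongrightarrow> 0" by (rule \<tau>)
  have U_in: "U k n = (\<lambda>x. wt c (r (\<tau> k) n x) * sig (\<tau> k) n x * indicator (D (\<tau> k) n) x)" if "real n * \<tau> k \<le> T" for k n
    using that unfolding U by auto
  have U_out: "U k n = (\<lambda>x. 0)" if "\<not> real n * \<tau> k \<le> T" for k n
    using that unfolding U by auto
  have nonneg: "0 \<le> Vx + Mx * Vx"
  proof -
    have "bv_on (D (\<tau> 0) 0) (sig (\<tau> 0) 0) Vx" using good[of 0 0] T unfolding good_state_def by simp
    then show ?thesis using bv_on_nonneg Mx_nonneg by fastforce
  qed
  show "U k n \<in> borel_measurable borel" for k n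
    using U_in[of n k] U_out[of n k] good_state_measurable(4)[OF good, of n k c] by (cases "real n * \<tau> k \<le> T") auto
  show "\<bar>U k n x\<bar> \<le> Mx" for k n x
  proof (cases "real n * \<tau> k \<le> T \<and> x \<in> D (\<tau> k) n")
    case True
    then have bd: "0 \<le> sig (\<tau> k) n x \<and> sig (\<tau> k) n x \<le> Mx \<and> 0 \<le> r (\<tau> k) n x \<and> r (\<tau> k) n x \<le> 1"
      using good[of n k] unfolding good_state_def by blast
    then have "0 \<le> wt c (r (\<tau> k) n x)" "wt c (r (\<tau> k) n x) \<le> 1" using wt_bounds by blast+
    moreover from this have "wt c (r (\<tau> k) n x) * sig (\<tau> k) n x \<le> 1 * Mx" using bd by (intro mult_mono) auto
    ultimately show ?thesis using True bd unfolding U by simp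
  qed (use Mx_nonneg in \<open>auto simp: U\<close>)
  show "\<exists>D. (AE x in lborel. x \<in> {a<..<b} \<longrightarrow> x \<in> D) \<and> bv_on D (U k n) (Vx + Mx * Vx)" for k n
  proof (cases "real n * \<tau> k \<le> T")
    case True
    have "bv_on (D (\<tau> k) n) (U k n) (Vx + Mx * Vx)"
      by (rule bv_on_cong[OF wt_state_bv[OF good[OF True], of c]]) (simp add: U_in[OF True])
    then show ?thesis using good[OF True] unfolding good_state_def by blast
  next
    case False
    have "bv_on UNIV (U k n) (Vx + Mx * Vx)"
      unfolding bv_on_def U_out[OF False] by (rule exI[of _ "\<lambda>_. 0"]) (use nonneg in \<open>auto simp: mono_def\<close>)
    then show ?thesis by (intro exI[of _ UNIV]) auto
  qed
  fix \<phi> :: "real \<Rightarrow> real" and L \<epsilon> :: real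
  assume \<phi>: "\<phi> \<in> borel_measurable borel" "\<And>x. \<bar>\<phi> x\<bar> \<le> 1" "\<And>x y. \<bar>\<phi> x - \<phi> y\<bar> \<le> L * \<bar>x - y\<bar>" and \<epsilon>: "0 < \<epsilon>"
  have L0: "0 \<le> L" using \<phi>(3)[of 0 1] by (simp add: abs_le_iff)
  have LC: "0 \<le> L * C3" using L0 C3_nonneg by simp
  define \<omega> where "\<omega> = \<epsilon> / (2 * (L * C3 + 1))"
  have \<omega>: "0 < \<omega>" unfolding \<omega>_def using \<epsilon> LC by simp
  have Lw: "L * C3 * \<omega> \<le> \<epsilon> / 2"
  proof -
    have "L * C3 * \<omega> \<le> (L * C3 + 1) * \<omega>" using \<omega> by (intro mult_right_mono) auto
    also have "\<dots> = \<epsilon> / 2" unfolding \<omega>_def using LC by (simp add: field_simps)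
    finally show ?thesis .
  qed
  define Q where "Q = L * (Mx * (b - a)) / \<omega> + C2 + 1"
  have C20: "0 \<le> C2" unfolding C2_def using \<kappa>0 Mx_nonneg ab by simp
  have Q: "1 \<le> Q" unfolding Q_def using L0 Mx_nonneg ab \<omega> C20 by simp
  define \<delta> where "\<delta> = \<epsilon> / (2 * Q)"
  have \<delta>: "0 < \<delta>" unfolding \<delta>_def using \<epsilon> Q by simp
  show "\<exists>\<delta>>0. \<forall>k m n. m \<le> n \<and> real n * \<tau> k \<le> T \<and> (real n - real m) * \<tau> k < \<delta> \<longrightarrow>
        \<bar>(LINT x|lborel. \<phi> x * U k n x * indicator {a<..<b} x) - (LINT x|lborel. \<phi> x * U k m x * indicator {a<..<b} x)\<bar> \<le> \<epsilon>"
  proof (intro exI[of _ \<delta>] conjI \<delta> allI impI)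
    fix k m n assume h: "m \<le> n \<and> real n * \<tau> k \<le> T \<and> (real n - real m) * \<tau> k < \<delta>"
    have mT: "real m * \<tau> k \<le> T"
      using h \<tau>(1)[of k] by (meson mult_right_mono of_nat_le_iff order_trans less_imp_le)
    have eq: "(LINT x|lborel. \<phi> x * U k n x * indicator {a<..<b} x) = (LINT x|lborel. \<phi> x * (wt c (r (\<tau> k) n x) * sig (\<tau> k) n x * indicator (D (\<tau> k) n) x))"
      if n: "real n * \<tau> k \<le> T" for n
    proof (rule Bochner_Integration.integral_cong[OF refl])
      fix x
      have "D (\<tau> k) n \<subseteq> {a<..<b}" using good[OF n] unfolding good_state_def by blast
      then show "\<phi> x * U k n x * indicator {a<..<b} x = \<phi> x * (wt c (r (\<tau> k) n x) * sig (\<tau> k) n x * indicator (D (\<tau> k) n) x)"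
        unfolding U_in[OF n] by (auto split: split_indicator)
    qed
    define z where "z = (real n - real m) * \<tau> k"
    have z: "0 \<le> z" "z < \<delta>" unfolding z_def using h \<tau>(1)[of k] by auto
    have "\<bar>(LINT x|lborel. \<phi> x * U k n x * indicator {a<..<b} x) - (LINT x|lborel. \<phi> x * U k m x * indicator {a<..<b} x)\<bar>
      \<le> L * (Mx * (b - a) * z / \<omega> + C3 * \<omega>) + C2 * z"
      unfolding eq[OF mT] eq[OF conjunct1[OF conjunct2[OF h]]] z_def by (rule est) (use \<phi> h \<omega> in auto)
    also have "\<dots> = (Q - 1) * z + L * C3 * \<omega>" unfolding Q_def by (simp add: algebra_simps)
    also have "\<dots> \<le> Q * \<delta> + \<epsilon> / 2" using z Q Lw by (intro add_mono mult_mono) auto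
    also have "Q * \<delta> = \<epsilon> / 2" unfolding \<delta>_def using Q by simp
    finally show "\<bar>(LINT x|lborel. \<phi> x * U k n x * indicator {a<..<b} x) - (LINT x|lborel. \<phi> x * U k m x * indicator {a<..<b} x)\<bar> \<le> \<epsilon>" by simp
  qed
qed

end

theorem mainTheorem15:
  fixes chi :: "real \<Rightarrow> real"
    and F1 F2 G1 G2 :: "real \<Rightarrow> real \<Rightarrow> real"
    and a b T p q :: real
    and \<rho>0 \<eta>0 r0 :: "real \<Rightarrow> real"
    and sig r sigh rh rho eta :: "real \<Rightarrow> nat \<Rightarrow> real \<Rightarrow> real"
  assumes "a < b" and "0 < T" and "1 \<le> p" and "1 \<le> q"
    and "internal_energy chi"
    and "bdd_lip F1" and "bdd_lip F2" and "bdd_lip G1" and "bdd_lip G2"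
    and "\<forall>y\<ge>0. G1 0 y \<ge> 0" and "\<forall>x\<ge>0. G2 x 0 \<ge> 0"
    and "is_BV \<rho>0 a b" and "is_BV \<eta>0 a b"
    and "\<exists>M. \<forall>x\<in>{a<..<b}. \<bar>\<rho>0 x\<bar> \<le> M" and "\<exists>M. \<forall>x\<in>{a<..<b}. \<bar>\<eta>0 x\<bar> \<le> M"
    and "\<forall>x\<in>{a..b}. \<rho>0 x \<ge> 0 \<and> \<eta>0 x \<ge> 0"
    and "is_BV r0 a b" and "\<forall>x\<in>{a..b}. 0 \<le> r0 x \<and> r0 x \<le> 1"
    and "\<forall>x\<in>{a..b}. \<rho>0 x + \<eta>0 x > 0 \<longrightarrow> r0 x = \<rho>0 x / (\<rho>0 x + \<eta>0 x)"
    and "\<And>\<tau>. admissible_step T \<tau> \<Longrightarrow>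
           splitting_scheme chi F1 F2 G1 G2 a b T \<tau> (\<lambda>x. \<rho>0 x + \<eta>0 x) r0
             (sig \<tau>) (r \<tau>) (sigh \<tau>) (rh \<tau>) (rho \<tau>) (eta \<tau>)"
  shows "\<exists>(\<rho> :: real \<Rightarrow> real \<Rightarrow> real) (\<eta> :: real \<Rightarrow> real \<Rightarrow> real) (\<tau>k :: nat \<Rightarrow> real).
     (\<forall>k. admissible_step T (\<tau>k k)) \<and> \<tau>k \<longlonglongrightarrow> 0 \<and>
     in_LpLq p q T a b \<rho> \<and> in_LpLq p q T a b \<eta> \<and>
     (\<lambda>k. LpLq_norm p q T a b
        (\<lambda>t x. rho_interp (\<tau>k k) (r (\<tau>k k)) (sig (\<tau>k k)) t x - \<rho> t x)) \<longlonglongrightarrow> 0 \<and>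
     (\<lambda>k. LpLq_norm p q T a b
        (\<lambda>t x. eta_interp (\<tau>k k) (r (\<tau>k k)) (sig (\<tau>k k)) t x - \<eta> t x)) \<longlonglongrightarrow> 0 \<and>
     (\<forall>t\<in>{0..T}.
        set_borel_measurable borel {a<..<b} (\<rho> t) \<and> set_borel_measurable borel {a<..<b} (\<eta> t) \<and>
        (\<lambda>k. Lq_norm q a b
           (\<lambda>x. rho_interp (\<tau>k k) (r (\<tau>k k)) (sig (\<tau>k k)) t x - \<rho> t x)) \<longlonglongrightarrow> 0 \<and>
        (\<lambda>k. Lq_norm q a b
           (\<lambda>x. eta_interp (\<tau>k k) (r (\<tau>k k)) (sig (\<tau>k k)) t x - \<eta> t x)) \<longlonglongrightarrow> 0)"
proof -
  note ab = assms(1) and T = assms(2) and p = assms(3) and q = assms(4) and chi = assms(5) and F = assms(6-9)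
  let ?\<sigma>0 = "\<lambda>x. \<rho>0 x + \<eta>0 x"
  obtain B where B: "0 \<le> B" "\<And>s r. 0 \<le> s \<Longrightarrow> 0 \<le> r \<Longrightarrow> r \<le> 1 \<Longrightarrow> \<bar>SigmaR F1 F2 G1 G2 s r\<bar> \<le> B * s"
    using SigmaR_growth[OF F] by blast
  obtain M1 where M1: "\<forall>x\<in>{a<..<b}. \<bar>\<rho>0 x\<bar> \<le> M1" using assms(14) by blast
  obtain M2 where M2: "\<forall>x\<in>{a<..<b}. \<bar>\<eta>0 x\<bar> \<le> M2" using assms(15) by blast
  define M0 where "M0 = max 0 (M1 + M2)"
  define Mx where "Mx = exp (B * T) * M0"
  have M0: "0 \<le> M0" and Mx: "0 \<le> Mx" unfolding M0_def Mx_def by simp_all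
  obtain \<kappa> where \<kappa>: "0 \<le> \<kappa>"
    "\<And>\<tau> s0 r0 s1 r1. 0 < \<tau> \<Longrightarrow> \<tau> \<le> 1 \<Longrightarrow> s0 \<le> Mx \<Longrightarrow>
       reaction_sol (SigmaR F1 F2 G1 G2) (RR F1 F2 G1 G2) \<tau> s0 r0 s1 r1 \<Longrightarrow>
       \<bar>s1 - s0\<bar> \<le> \<kappa> * \<tau> * s0 \<and> \<bar>r1 - r0\<bar> \<le> \<kappa> * \<tau>"
    "\<And>\<tau> s0 r0 s1 r1 s0' r0' s1' r1'. 0 < \<tau> \<Longrightarrow> \<tau> \<le> 1 \<Longrightarrow> s0 \<le> Mx \<Longrightarrow> s0' \<le> Mx \<Longrightarrow>
       reaction_sol (SigmaR F1 F2 G1 G2) (RR F1 F2 G1 G2) \<tau> s0 r0 s1 r1 \<Longrightarrow>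
       reaction_sol (SigmaR F1 F2 G1 G2) (RR F1 F2 G1 G2) \<tau> s0' r0' s1' r1' \<Longrightarrow>
       \<bar>s1 - s1'\<bar> \<le> \<bar>s0 - s0'\<bar> + \<kappa> * \<tau> * (\<bar>s0 - s0'\<bar> + \<bar>r0 - r0'\<bar>) \<and>
       \<bar>r1 - r1'\<bar> \<le> \<bar>r0 - r0'\<bar> + \<kappa> * \<tau> * (\<bar>s0 - s0'\<bar> + \<bar>r0 - r0'\<bar>)"
    by (rule reaction_estimates[OF F Mx B], assumption+, rule that)
  obtain V1 where V1: "bv_on {a<..<b} \<rho>0 V1" using bv_on_of_is_BV[OF assms(12)] .
  obtain V2 where V2: "bv_on {a<..<b} \<eta>0 V2" using bv_on_of_is_BV[OF assms(13)] .
  obtain W0 where W0: "bv_on {a<..<b} r0 W0" using bv_on_of_is_BV[OF assms(17)] .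
  have "bv_on {a<..<b} ?\<sigma>0 (1 * V1 + 1 * V2)"
    by (rule bv_on_combine[OF V1 V2]) auto
  moreover have "0 \<le> ?\<sigma>0 x \<and> ?\<sigma>0 x \<le> M0 \<and> 0 \<le> r0 x \<and> r0 x \<le> 1" if "x \<in> {a<..<b}" for x
  proof -
    have "x \<in> {a..b}" using that by simp
    then show ?thesis using assms(16,18) M1[rule_format, OF that] M2[rule_format, OF that] unfolding M0_def by auto
  qed
  ultimately have init: "good_state a b M0 (1 * V1 + 1 * V2) W0 ?\<sigma>0 r0 {a<..<b}"
    unfolding good_state_def using bv_on_subset[OF W0, of "{x \<in> {a<..<b}. 0 < ?\<sigma>0 x}", OF Collect_restrict] by auto
  interpret splitting_data chi F1 F2 G1 G2 a b T B \<kappa> M0 "1 * V1 + 1 * V2" W0 Mx ?\<sigma>0 r0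
    by unfold_locales (use ab T chi B \<kappa> M0 init in \<open>auto simp: Mx_def\<close>)
  define m where "m k = k + Suc (nat \<lceil>T\<rceil>)" for k
  have m: "T < real (m k)" for k
    using real_nat_ceiling_ge[of T] unfolding m_def of_nat_add of_nat_Suc by linarith
  define tk where "tk k = T / real (m k)" for k
  have tk_pos: "0 < tk k" for k unfolding tk_def using T m[of k] by simp
  have adm: "admissible_step T (tk k)" for k
  proof -
    have "tk k < 1" unfolding tk_def using T m[of k] by (simp add: pos_divide_less_eq)
    moreover have "real (m k) * tk k = T" unfolding tk_def using T m[of k] by simp
    ultimately show ?thesis unfolding admissible_step_def using tk_pos by blast
  qed
  have tk_lim: "tk \<longlonglongrightarrow> 0"
    unfolding tk_def[abs_def] m_def by (rule LIMSEQ_ignore_initial_segment[OF lim_const_over_n])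
  define P where "P \<tau> D \<longleftrightarrow> (\<forall>n. real n * \<tau> \<le> T \<longrightarrow> good_state a b Mx Vx Vx (sig \<tau> n) (r \<tau> n) (D n)) \<and>
      (\<forall>\<phi> L c m n \<omega>. \<phi> \<in> borel_measurable borel \<longrightarrow> (\<forall>x. \<bar>\<phi> x\<bar> \<le> 1) \<longrightarrow> (\<forall>x y. \<bar>\<phi> x - \<phi> y\<bar> \<le> L * \<bar>x - y\<bar>) \<longrightarrow>
      m \<le> n \<longrightarrow> real n * \<tau> \<le> T \<longrightarrow> 0 < \<omega> \<longrightarrow>
      \<bar>(LINT x|lborel. \<phi> x * (wt c (r \<tau> n x) * sig \<tau> n x * indicator (D n) x)) - (LINT x|lborel. \<phi> x * (wt c (r \<tau> m x) * sig \<tau> m x * indicator (D m) x))\<bar>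
       \<le> L * (Mx * (b - a) * ((real n - real m) * \<tau>) / \<omega> + C3 * \<omega>) + C2 * ((real n - real m) * \<tau>))" for \<tau> D
  have "\<exists>D. P \<tau> D" if "admissible_step T \<tau>" for \<tau>
    unfolding P_def by (rule scheme_estimates[OF that assms(20)[OF that]]) blast
  then obtain D where PD: "\<And>\<tau>. admissible_step T \<tau> \<Longrightarrow> P \<tau> (D \<tau>)" by metis
  have D: "good_state a b Mx Vx Vx (sig \<tau> n) (r \<tau> n) (D \<tau> n)" if "admissible_step T \<tau>" "real n * \<tau> \<le> T" for \<tau> n
    using PD[OF that(1)] that(2) unfolding P_def by blast
  have est: "\<bar>(LINT x|lborel. \<phi> x * (wt c (r \<tau> n x) * sig \<tau> n x * indicator (D \<tau> n) x)) - (LINT x|lborel. \<phi> x * (wt c (r \<tau> m x) * sig \<tau> m x * indicator (D \<tau> m) x))\<bar>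
       \<le> L * (Mx * (b - a) * ((real n - real m) * \<tau>) / \<omega> + C3 * \<omega>) + C2 * ((real n - real m) * \<tau>)"
    if "admissible_step T \<tau>" "\<phi> \<in> borel_measurable borel" "\<And>x. \<bar>\<phi> x\<bar> \<le> 1" "\<And>x y. \<bar>\<phi> x - \<phi> y\<bar> \<le> L * \<bar>x - y\<bar>"
      "m \<le> n" "real n * \<tau> \<le> T" "0 < \<omega>" for \<tau> \<phi> L c m n \<omega>
    using PD[OF that(1)] that(2-) unfolding P_def by blast
  define U where "U c \<tau> n x = (if real n * \<tau> \<le> T then wt c (r \<tau> n x) * sig \<tau> n x * indicator (D \<tau> n) x else 0)" for c \<tau> n x
  have fam: "bv_family a b T Mx (Vx + Mx * Vx) (\<lambda>k. U c (tk (g k))) (\<lambda>k. tk (g k))" if g: "(\<lambda>k. tk (g k)) \<longlonglongrightarrow> 0" for c and g :: "nat \<Rightarrow> nat"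
    by (rule scheme_bv_family[OF tk_pos g D[OF adm] est[OF adm] U_def])
  have interp: "AE x in lborel. x \<in> {a<..<b} \<longrightarrow> wt c (r \<tau> (nat \<lfloor>t / \<tau>\<rfloor>) x) * sig \<tau> (nat \<lfloor>t / \<tau>\<rfloor>) x = U c \<tau> (nat \<lfloor>t / \<tau>\<rfloor>) x"
    if \<tau>: "admissible_step T \<tau>" and t: "t \<in> {0..T}" for c \<tau> t
  proof -
    have "0 < \<tau>" using \<tau> by (simp add: admissible_step_def)
    then have "real (nat \<lfloor>t / \<tau>\<rfloor>) * \<tau> \<le> t" using t by (simp add: pos_le_divide_eq[symmetric])
    then have n: "real (nat \<lfloor>t / \<tau>\<rfloor>) * \<tau> \<le> T" using t by simp
    have "AE x in lborel. x \<in> {a<..<b} \<longrightarrow> x \<in> D \<tau> (nat \<lfloor>t / \<tau>\<rfloor>)" using D[OF \<tau> n] unfolding good_state_def by blast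
    then show ?thesis by eventually_elim (use n in \<open>auto simp: U_def\<close>)
  qed
  interpret A: bv_family a b T Mx "Vx + Mx * Vx" "\<lambda>k. U True (tk k)" tk
    using fam[of "\<lambda>k. k" True] tk_lim by simp
  obtain s1 \<rho> where s1: "strict_mono s1" "(\<lambda>(t, x). \<rho> t x) \<in> borel_measurable (borel \<Otimes>\<^sub>M borel)" "\<And>t x. \<bar>\<rho> t x\<bar> \<le> Mx"
    "\<And>t. t \<in> {0..T} \<Longrightarrow> (\<lambda>k. A.l1_norm (\<lambda>x. U True (tk (s1 k)) (A.N (s1 k) t) x - \<rho> t x)) \<longlonglongrightarrow> 0"
    using A.compactness by blast
  have tk1: "(\<lambda>k. tk (s1 k)) \<longlonglongrightarrow> 0" using LIMSEQ_subseq_LIMSEQ[OF tk_lim s1(1)] by (simp add: o_def)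
  interpret B: bv_family a b T Mx "Vx + Mx * Vx" "\<lambda>k. U False (tk (s1 k))" "\<lambda>k. tk (s1 k)"
    using fam[OF tk1] .
  obtain s2 \<eta> where s2: "strict_mono s2" "(\<lambda>(t, x). \<eta> t x) \<in> borel_measurable (borel \<Otimes>\<^sub>M borel)" "\<And>t x. \<bar>\<eta> t x\<bar> \<le> Mx"
    "\<And>t. t \<in> {0..T} \<Longrightarrow> (\<lambda>k. B.l1_norm (\<lambda>x. U False (tk (s1 (s2 k))) (B.N (s2 k) t) x - \<eta> t x)) \<longlonglongrightarrow> 0"
    using B.compactness by blast
  define \<tau>k where "\<tau>k k = tk (s1 (s2 k))" for k
  have admk: "admissible_step T (\<tau>k k)" for k unfolding \<tau>k_def by (rule adm)
  have limk: "\<tau>k \<longlonglongrightarrow> 0" unfolding \<tau>k_def[abs_def] using LIMSEQ_subseq_LIMSEQ[OF tk1 s2(1)] by (simp add: o_def)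
  have c1: "(\<lambda>k. A.l1_norm (\<lambda>x. U True (tk (s1 (s2 k))) (A.N (s1 (s2 k)) t) x - \<rho> t x)) \<longlonglongrightarrow> 0" if "t \<in> {0..T}" for t
    using LIMSEQ_subseq_LIMSEQ[OF s1(4)[OF that] s2(1)] by (simp add: o_def)
  have i1: "AE x in lborel. x \<in> {a<..<b} \<longrightarrow> rho_interp (\<tau>k k) (r (\<tau>k k)) (sig (\<tau>k k)) t x = U True (tk (s1 (s2 k))) (A.N (s1 (s2 k)) t) x"
    if "t \<in> {0..T}" for k t
    using interp[OF admk[of k] that, where c=True] unfolding A.N_def rho_interp_def wt_def \<tau>k_def by simp
  have i2: "AE x in lborel. x \<in> {a<..<b} \<longrightarrow> eta_interp (\<tau>k k) (r (\<tau>k k)) (sig (\<tau>k k)) t x = U False (tk (s1 (s2 k))) (B.N (s2 k) t) x"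
    if "t \<in> {0..T}" for k t
    using interp[OF admk[of k] that, where c=False] unfolding B.N_def eta_interp_def wt_def \<tau>k_def by simp
  note R = A.strong_convergence[where s="\<lambda>k. s1 (s2 k)", OF p q s1(2,3) c1 i1] and E = B.strong_convergence[OF p q s2(2,3,4) i2]
  show ?thesis
    by (intro exI[of _ \<rho>] exI[of _ \<eta>] exI[of _ \<tau>k] conjI allI ballI admk limk R E)
qed

end
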